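(* Let $n\ge 1$ and $p,q,k\in\mathbb Z_+$ be integers, and put $\gamma=n+p+q$. There is a constant $C=C(k,n,p,q)$, depending only on $k,n,p,q$, such that the following holds. Let $1\le r\le\infty$, let $P\in H_{p,q}$ be non-zero, and let $\tilde a$ be a radial function on $\mathbb C^n$ (written $\tilde a(z)=\tilde a(|z|)$) such that $\tilde aP\in L^r(\mathbb C^n)$. If $k\ge p$, then for all $z\in\mathbb C^n$ $$\tilde aP\times\varphi_k^{n-1}(z)=(2\pi)^{-n}\,C\,C_{k-p}^{\gamma-1}\,P(z)\,\varphi_{k-p}^{\gamma-1}(z),\qquad C_{k-p}^{\gamma-1}:=\int_0^\infty \tilde a(t)\,\varphi_{k-p}^{\gamma-1}(t)\,t^{2\gamma-1}\,dt,$$ and if $k<p$, then $\tilde aP\times\varphi_k^{n-1}=0$.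
   Context: $\mathbb Z_+=\{0,1,2,\dots\}$. The twisted convolution on $\mathbb C^n$ is $f\times g(z)=\int_{\mathbb C^n}f(z-w)g(w)e^{\frac i2\mathrm{Im}(z\cdot\bar w)}\,dw$, where $z\cdot\bar w=\sum_j z_j\bar w_j$ and $dw$ is Lebesgue measure. $H_{p,q}$ is the space of polynomials $P(z)=\sum_{|\alpha|=p}\sum_{|\beta|=q}c_{\alpha\beta}z^\alpha\bar z^\beta$ on $\mathbb C^n$ with $\Delta P=0$. For an integer $m\ge1$ and $k\in\mathbb Z_+$, the Laguerre function is the radial function $\varphi_k^{m-1}(z)=L_k^{m-1}(\tfrac12|z|^2)e^{-\frac14|z|^2}$, where $L_k^{\alpha}(x)=\sum_{i=0}^k(-1)^i\binom{\alpha+k}{k-i}\frac{x^i}{i!}$. As a function of $|z|$ it is also written $\varphi_k^{m-1}(t)=L_k^{m-1}(\tfrac12t^2)e^{-\frac14t^2}$ for $t\ge0$. In particular $\varphi_{k-p}^{\gamma-1}(z)$ for $z\in\mathbb C^n$ means $L_{k-p}^{\gamma-1}(\tfrac12|z|^2)e^{-\frac14|z|^2}$. *)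

theory Defs
  imports "HOL-Analysis.Analysis"
begin

text \<open>The space $\mathbb{C}^n$ is the type \<^typ>\<open>complex ^ 'n\<close> with \<open>n = CARD('n)\<close>;
  its norm is the Euclidean one, and \<^const>\<open>lebesgue\<close> on it is
  Lebesgue measure on $\mathbb{R}^{2n}$.\<close>

definition hermitian_dot :: "complex ^ 'n \<Rightarrow> complex ^ 'n \<Rightarrow> complex" where
  "hermitian_dot z w = (\<Sum>j\<in>UNIV. z $ j * cnj (w $ j))"

definition twisted_integrand ::
  "(complex ^ 'n \<Rightarrow> complex) \<Rightarrow> (complex ^ 'n \<Rightarrow> complex) \<Rightarrow> complex ^ 'n \<Rightarrow> complex ^ 'n \<Rightarrow> complex"
  where "twisted_integrand f g z w =
    f (z - w) * g w * exp (\<i> / 2 * complex_of_real (Im (hermitian_dot z w)))"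

definition twisted_conv ::
  "(complex ^ 'n \<Rightarrow> complex) \<Rightarrow> (complex ^ 'n \<Rightarrow> complex) \<Rightarrow> complex ^ 'n \<Rightarrow> complex"
  where "twisted_conv f g z = (LINT w|lebesgue. twisted_integrand f g z w)"

definition dir_deriv :: "'a::euclidean_space \<Rightarrow> ('a \<Rightarrow> complex) \<Rightarrow> 'a \<Rightarrow> complex" where
  "dir_deriv b f x = vector_derivative (\<lambda>t. f (x + t *\<^sub>R b)) (at 0)"

text \<open>On \<^typ>\<open>complex ^ 'n\<close> the standard real basis consists of the vectors with a single
  non-zero entry, equal to \<open>1\<close> or \<open>\<i>\<close>, so this is
  $\sum_j (\partial_{x_j}^2 + \partial_{y_j}^2)$.\<close>

definition laplacian :: "('a::euclidean_space \<Rightarrow> complex) \<Rightarrow> 'a \<Rightarrow> complex" where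
  "laplacian f x = (\<Sum>b\<in>Basis. dir_deriv b (dir_deriv b f) x)"

definition multi_indices :: "nat \<Rightarrow> ('n::finite \<Rightarrow> nat) set" where
  "multi_indices d = {\<alpha>. (\<Sum>j\<in>UNIV. \<alpha> j) = d}"

definition bihom_poly ::
  "nat \<Rightarrow> nat \<Rightarrow> (('n \<Rightarrow> nat) \<Rightarrow> ('n \<Rightarrow> nat) \<Rightarrow> complex) \<Rightarrow> complex ^ 'n \<Rightarrow> complex" where
  "bihom_poly p q c z =
    (\<Sum>\<alpha>\<in>multi_indices p. \<Sum>\<beta>\<in>multi_indices q.
       c \<alpha> \<beta> * (\<Prod>j\<in>UNIV. (z $ j) ^ \<alpha> j) * (\<Prod>j\<in>UNIV. cnj (z $ j) ^ \<beta> j))"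

definition bigraded_harmonics :: "nat \<Rightarrow> nat \<Rightarrow> (complex ^ 'n \<Rightarrow> complex) set" where
  "bigraded_harmonics p q =
    {P. (\<exists>c. P = bihom_poly p q c) \<and> (\<forall>z. laplacian P z = 0)}"

definition laguerre_poly :: "nat \<Rightarrow> nat \<Rightarrow> real \<Rightarrow> real" where
  "laguerre_poly \<alpha> k x = (\<Sum>i\<le>k. (-1) ^ i * real ((\<alpha> + k) choose (k - i)) * x ^ i / fact i)"

text \<open>\<open>laguerre_fun \<alpha> k\<close> is the radial profile of $\varphi_k^{\alpha}$ (superscript first);
  the function on $\mathbb{C}^n$ is \<open>\<lambda>z. laguerre_fun \<alpha> k (norm z)\<close>.\<close>

definition laguerre_fun :: "nat \<Rightarrow> nat \<Rightarrow> real \<Rightarrow> real" where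
  "laguerre_fun \<alpha> k t = laguerre_poly \<alpha> k (t\<^sup>2 / 2) * exp (- (t\<^sup>2) / 4)"

text \<open>Membership in $L^r$ for $1 \le r \le \infty$, for functions rather than classes
  modulo null sets.\<close>

definition Lr_space :: "ennreal \<Rightarrow> ('a::euclidean_space \<Rightarrow> complex) set" where
  "Lr_space r = {f. f \<in> borel_measurable lebesgue \<and>
     (if r = \<infinity> then \<exists>B. AE x in lebesgue. norm (f x) \<le> B
      else integrable lebesgue (\<lambda>x. norm (f x) powr enn2real r))}"

end

theory Submission
  imports Defs "HOL-Probability.Distributions"
begin

text \<open>Put \<open>x = \<bar>z\<bar>\<^sup>2/2\<close>, \<open>y = \<bar>u\<bar>\<^sup>2/2\<close> and \<open>s = z \<cdot> cnj u / 2\<close>. The substitution \<open>w = z - u\<close> turns the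
  twisted convolution into an integral of \<open>a(\<bar>u\<bar>) P(u)\<close> against \<open>exp (- \<bar>z\<bar>\<^sup>2/4) exp (- \<bar>u\<bar>\<^sup>2/4)\<close>
  times \<open>L\<^sub>k(x + y - s - cnj s) exp (cnj s)\<close>, where \<open>L\<^sub>k\<close> is the Laguerre polynomial of upper index
  \<open>n - 1\<close> (\<open>twisted_phase_eq_kernel\<close>). This factor is a power series in \<open>s\<close> and \<open>cnj s\<close> whose
  coefficients depend only on \<open>x\<close> and \<open>y\<close>, and its degree in \<open>s\<close> is at most \<open>k\<close>.

  For \<open>P\<close> harmonic of bidegree \<open>(p, q)\<close> and any radial weight, the integral of
  \<open>P(u) s^i (cnj s)^j\<close> vanishes unless \<open>i = p + m\<close> and \<open>j = q + m\<close> for some \<open>m \<ge> 0\<close>, and then it is an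
  explicit multiple of \<open>\<bar>z\<bar>^(2m) P(z)\<close>. This explains both why the convolution is \<open>P\<close> times a radial
  function and why it is zero for \<open>k < p\<close>. For the Gaussian weight the multiple is found by
  integration by parts with Wirtinger derivatives (\<open>gauss_integral_harmonic_zonal\<close>); harmonicity
  enters because all derivatives of \<open>P\<close> are harmonic and a harmonic polynomial of positive degree
  has Gaussian mean zero. Since the integrands are homogeneous, integration in polar coordinates
  (\<open>integral_polar\<close>) separates the radial weight from one spherical constant, which the Gaussian
  case has determined; this gives the multiple for the weight \<open>a\<close> (\<open>zonal_monomial_integral\<close>).

  After summation over \<open>i\<close>, \<open>j\<close> there remains a polynomial in \<open>x\<close> and \<open>y\<close>. It is a multiple of the
  product of the two Laguerre polynomials of degree \<open>k - p\<close> and upper index \<open>\<gamma> - 1\<close>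
  (\<open>laguerre_product\<close>), which comes down to a binomial identity of Saalschuetz type for each
  coefficient. The factor in \<open>y\<close> goes into the radial integral, the factor in \<open>x\<close> into the result.

  The power series in \<open>cnj s\<close> is exchanged with the integral by dominated convergence: the kernel and
  its partial sums are bounded by one multiple of \<open>exp (- \<bar>u\<bar>)\<close>, and every function in \<open>L^r\<close> with \<open>r \<ge> 1\<close> is bounded by a
  constant plus an integrable function (\<open>Lr_space_times_exp_decay_integrable\<close>). As only the product
  of the radial factor with \<open>P\<close> is known to be measurable, the radial factor is first replaced by a
  Borel function that agrees with it almost everywhere (\<open>radial_profile_borel\<close>).\<close>

section \<open>Laguerre polynomials\<close>

text \<open>Vandermonde's identity with one lower index reflected.\<close>

lemma vandermonde_absorb:
  fixes N M a :: nat
  shows "(\<Sum>i\<le>M. (M choose i) * (N choose (a + i))) = (N + M) choose (a + M)"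
proof -
  have "(\<Sum>i\<le>M. (M choose i) * (N choose (a + i))) = (\<Sum>i\<le>M. (M choose (M - i)) * (N choose (a + i)))"
    by (intro sum.cong) (auto simp: binomial_symmetric[symmetric])
  also have "\<dots> = (\<Sum>i\<in>{a..a+M}. (M choose (a + M - i)) * (N choose i))"
    by (rule sum.reindex_bij_witness[of _ "\<lambda>i. i - a" "\<lambda>i. i + a"]) (auto simp: add.commute)
  also have "\<dots> = (\<Sum>i\<le>a+M. (N choose i) * (M choose (a + M - i)))"
    by (rule sum.mono_neutral_cong_left) (auto simp: mult.commute)
  finally show ?thesis by (simp add: vandermonde)
qed

text \<open>Vandermonde's identity, applied three times: it splits the last binomial coefficient along
  \<open>(\<alpha> + K) + m\<close>, then it evaluates the sum over \<open>m\<close>, and after trinomial revision it evaluates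
  the sum over the expansion index.\<close>

lemma saalschuetz_binomial:
  fixes j l K \<alpha> :: nat
  assumes "j \<le> K" "l \<le> K"
  shows "(\<Sum>m\<le>l. (j choose m) * ((\<alpha> + l) choose (l - m)) * ((\<alpha> + K + m) choose (\<alpha> + j + l)))
       = ((\<alpha> + K) choose (\<alpha> + j)) * (K choose l)"
proof -
  have 1: "(\<alpha> + K + m) choose (\<alpha> + j + l)
      = (\<Sum>i\<le>l. (m choose i) * ((\<alpha> + K) choose (\<alpha> + j + l - i)))" if "m \<le> l" for m
  proof -
    have "(\<alpha> + K + m) choose (\<alpha> + j + l) = (\<Sum>i\<le>\<alpha>+j+l. (m choose i) * ((\<alpha> + K) choose (\<alpha> + j + l - i)))"
      using vandermonde[of m "\<alpha>+K" "\<alpha>+j+l"] by (simp add: add_ac)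
    also have "\<dots> = (\<Sum>i\<le>l. (m choose i) * ((\<alpha> + K) choose (\<alpha> + j + l - i)))"
      using that by (intro sum.mono_neutral_right) auto
    finally show ?thesis .
  qed
  have 2: "(\<Sum>m\<le>l. (j choose m) * (m choose i) * ((\<alpha> + l) choose (l - m)))
      = (j choose i) * ((\<alpha> + l + j - i) choose (l - i))" if "i \<le> l" for i
  proof (cases "i \<le> j")
    case True
    have "(\<Sum>m\<le>l. (j choose m) * (m choose i) * ((\<alpha> + l) choose (l - m)))
        = (\<Sum>m\<in>{i..l}. (j choose m) * (m choose i) * ((\<alpha> + l) choose (l - m)))"
      by (intro sum.mono_neutral_right) auto
    also have "\<dots> = (\<Sum>m\<in>{i..l}. (j choose i) * ((j - i) choose (m - i)) * ((\<alpha> + l) choose (l - m)))"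
    proof (intro sum.cong refl)
      fix m assume m: "m \<in> {i..l}"
      show "(j choose m) * (m choose i) * ((\<alpha> + l) choose (l - m)) =
        (j choose i) * ((j - i) choose (m - i)) * ((\<alpha> + l) choose (l - m))"
      proof (cases "m \<le> j")
        case True then show ?thesis using m choose_mult[of i m j] by simp
      next
        case False
        moreover from this have "j - i < m - i \<or> j < i" using m by auto
        ultimately show ?thesis by (auto simp: binomial_eq_0)
      qed
    qed
    also have "\<dots> = (\<Sum>r\<le>l-i. (j choose i) * ((j - i) choose r) * ((\<alpha> + l) choose (l - i - r)))"
      by (rule sum.reindex_bij_witness[of _ "\<lambda>r. r + i" "\<lambda>m. m - i"]) (use that in auto)
    also have "\<dots> = (j choose i) * ((j - i + (\<alpha> + l)) choose (l - i))"
      by (simp add: vandermonde[symmetric] sum_distrib_left mult.assoc)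
    finally show ?thesis using True by (simp add: add_ac)
  next
    case False
    then have z: "(j choose m) * (m choose i) = 0" for m
      by (cases "m \<le> j") auto
    show ?thesis unfolding z using False by simp
  qed
  have 3: "((\<alpha> + l + j - i) choose (l - i)) * ((\<alpha> + K) choose (\<alpha> + j + l - i))
      = ((\<alpha> + K) choose (\<alpha> + j)) * ((K - j) choose (l - i))" if "i \<le> l" for i
  proof (cases "j + l - i \<le> K")
    case True
    have "((\<alpha> + K) choose (\<alpha> + j + l - i)) * ((\<alpha> + j + l - i) choose (\<alpha> + j))
      = ((\<alpha> + K) choose (\<alpha> + j)) * ((K - j) choose (l - i))"
      using choose_mult[of "\<alpha> + j" "\<alpha> + j + l - i" "\<alpha> + K"] that True by simp
    moreover have "((\<alpha> + j + l - i) choose (\<alpha> + j)) = ((\<alpha> + l + j - i) choose (l - i))"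
      using that by (subst binomial_symmetric) (auto simp: add_ac)
    ultimately show ?thesis by (simp add: mult.commute)
  next
    case False
    then have "\<alpha> + K < \<alpha> + j + l - i" "K - j < l - i" using that assms by auto
    then show ?thesis by (simp add: binomial_eq_0)
  qed
  have "(\<Sum>m\<le>l. (j choose m) * ((\<alpha> + l) choose (l - m)) * ((\<alpha> + K + m) choose (\<alpha> + j + l)))
     = (\<Sum>m\<le>l. \<Sum>i\<le>l. (j choose m) * (m choose i) * ((\<alpha> + l) choose (l - m)) * ((\<alpha> + K) choose (\<alpha> + j + l - i)))"
    by (intro sum.cong refl) (simp add: 1 sum_distrib_left mult_ac)
  also have "\<dots> = (\<Sum>i\<le>l. \<Sum>m\<le>l. (j choose m) * (m choose i) * ((\<alpha> + l) choose (l - m)) * ((\<alpha> + K) choose (\<alpha> + j + l - i)))"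
    by (rule sum.swap)
  also have "\<dots> = (\<Sum>i\<le>l. (j choose i) * ((\<alpha> + l + j - i) choose (l - i)) * ((\<alpha> + K) choose (\<alpha> + j + l - i)))"
    by (intro sum.cong refl) (simp add: 2 sum_distrib_right[symmetric])
  also have "\<dots> = (\<Sum>i\<le>l. (j choose i) * (((\<alpha> + K) choose (\<alpha> + j)) * ((K - j) choose (l - i))))"
    by (intro sum.cong refl) (simp only: 3 mult.assoc atMost_iff)
  also have "\<dots> = ((\<alpha> + K) choose (\<alpha> + j)) * (\<Sum>i\<le>l. (j choose i) * ((K - j) choose (l - i)))"
    by (simp add: sum_distrib_left mult_ac)
  also have "(\<Sum>i\<le>l. (j choose i) * ((K - j) choose (l - i))) = K choose l"
    using vandermonde[of j "K-j" l] assms by simp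
  finally show ?thesis .
qed

text \<open>Writing the coefficient as \<open>(\<alpha> + k) choose (\<alpha> + i)\<close> makes it vanish for \<open>i > k\<close>, which
  allows sums over larger index ranges. Complex arguments are needed because \<open>L\<^sub>k\<close> is evaluated at
  points that involve the Hermitian product.\<close>

definition laguerre :: "nat \<Rightarrow> nat \<Rightarrow> 'a \<Rightarrow> 'a::{banach,real_normed_field}" where
  "laguerre \<alpha> k x = (\<Sum>i\<le>k. (-1) ^ i * of_nat ((\<alpha> + k) choose (\<alpha> + i)) * (x ^ i / fact i))"

lemma of_real_laguerre_poly: "of_real (laguerre_poly \<alpha> k x) = laguerre \<alpha> k (of_real x)"
proof -
  have "(\<alpha> + k) choose (k - i) = (\<alpha> + k) choose (\<alpha> + i)" if "i \<le> k" for i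
    using that by (subst binomial_symmetric) auto
  then show ?thesis
    by (simp add: laguerre_poly_def laguerre_def)
qed

text \<open>In terms of the divided powers \<open>x^i / i!\<close> the binomial theorem is a plain convolution, so a
  polynomial evaluated at a sum has coefficients that depend on the total degree only.\<close>

lemma sum_exp_coeff_add:
  fixes lc :: "nat \<Rightarrow> 'a::{banach,real_normed_field}"
  assumes "\<And>i. i > k \<Longrightarrow> lc i = 0"
  shows "(\<Sum>i\<le>k. lc i * ((x + y) ^ i / fact i))
       = (\<Sum>a\<le>k. \<Sum>b\<le>k. lc (a + b) * (x ^ a / fact a) * (y ^ b / fact b))"
proof -
  have "(\<Sum>i\<le>k. lc i * ((x + y) ^ i / fact i))
      = (\<Sum>i\<le>k. \<Sum>a\<le>i. lc i * (x ^ a / fact a) * (y ^ (i - a) / fact (i - a)))"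
  proof (intro sum.cong refl)
    fix i
    have "(x + y) ^ i / fact i = (\<Sum>a\<le>i. (x ^ a / fact a) * (y ^ (i - a) / fact (i - a)))"
      unfolding binomial_ring sum_divide_distrib
      by (intro sum.cong refl) (simp add: binomial_fact field_simps)
    then show "lc i * ((x + y) ^ i / fact i) = (\<Sum>a\<le>i. lc i * (x ^ a / fact a) * (y ^ (i - a) / fact (i - a)))"
      by (simp add: sum_distrib_left mult.assoc)
  qed
  also have "\<dots> = (\<Sum>(i,a)\<in>(SIGMA i:{..k}. {..i}). lc i * (x ^ a / fact a) * (y ^ (i - a) / fact (i - a)))"
    by (simp add: sum.Sigma)
  also have "\<dots> = (\<Sum>(a,b)\<in>{(a,b). a + b \<le> k}. lc (a + b) * (x ^ a / fact a) * (y ^ b / fact b))"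
    by (rule sum.reindex_bij_witness[of _ "\<lambda>(a,b). (a + b, a)" "\<lambda>(i,a). (a, i - a)"]) auto
  also have "\<dots> = (\<Sum>(a,b)\<in>{..k} \<times> {..k}. lc (a + b) * (x ^ a / fact a) * (y ^ b / fact b))"
    by (rule sum.mono_neutral_left) (use assms in \<open>auto simp: not_le intro: ccontr\<close>)
  finally show ?thesis by (simp add: sum.cartesian_product)
qed

lemma laguerre_add:
  "laguerre \<alpha> k (x + y) = (\<Sum>a\<le>k. \<Sum>b\<le>k. (-1) ^ (a + b) * of_nat ((\<alpha> + k) choose (\<alpha> + (a + b)))
     * (x ^ a / fact a) * (y ^ b / fact b))"
  unfolding laguerre_def
  by (rule sum_exp_coeff_add[where lc = "\<lambda>i. (-1) ^ i * of_nat ((\<alpha> + k) choose (\<alpha> + i))"]) simp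

lemma laguerre_add3:
  "laguerre \<alpha> k (x + y + z) = (\<Sum>a\<le>k. \<Sum>b\<le>k. \<Sum>c\<le>k. (-1) ^ (a + b + c) *
     of_nat ((\<alpha> + k) choose (\<alpha> + (a + b + c)))
     * (x ^ a / fact a) * (y ^ b / fact b) * (z ^ c / fact c))"
proof -
  let ?lc = "\<lambda>i. (-1) ^ i * of_nat ((\<alpha> + k) choose (\<alpha> + i))"
  have "laguerre \<alpha> k (x + (y + z)) = (\<Sum>a\<le>k. (x ^ a / fact a) * (\<Sum>b\<le>k. ?lc (a + b) * ((y + z) ^ b / fact b)))"
    by (simp add: laguerre_add sum_distrib_left mult_ac)
  also have "\<dots> = (\<Sum>a\<le>k. (x ^ a / fact a) * (\<Sum>b\<le>k. \<Sum>c\<le>k. ?lc (a + (b + c)) * (y ^ b / fact b) * (z ^ c / fact c)))"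
    by (intro sum.cong refl arg_cong[of _ _ "\<lambda>u. _ * u"] sum_exp_coeff_add) simp
  finally show ?thesis by (simp add: sum_distrib_left mult_ac add_ac)
qed

lemma exp_shift_sums:
  fixes w :: "'a::{banach,real_normed_field}"
  shows "(\<lambda>j. of_nat (j choose d) * (w ^ j / fact j)) sums (w ^ d / fact d * exp w)"
proof -
  have "(\<lambda>j. w ^ j / fact j) sums exp w"
    using exp_converges[of w] by (simp add: scaleR_conv_of_real field_simps)
  then have "(\<lambda>j. w ^ d / fact d * (w ^ j / fact j)) sums (w ^ d / fact d * exp w)"
    by (rule sums_mult)
  also have "(\<lambda>j. w ^ d / fact d * (w ^ j / fact j)) =
      (\<lambda>j. of_nat ((j + d) choose d) * (w ^ (j + d) / fact (j + d)))"
    by (rule ext) (simp add: binomial_fact power_add field_simps)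
  finally have *: "(\<lambda>j. of_nat ((j + d) choose d) * (w ^ (j + d) / fact (j + d))) sums (w ^ d / fact d * exp w)" .
  have "(\<lambda>j. of_nat (j choose d) * (w ^ j / fact j)) sums (w ^ d / fact d * exp w) \<longleftrightarrow>
    (\<lambda>j. of_nat ((j + d) choose d) * (w ^ (j + d) / fact (j + d))) sums
      (w ^ d / fact d * exp w - (\<Sum>j<d. of_nat (j choose d) * (w ^ j / fact j)))"
    by (rule sums_iff_shift'[symmetric])
  moreover have "(\<Sum>j<d. of_nat (j choose d) * (w ^ j / fact j)) = 0"
    by (intro sum.neutral) auto
  ultimately show ?thesis using * by simp
qed

text \<open>Multiplication by an exponential raises the upper index: the coefficient of
  \<open>w^j / j!\<close> is a Vandermonde sum over the powers of \<open>w\<close> that come from the polynomial.\<close>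

lemma laguerre_exp_sums:
  fixes w x :: "'a::{banach,real_normed_field}"
  shows "(\<lambda>j. w ^ j / fact j * laguerre (\<alpha> + j) k x) sums (laguerre \<alpha> k (x - w) * exp w)"
proof -
  let ?lc = "\<lambda>i. (-1) ^ i * of_nat ((\<alpha> + k) choose (\<alpha> + i)) :: 'a"
  let ?e = "\<lambda>x i. x ^ i / fact i :: 'a"
  have "(\<lambda>j. \<Sum>a\<le>k. \<Sum>d\<le>k. ?lc (a + d) * ?e x a * (-1) ^ d * (of_nat (j choose d) * ?e w j))
    sums (\<Sum>a\<le>k. \<Sum>d\<le>k. ?lc (a + d) * ?e x a * (-1) ^ d * (?e w d * exp w))"
    by (intro sums_sum sums_mult exp_shift_sums)
  also have "(\<Sum>a\<le>k. \<Sum>d\<le>k. ?lc (a + d) * ?e x a * (-1) ^ d * (?e w d * exp w))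
      = laguerre \<alpha> k (x + (- w)) * exp w"
    unfolding laguerre_add sum_distrib_right by (intro sum.cong refl) (simp add: power_minus[of w] mult_ac)
  also have "(\<lambda>j. \<Sum>a\<le>k. \<Sum>d\<le>k. ?lc (a + d) * ?e x a * (-1) ^ d * (of_nat (j choose d) * ?e w j))
      = (\<lambda>j. w ^ j / fact j * laguerre (\<alpha> + j) k x)"
  proof
    fix j
    have "(\<Sum>d\<le>k. (j choose d) * ((\<alpha> + k) choose (\<alpha> + (a + d)))) = (\<alpha> + j + k) choose (\<alpha> + j + a)" for a
    proof -
      have "(\<Sum>d\<le>k. (j choose d) * ((\<alpha> + k) choose (\<alpha> + (a + d)))) =
         (\<Sum>d\<le>max j k. (j choose d) * ((\<alpha> + k) choose (\<alpha> + (a + d))))"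
        by (rule sum.mono_neutral_left) auto
      also have "\<dots> = (\<Sum>d\<le>j. (j choose d) * ((\<alpha> + k) choose (\<alpha> + (a + d))))"
        by (rule sum.mono_neutral_right) auto
      also have "\<dots> = (\<alpha> + k + j) choose (\<alpha> + a + j)"
        using vandermonde_absorb[of j "\<alpha>+k" "\<alpha>+a"] by (simp add: add_ac)
      finally show ?thesis by (simp add: add_ac)
    qed
    note van = this
    have "(\<Sum>a\<le>k. \<Sum>d\<le>k. ?lc (a + d) * ?e x a * (-1) ^ d * (of_nat (j choose d) * ?e w j))
       = (\<Sum>a\<le>k. \<Sum>d\<le>k. ((-1) ^ a * (?e x a * ?e w j)) * of_nat ((j choose d) * ((\<alpha> + k) choose (\<alpha> + (a + d)))))"
      by (intro sum.cong refl) (simp add: power_add mult_ac flip: power_mult_distrib)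
    also have "\<dots> = (\<Sum>a\<le>k. ((-1) ^ a * (?e x a * ?e w j)) * of_nat ((\<alpha> + j + k) choose (\<alpha> + j + a)))"
      by (simp only: sum_distrib_left[symmetric] of_nat_sum[symmetric] van)
    finally show "(\<Sum>a\<le>k. \<Sum>d\<le>k. ?lc (a + d) * ?e x a * (-1) ^ d * (of_nat (j choose d) * ?e w j))
      = w ^ j / fact j * laguerre (\<alpha> + j) k x"
      by (simp add: laguerre_def sum_distrib_left mult_ac)
  qed
  finally show ?thesis by simp
qed

text \<open>This is the coefficient of \<open>r^K\<close> in the Hille-Hardy formula for
  \<open>\<Sum>\<^sub>K K! / (\<alpha> + K)! L\<^sub>K(x) L\<^sub>K(y) r^K\<close>, with the Laguerre polynomials of argument \<open>x + y\<close> expanded.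
  The coefficients of \<open>x^A y^B\<close> on both sides agree by \<open>saalschuetz_binomial\<close>. Terms with
  \<open>a\<close> or \<open>b\<close> beyond \<open>K\<close> have a vanishing binomial coefficient, so any bound \<open>k \<ge> K\<close> is possible.\<close>

lemma laguerre_product:
  fixes x y :: "'a::{banach,real_normed_field}"
  assumes "K \<le> k"
  shows "(\<Sum>m\<le>K. \<Sum>a\<le>k. \<Sum>b\<le>k. (-1) ^ (a + b) * of_nat ((\<alpha> + K + m) choose (\<alpha> + 2 * m + a + b))
      * (x ^ (m + a) / fact a) * (y ^ (m + b) / fact b) / (fact m * fact (\<alpha> + m)))
    = fact K / fact (\<alpha> + K) * laguerre \<alpha> K x * laguerre \<alpha> K y"
proof -
  \<comment> \<open>The terms after the substitution \<open>A = m + a\<close>, \<open>B = m + b\<close>, which groups equal powers.\<close>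
  define T where "T m A B = (-1) ^ (A + B) * of_nat ((\<alpha> + K + m) choose (\<alpha> + A + B))
      * x ^ A * y ^ B / (fact (A - m) * fact (B - m) * fact m * fact (\<alpha> + m))" for m A B
  have shift: "(\<Sum>a\<le>k. f (m + a)) = (\<Sum>A\<in>{m..K}. f A)"
    if "m \<le> K" "\<And>A. A > K \<Longrightarrow> f A = 0" for m and f :: "nat \<Rightarrow> 'a"
  proof -
    have "(\<Sum>a\<le>k. f (m + a)) = (\<Sum>A\<in>{m..m+k}. f A)"
      by (rule sum.reindex_bij_witness[of _ "\<lambda>A. A - m" "\<lambda>a. m + a"]) auto
    also have "\<dots> = (\<Sum>A\<in>{m..K}. f A)"
      using that assms by (intro sum.mono_neutral_right) auto
    finally show ?thesis .
  qed
  have "(\<Sum>m\<le>K. \<Sum>a\<le>k. \<Sum>b\<le>k. (-1) ^ (a + b) * of_nat ((\<alpha> + K + m) choose (\<alpha> + 2 * m + a + b))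
      * (x ^ (m + a) / fact a) * (y ^ (m + b) / fact b) / (fact m * fact (\<alpha> + m)))
    = (\<Sum>m\<le>K. \<Sum>a\<le>k. \<Sum>b\<le>k. T m (m + a) (m + b))"
  proof (intro sum.cong refl)
    fix m a b
    have "(-1::'a) ^ (m + a + (m + b)) = (-1) ^ (a + b)"
      by (simp add: power_add mult_ac flip: power_mult_distrib)
    moreover have "\<alpha> + 2 * m + a + b = \<alpha> + (m + a) + (m + b)" by simp
    ultimately show "(-1) ^ (a + b) * of_nat ((\<alpha> + K + m) choose (\<alpha> + 2 * m + a + b))
      * (x ^ (m + a) / fact a) * (y ^ (m + b) / fact b) / (fact m * fact (\<alpha> + m)) = T m (m + a) (m + b)"
      by (simp only: T_def) (simp add: mult_ac)
  qed
  also have "\<dots> = (\<Sum>m\<le>K. \<Sum>A\<in>{m..K}. \<Sum>B\<in>{m..K}. T m A B)"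
  proof (rule sum.cong[OF refl])
    fix m assume m: "m \<in> {..K}"
    have "(\<Sum>a\<le>k. \<Sum>b\<le>k. T m (m + a) (m + b)) = (\<Sum>A\<in>{m..K}. \<Sum>b\<le>k. T m A (m + b))"
      using m by (intro shift[where f = "\<lambda>A. \<Sum>b\<le>k. T m A (m + b)"]) (auto simp: T_def intro!: sum.neutral)
    also have "\<dots> = (\<Sum>A\<in>{m..K}. \<Sum>B\<in>{m..K}. T m A B)"
      using m by (intro sum.cong refl shift) (auto simp: T_def)
    finally show "(\<Sum>a\<le>k. \<Sum>b\<le>k. T m (m + a) (m + b)) = (\<Sum>A\<in>{m..K}. \<Sum>B\<in>{m..K}. T m A B)" .
  qed
  also have "\<dots> = (\<Sum>m\<le>K. \<Sum>A\<le>K. \<Sum>B\<le>K. if m \<le> A \<and> m \<le> B then T m A B else 0)"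
  proof (rule sum.cong[OF refl])
    fix m assume m: "m \<in> {..K}"
    have "(\<Sum>B\<in>{m..K}. T m A B) = (\<Sum>B\<le>K. if m \<le> B then T m A B else 0)" for A
      by (rule sum.mono_neutral_cong_left) auto
    moreover have "(\<Sum>A\<in>{m..K}. \<Sum>B\<le>K. if m \<le> B then T m A B else 0)
       = (\<Sum>A\<le>K. \<Sum>B\<le>K. if m \<le> A \<and> m \<le> B then T m A B else 0)"
      by (rule sum.mono_neutral_cong_left) auto
    ultimately show "(\<Sum>A\<in>{m..K}. \<Sum>B\<in>{m..K}. T m A B) = (\<Sum>A\<le>K. \<Sum>B\<le>K. if m \<le> A \<and> m \<le> B then T m A B else 0)"
      by simp
  qed
  also have "\<dots> = (\<Sum>A\<le>K. \<Sum>B\<le>K. \<Sum>m\<le>K. if m \<le> A \<and> m \<le> B then T m A B else 0)"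
    by (rule trans[OF sum.swap], rule sum.cong[OF refl], rule sum.swap)
  also have "\<dots> = (\<Sum>A\<le>K. \<Sum>B\<le>K. fact K / fact (\<alpha> + K) *
       ((-1) ^ A * of_nat ((\<alpha> + K) choose (\<alpha> + A)) * (x ^ A / fact A)) *
       ((-1) ^ B * of_nat ((\<alpha> + K) choose (\<alpha> + B)) * (y ^ B / fact B)))"
  proof (intro sum.cong refl)
    fix A B assume AB: "A \<in> {..K}" "B \<in> {..K}"
    have "(\<Sum>m\<le>K. if m \<le> A \<and> m \<le> B then T m A B else 0) =
       (\<Sum>m\<le>B. (-1) ^ (A + B) * x ^ A * y ^ B / (fact A * fact (\<alpha> + B)) *
          of_nat ((A choose m) * ((\<alpha> + B) choose (B - m)) * ((\<alpha> + K + m) choose (\<alpha> + A + B))))"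
      (is "_ = sum ?g _")
    proof (rule sum.mono_neutral_cong_right)
      fix m assume m: "m \<in> {..B}"
      show "(if m \<le> A \<and> m \<le> B then T m A B else 0) = ?g m"
      proof (cases "m \<le> A")
        case True
        have "of_nat (A choose m) = (fact A / (fact m * fact (A - m)) :: 'a)"
          using True by (simp add: binomial_fact)
        moreover have "of_nat ((\<alpha> + B) choose (B - m)) = (fact (\<alpha> + B) / (fact (B - m) * fact (\<alpha> + m)) :: 'a)"
          using m by (simp add: binomial_fact add.commute)
        ultimately show ?thesis using True m by (simp add: T_def mult_ac)
      qed simp
    qed (use AB in auto)
    also have "\<dots> = (-1) ^ (A + B) * x ^ A * y ^ B / (fact A * fact (\<alpha> + B)) *
          of_nat (((\<alpha> + K) choose (\<alpha> + A)) * (K choose B))"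
      using AB by (simp only: sum_distrib_left[symmetric] of_nat_sum[symmetric] saalschuetz_binomial atMost_iff)
    also have "\<dots> = fact K / fact (\<alpha> + K) *
       ((-1) ^ A * of_nat ((\<alpha> + K) choose (\<alpha> + A)) * (x ^ A / fact A)) *
       ((-1) ^ B * of_nat ((\<alpha> + K) choose (\<alpha> + B)) * (y ^ B / fact B))"
    proof -
      have "of_nat (K choose B) = (fact K / (fact B * fact (K - B)) :: 'a)"
        using AB by (simp add: binomial_fact)
      moreover have "of_nat ((\<alpha> + K) choose (\<alpha> + B)) = (fact (\<alpha> + K) / (fact (\<alpha> + B) * fact (K - B)) :: 'a)"
        using AB by (simp add: binomial_fact)
      ultimately have e: "of_nat (K choose B) / fact (\<alpha> + B)
          = fact K / fact (\<alpha> + K) * (of_nat ((\<alpha> + K) choose (\<alpha> + B)) / fact B :: 'a)"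
        by simp
      have "(-1) ^ (A + B) * x ^ A * y ^ B / (fact A * fact (\<alpha> + B)) *
          of_nat (((\<alpha> + K) choose (\<alpha> + A)) * (K choose B))
        = (-1) ^ (A + B) * x ^ A * y ^ B / fact A * of_nat ((\<alpha> + K) choose (\<alpha> + A)) *
          (of_nat (K choose B) / fact (\<alpha> + B))"
        by simp
      also note e
      finally show ?thesis by (simp add: power_add mult_ac)
    qed
    finally show "(\<Sum>m\<le>K. if m \<le> A \<and> m \<le> B then T m A B else 0) = \<dots>" .
  qed
  also have "\<dots> = fact K / fact (\<alpha> + K) * laguerre \<alpha> K x * laguerre \<alpha> K y"
    unfolding laguerre_def sum_distrib_left sum_distrib_right by (rule sum.swap)
  finally show ?thesis .
qed

section \<open>Integration in polar coordinates\<close>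

lemma nn_integral_lborel_scaleR:
  fixes F :: "'a::euclidean_space \<Rightarrow> ennreal"
  assumes [measurable]: "F \<in> borel_measurable borel" and c: "c \<noteq> 0"
  shows "(\<integral>\<^sup>+x. F x \<partial>lborel) = ennreal (\<bar>c\<bar> ^ DIM('a)) * (\<integral>\<^sup>+x. F (c *\<^sub>R x) \<partial>lborel)"
proof -
  have "(\<integral>\<^sup>+x. F x \<partial>lborel) = (\<integral>\<^sup>+x. F x \<partial>density (distr lborel borel (\<lambda>x::'a. 0 + c *\<^sub>R x)) (\<lambda>_. \<bar>c\<bar>^DIM('a)))"
    using lborel_affine[OF c, of "0::'a"] by simp
  also have "\<dots> = ennreal (\<bar>c\<bar> ^ DIM('a)) * (\<integral>\<^sup>+x. F (c *\<^sub>R x) \<partial>lborel)"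
    by (simp add: nn_integral_density nn_integral_distr nn_integral_cmult)
  finally show ?thesis .
qed

lemma lborel_distr_reflect: "distr lborel borel (\<lambda>x. z - x) = (lborel :: 'a::euclidean_space measure)"
proof -
  have "lborel = density (distr lborel borel (\<lambda>x::'a. z + (- 1) *\<^sub>R x)) (\<lambda>_. ennreal (\<bar>-1\<bar>^DIM('a)))"
    by (rule lborel_affine) simp
  then show ?thesis by (simp add: density_1)
qed

lemma power_density_integral:
  assumes "0 \<le> c" "0 \<le> t"
  shows "(\<integral>\<^sup>+s. ennreal (c * (real (Suc m) * s ^ m)) * indicator {0..t} s \<partial>lborel) = ennreal (c * t ^ Suc m)"
proof -
  have "(\<integral>\<^sup>+s. ennreal (c * (real (Suc m) * s ^ m)) * indicator {0..t} s \<partial>lborel) = c * t ^ Suc m - c * 0 ^ Suc m"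
  proof (rule nn_integral_FTC_Icc)
    fix x assume "x \<in> {0..t}"
    show "((\<lambda>x. c * x ^ Suc m) has_real_derivative c * (real (Suc m) * x ^ m)) (at x)"
      using DERIV_cmult[OF DERIV_pow[of "Suc m"], of c x] by simp
  qed (use assms in auto)
  then show ?thesis by simp
qed

text \<open>Polar coordinates without a surface measure: for a homogeneous density \<open>H \<ge> 0\<close>, the image under
  \<open>norm\<close> of the measure with density \<open>H\<close> is determined by its values on the sets \<open>{..t}\<close>, and these
  follow by scaling from the integral of \<open>H\<close> over the unit ball. For \<open>H = 1\<close> this is the usual
  formula for radial functions.\<close>

context
  fixes H :: "'a::euclidean_space \<Rightarrow> real" and d :: nat
  assumes cont: "continuous_on UNIV H"
    and nonneg: "\<And>u. 0 \<le> H u"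
    and hom: "\<And>t u. 0 < t \<Longrightarrow> H (t *\<^sub>R u) = t ^ d * H u"
begin

lemma borel_H [measurable]: "H \<in> borel_measurable borel"
  using cont by (rule borel_measurable_continuous_onI)

lemma set_integrable_H: "set_integrable lborel (cball 0 1) H"
  unfolding set_integrable_def using cont
  by (intro borel_integrable_compact) (auto intro: continuous_on_subset)

lemma emeasure_norm_le:
  assumes "0 \<le> t"
  shows "(\<integral>\<^sup>+u. ennreal (H u) * indicator {..t} (norm u) \<partial>lborel)
       = ennreal (t ^ (DIM('a) + d) * (LINT u:cball 0 1|lborel. H u))"
proof (cases "t = 0")
  case True
  have "(\<integral>\<^sup>+u. ennreal (H u) * indicator {..t} (norm u) \<partial>lborel) = (\<integral>\<^sup>+u. 0 \<partial>(lborel :: 'a measure))"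
  proof (rule nn_integral_cong_AE)
    have "AE u::'a in lborel. u \<noteq> 0" by (rule AE_lborel_singleton)
    then show "AE u in lborel. ennreal (H u) * indicator {..t} (norm u) = (0::ennreal)"
      by eventually_elim (simp add: True)
  qed
  then show ?thesis using True by (simp add: zero_power)
next
  case False
  with assms have t: "0 < t" by simp
  have "(\<integral>\<^sup>+u. ennreal (H u) * indicator {..t} (norm u) \<partial>lborel)
     = ennreal (\<bar>t\<bar> ^ DIM('a)) * (\<integral>\<^sup>+u. ennreal (H (t *\<^sub>R u)) * indicator {..t} (norm (t *\<^sub>R u)) \<partial>lborel)"
    using t by (subst nn_integral_lborel_scaleR[of _ t]) simp_all
  also have "(\<integral>\<^sup>+u. ennreal (H (t *\<^sub>R u)) * indicator {..t} (norm (t *\<^sub>R u)) \<partial>lborel)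
     = (\<integral>\<^sup>+u. ennreal (t ^ d) * ennreal (indicator (cball 0 1) u *\<^sub>R H u) \<partial>lborel)"
    using t by (intro nn_integral_cong) (auto simp: hom nonneg ennreal_mult indicator_def)
  also have "\<dots> = ennreal (t ^ d) * ennreal (LINT u:cball 0 1|lborel. H u)"
    using set_integrable_H unfolding set_integrable_def set_lebesgue_integral_def
    by (subst nn_integral_cmult, simp, subst nn_integral_eq_integral) (auto simp: nonneg)
  finally show ?thesis
    using t by (simp add: power_add ennreal_mult' mult.assoc)
qed

lemma distr_norm_density:
  "distr (density lborel (\<lambda>u. ennreal (H u))) borel norm
   = density lborel (\<lambda>t. ennreal (indicator {0..} t * ((LINT u:cball 0 1|lborel. H u)
       * (real (DIM('a) + d) * t ^ (DIM('a) + d - 1)))))"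
  (is "?M = ?N")
proof -
  let ?c = "LINT u:cball 0 1|lborel. H u"
  have c: "0 \<le> ?c"
    unfolding set_lebesgue_integral_def by (rule integral_nonneg_AE) (simp add: nonneg)
  obtain m where m: "DIM('a) + d = Suc m"
    using DIM_positive[where 'a='a] by (cases "DIM('a) + d") auto
  have M: "emeasure ?M {..t} = (if t < 0 then 0 else ennreal (t ^ (DIM('a) + d) * ?c))" for t
  proof -
    have "emeasure ?M {..t} = (\<integral>\<^sup>+u. ennreal (H u) * indicator {..t} (norm u) \<partial>lborel)"
      by (simp add: emeasure_distr emeasure_density vimage_def indicator_def)
    also have "\<dots> = (if t < 0 then 0 else ennreal (t ^ (DIM('a) + d) * ?c))"
    proof (cases "t < 0")
      case True
      then have "indicator {..t} (norm u) = (0::ennreal)" for u :: 'a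
        using norm_ge_zero[of u] by (auto simp: indicator_def simp del: norm_ge_zero)
      then show ?thesis using True by simp
    qed (use emeasure_norm_le in auto)
    finally show ?thesis .
  qed
  have N: "emeasure ?N {..t} = (if t < 0 then 0 else ennreal (t ^ (DIM('a) + d) * ?c))" for t
  proof -
    have "emeasure ?N {..t} = (\<integral>\<^sup>+s. ennreal (?c * (real (Suc m) * s ^ m)) * indicator {0..t} s \<partial>lborel)"
      unfolding m by (subst emeasure_density) (auto intro!: nn_integral_cong split: split_indicator)
    also have "\<dots> = (if t < 0 then 0 else ennreal (t ^ (DIM('a) + d) * ?c))"
      using power_density_integral[OF c, of t m] by (simp add: m mult.commute)
    finally show ?thesis .
  qed
  show ?thesis
  proof (rule measure_eqI_generator_eq[where E = "range (\<lambda>t::real. {..t})" and \<Omega> = UNIV and A = "\<lambda>i. {..real i}"])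
    show "Int_stable (range (\<lambda>t::real. {..t}))"
      by (auto simp: Int_stable_def)
    show "emeasure ?M X = emeasure ?N X" if "X \<in> range (\<lambda>t::real. {..t})" for X
      using that M N by auto
    show "sets ?M = sigma_sets UNIV (range (\<lambda>t::real. {..t}))" "sets ?N = sigma_sets UNIV (range (\<lambda>t::real. {..t}))"
      by (simp_all add: borel_eq_atMost)
    show "(\<Union>i. {..real i}) = UNIV" using real_arch_simple by auto
    show "emeasure ?M {..real i} \<noteq> \<infinity>" for i using M[of "real i"] by simp
  qed auto
qed

lemma nn_integral_polar:
  assumes [measurable]: "F \<in> borel_measurable borel"
  shows "(\<integral>\<^sup>+u. ennreal (H u) * F (norm u) \<partial>lborel)
    = (\<integral>\<^sup>+t. ennreal (indicator {0..} t * ((LINT u:cball 0 1|lborel. H u)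
       * (real (DIM('a) + d) * t ^ (DIM('a) + d - 1)))) * F t \<partial>lborel)"
proof -
  have "(\<integral>\<^sup>+u. ennreal (H u) * F (norm u) \<partial>lborel)
    = (\<integral>\<^sup>+t. F t \<partial>distr (density lborel (\<lambda>u. ennreal (H u))) borel norm)"
    by (simp add: nn_integral_distr nn_integral_density)
  also have "\<dots> = (\<integral>\<^sup>+t. ennreal (indicator {0..} t * ((LINT u:cball 0 1|lborel. H u)
       * (real (DIM('a) + d) * t ^ (DIM('a) + d - 1)))) * F t \<partial>lborel)"
    unfolding distr_norm_density by (simp add: nn_integral_density)
  finally show ?thesis .
qed

lemma integral_polar_nonneg:
  fixes B :: "real \<Rightarrow> complex"
  assumes [measurable]: "B \<in> borel_measurable borel"
  shows "(LINT u|lborel. of_real (H u) * B (norm u))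
    = of_real (real (DIM('a) + d) * (LINT u:cball 0 1|lborel. H u)) *
      (LINT t:{0..}|lborel. B t * of_real (t ^ (DIM('a) + d - 1)))"
proof -
  let ?c = "LINT u:cball 0 1|lborel. H u" and ?D = "DIM('a) + d"
  have c: "0 \<le> ?c"
    unfolding set_lebesgue_integral_def by (rule integral_nonneg_AE) (simp add: nonneg)
  have "(LINT u|lborel. of_real (H u) * B (norm u)) = (LINT u|lborel. H u *\<^sub>R B (norm u))"
    by (simp add: scaleR_conv_of_real)
  also have "\<dots> = (LINT t|distr (density lborel (\<lambda>u. ennreal (H u))) borel norm. B t)"
    by (subst integral_distr, measurable) (subst integral_density, auto simp: nonneg)
  also have "\<dots> = (LINT t|lborel. (indicator {0..} t * (?c * (real ?D * t ^ (?D - 1)))) *\<^sub>R B t)"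
    unfolding distr_norm_density by (subst integral_density) (auto simp: c indicator_def)
  also have "\<dots> = (LINT t|lborel. of_real (real ?D * ?c) * (indicator {0..} t *\<^sub>R (B t * of_real (t ^ (?D - 1)))))"
    by (intro Bochner_Integration.integral_cong refl)
       (simp add: scaleR_conv_of_real mult_ac split: split_indicator)
  also have "\<dots> = of_real (real ?D * ?c) * (LINT t:{0..}|lborel. B t * of_real (t ^ (?D - 1)))"
    unfolding set_lebesgue_integral_def by (rule integral_mult_right_zero)
  finally show ?thesis .
qed

text \<open>If the integral were zero, \<open>H\<close> would vanish almost everywhere on the ball, hence everywhere on it by
  continuity, hence everywhere by homogeneity.\<close>

lemma ball_integral_pos:
  assumes "H u \<noteq> 0"
  shows "0 < (LINT u:cball 0 1|lborel. H u)"
proof (rule ccontr)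
  assume "\<not> 0 < (LINT u:cball 0 1|lborel. H u)"
  moreover have "0 \<le> (LINT u:cball 0 1|lborel. H u)"
    unfolding set_lebesgue_integral_def by (rule integral_nonneg_AE) (simp add: nonneg)
  ultimately have "(LINT u|lborel. indicator (cball 0 1) u *\<^sub>R H u) = 0"
    unfolding set_lebesgue_integral_def by simp
  then have "AE u in lborel. indicator (cball 0 1) u *\<^sub>R H u = 0"
    using set_integrable_H unfolding set_integrable_def
    by (subst (asm) integral_nonneg_eq_0_iff_AE) (auto simp: nonneg)
  then have "AE u in lebesgue. u \<in> ball 0 1 \<longrightarrow> u \<in> {u. H u \<le> 0}"
    by (intro AE_completion, eventually_elim) (auto simp: indicator_def)
  moreover have "closed {u. H u \<le> 0}"
    using cont by (intro closed_Collect_le) auto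
  ultimately have "u \<in> ball 0 1 \<Longrightarrow> H u \<le> 0" for u
    using mem_closed_if_AE_lebesgue_open[of "ball 0 1" "{u. H u \<le> 0}" u] by auto
  moreover have "inverse (1 + norm u) *\<^sub>R u \<in> ball 0 1"
    by (simp add: add_pos_nonneg divide_simps)
  ultimately have "inverse (1 + norm u) ^ d * H u \<le> 0"
    by (metis hom inverse_positive_iff_positive add_pos_nonneg norm_ge_zero zero_less_one)
  moreover have "0 < inverse (1 + norm u) ^ d * H u"
    using assms nonneg[of u] by (intro mult_pos_pos zero_less_power) (auto simp: add_pos_nonneg)
  ultimately show False by simp
qed

text \<open>Polar coordinates read backwards: a non-zero homogeneous factor can be stripped off, which leaves
  a statement about the radial profile alone.\<close>

lemma set_integrable_radial_profile:
  fixes B :: "real \<Rightarrow> complex"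
  assumes [measurable]: "B \<in> borel_measurable borel"
    and int: "integrable lborel (\<lambda>u. of_real (H u) * B (norm u))" and "H u0 \<noteq> 0"
  shows "set_integrable lborel {0..} (\<lambda>t. B t * of_real (t ^ (DIM('a) + d - 1)))"
  unfolding set_integrable_def
proof (rule integrableI_bounded)
  let ?c = "LINT u:cball 0 1|lborel. H u"
  have c: "0 < ?c" by (rule ball_integral_pos) fact
  have "(\<integral>\<^sup>+t. ennreal (?c * real (DIM('a) + d)) * ennreal (norm (indicator {0..} t *\<^sub>R (B t * of_real (t ^ (DIM('a) + d - 1))))) \<partial>lborel)
     = (\<integral>\<^sup>+t. ennreal (indicator {0..} t * (?c * (real (DIM('a) + d) * t ^ (DIM('a) + d - 1)))) * ennreal (norm (B t)) \<partial>lborel)"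
    using c by (intro nn_integral_cong)
      (auto simp: indicator_def norm_mult norm_power ennreal_mult[symmetric] mult_ac simp del: of_nat_add)
  also have "\<dots> = (\<integral>\<^sup>+u. ennreal (H u) * ennreal (norm (B (norm u))) \<partial>lborel)"
    by (rule nn_integral_polar[symmetric]) measurable
  also have "\<dots> = (\<integral>\<^sup>+u. ennreal (norm (of_real (H u) * B (norm u))) \<partial>lborel)"
    by (intro nn_integral_cong) (simp add: norm_mult nonneg ennreal_mult)
  also have "\<dots> < \<infinity>"
    using int by (simp add: integrable_iff_bounded)
  finally have "ennreal (?c * real (DIM('a) + d)) *
      (\<integral>\<^sup>+t. ennreal (norm (indicator {0..} t *\<^sub>R (B t * of_real (t ^ (DIM('a) + d - 1))))) \<partial>lborel) < \<infinity>"
    by (subst (asm) nn_integral_cmult) (auto simp del: norm_scaleR of_nat_add)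
  moreover have "ennreal (?c * real (DIM('a) + d)) \<noteq> 0"
    using c DIM_positive[where 'a='a] by (simp add: ennreal_eq_0_iff not_le mult_pos_pos add_pos_nonneg)
  ultimately show "(\<integral>\<^sup>+t. ennreal (norm (indicator {0..} t *\<^sub>R (B t * of_real (t ^ (DIM('a) + d - 1))))) \<partial>lborel) < \<infinity>"
    by (auto simp: ennreal_mult_less_top simp del: norm_scaleR of_nat_add)
qed measurable

end

(* Outside the context this rule would reduce the measurability of any function to a search
   for its homogeneity. *)
declare borel_H [measurable del]

text \<open>By homogeneity the bound on the compact unit ball controls everything.\<close>

lemma homogeneous_bound:
  fixes G :: "'a::euclidean_space \<Rightarrow> complex"
  assumes cont: "continuous_on UNIV G"
    and hom: "\<And>t u. 0 < t \<Longrightarrow> G (t *\<^sub>R u) = of_real (t ^ d) * G u"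
  shows "\<exists>M. \<forall>u. norm (G u) \<le> M * norm u ^ d"
proof -
  have "bounded (G ` cball 0 1)"
    by (intro compact_imp_bounded compact_continuous_image continuous_on_subset[OF cont]) auto
  then obtain M where M: "\<And>u. u \<in> cball 0 1 \<Longrightarrow> norm (G u) \<le> M"
    unfolding bounded_iff by blast
  have "norm (G u) \<le> M * norm u ^ d" for u
  proof (cases "u = 0")
    case True
    show ?thesis
    proof (cases "d = 0")
      case False
      have "G 0 = of_real (2 ^ d) * G 0" using hom[of 2 0] by simp
      moreover have "(of_real (2 ^ d) :: complex) \<noteq> 1" using False
        by (metis of_real_eq_1_iff power_inject_exp power_0 one_less_numeral_iff semiring_norm(76))
      ultimately show ?thesis using True False by (simp add: zero_power)
    qed (use M[of 0] True in simp)
  next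
    case False
    have "norm (G (norm u *\<^sub>R (u /\<^sub>R norm u))) = norm u ^ d * norm (G (u /\<^sub>R norm u))"
      using False by (subst hom) (auto simp: norm_mult norm_power)
    also have "\<dots> \<le> norm u ^ d * M"
      using False by (intro mult_left_mono M) auto
    finally show ?thesis using False by (simp add: mult.commute)
  qed
  then show ?thesis by blast
qed

lemma integrable_radial:
  fixes B :: "real \<Rightarrow> complex"
  assumes [measurable]: "B \<in> borel_measurable borel"
    and int: "set_integrable lborel {0..} (\<lambda>t. B t * of_real (t ^ (DIM('a) + d - 1)))"
  shows "integrable lborel (\<lambda>u::'a::euclidean_space. of_real (norm u ^ d) * B (norm u))"
proof (rule integrableI_bounded)
  let ?c = "LINT u:cball (0::'a) 1|lborel. norm u ^ d"
  have c: "0 \<le> ?c"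
    unfolding set_lebesgue_integral_def by (rule integral_nonneg_AE) simp
  have "(\<integral>\<^sup>+u. ennreal (norm (of_real (norm u ^ d) * B (norm (u::'a)))) \<partial>lborel)
     = (\<integral>\<^sup>+u. ennreal (norm u ^ d) * ennreal (norm (B (norm (u::'a)))) \<partial>lborel)"
    by (intro nn_integral_cong) (simp add: norm_mult norm_power ennreal_mult)
  also have "\<dots> = (\<integral>\<^sup>+t. ennreal (indicator {0..} t * (?c * (real (DIM('a) + d) * t ^ (DIM('a) + d - 1)))) * ennreal (norm (B t)) \<partial>lborel)"
    by (rule nn_integral_polar) (auto intro!: continuous_intros simp: power_mult_distrib)
  also have "\<dots> = (\<integral>\<^sup>+t. ennreal (?c * real (DIM('a) + d)) * ennreal (norm (indicator {0..} t *\<^sub>R (B t * of_real (t ^ (DIM('a) + d - 1))))) \<partial>lborel)"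
    using c by (intro nn_integral_cong)
      (auto simp: indicator_def norm_mult norm_power ennreal_mult[symmetric] mult_ac simp del: of_nat_add)
  also have "\<dots> = ennreal (?c * real (DIM('a) + d)) * (\<integral>\<^sup>+t. ennreal (norm (indicator {0..} t *\<^sub>R (B t * of_real (t ^ (DIM('a) + d - 1))))) \<partial>lborel)"
    by (rule nn_integral_cmult) measurable
  also have "\<dots> < \<infinity>"
    using int unfolding set_integrable_def integrable_iff_bounded
    by (auto simp: ennreal_mult_less_top simp del: norm_scaleR of_nat_add)
  finally show "(\<integral>\<^sup>+u. ennreal (norm (of_real (norm u ^ d) * B (norm (u::'a)))) \<partial>lborel) < \<infinity>" .
qed measurable

text \<open>The positive and negative parts of the real and imaginary parts of \<open>G\<close> are again continuous and
  homogeneous, so the formula for non-negative densities applies to each of them. The factor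
  in front of the radial integral depends on \<open>G\<close> only, not on \<open>B\<close>.\<close>

lemma integral_polar:
  fixes G :: "'a::euclidean_space \<Rightarrow> complex" and B :: "real \<Rightarrow> complex"
  assumes cont: "continuous_on UNIV G"
    and hom: "\<And>t u. 0 < t \<Longrightarrow> G (t *\<^sub>R u) = of_real (t ^ d) * G u"
    and B [measurable]: "B \<in> borel_measurable borel"
    and int1: "set_integrable lborel {0..} (\<lambda>t. B t * of_real (t ^ (DIM('a) + d - 1)))"
  shows "integrable lborel (\<lambda>u. G u * B (norm u))" (is ?int)
    and "(LINT u|lborel. G u * B (norm u)) = of_nat (DIM('a) + d) * (LINT u:cball 0 1|lborel. G u) *
      (LINT t:{0..}|lborel. B t * of_real (t ^ (DIM('a) + d - 1)))" (is ?eq)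
proof -
  have [measurable]: "G \<in> borel_measurable borel"
    using cont by (rule borel_measurable_continuous_onI)
  note int = integrable_radial[OF B int1]
  obtain M where M: "\<And>u. norm (G u) \<le> M * norm u ^ d"
    using homogeneous_bound[OF cont hom] by blast
  have dom: "integrable lborel (\<lambda>u. of_real (H u) * B (norm u))"
    if [measurable]: "H \<in> borel_measurable borel" and "\<And>u. \<bar>H u\<bar> \<le> norm (G u)" for H :: "'a \<Rightarrow> real"
  proof (rule Bochner_Integration.integrable_bound)
    show "integrable lborel (\<lambda>u::'a. of_real M * (of_real (norm u ^ d) * B (norm u)))"
      using int by (rule integrable_mult_right)
    show "AE u in lborel. norm (of_real (H u) * B (norm u)) \<le> norm (of_real M * (of_real (norm u ^ d) * B (norm u)))"
    proof (rule AE_I2)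
      fix u :: 'a
      have "\<bar>H u\<bar> \<le> \<bar>M\<bar> * norm u ^ d"
        using that(2)[of u] M[of u] mult_right_mono[OF abs_ge_self[of M], of "norm u ^ d"] by simp
      then have "\<bar>H u\<bar> * norm (B (norm u)) \<le> (\<bar>M\<bar> * norm u ^ d) * norm (B (norm u))"
        by (rule mult_right_mono) simp
      then show "norm (of_real (H u) * B (norm u)) \<le> norm (of_real M * (of_real (norm u ^ d) * B (norm u)))"
        by (simp add: norm_mult norm_power mult.assoc)
    qed
  qed measurable
  let ?J = "LINT t:{0..}|lborel. B t * of_real (t ^ (DIM('a) + d - 1))"
  define P where "P f u = max 0 (f (G u))" for f :: "complex \<Rightarrow> real" and u
  have P: "continuous_on UNIV (P f)" "0 \<le> P f u" "0 < t \<Longrightarrow> P f (t *\<^sub>R u) = t ^ d * P f u"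
      "\<bar>P f u\<bar> \<le> norm (G u)"
    if "f \<in> {Re, \<lambda>z. - Re z, Im, \<lambda>z. - Im z}" for f u t
  proof -
    have f: "continuous_on UNIV f" "f (of_real r * z) = r * f z" "\<bar>f z\<bar> \<le> norm z" for r z
      using that by (auto intro!: continuous_intros simp: abs_Re_le_cmod abs_Im_le_cmod)
    show "continuous_on UNIV (P f)"
      unfolding P_def using continuous_on_compose2[OF f(1) cont] by (intro continuous_intros) auto
    show "0 \<le> P f u" by (simp add: P_def)
    show "P f (t *\<^sub>R u) = t ^ d * P f u" if "0 < t"
      using that by (simp add: P_def hom f(2) max_mult_distrib_left del: of_real_power)
    show "\<bar>P f u\<bar> \<le> norm (G u)"
      using f(3)[of "G u"] by (auto simp: P_def)
  qed
  have PB [measurable]: "P f \<in> borel_measurable borel" if "f \<in> {Re, \<lambda>z. - Re z, Im, \<lambda>z. - Im z}" for f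
    using P(1)[OF that] by (rule borel_measurable_continuous_onI)
  note I = dom[OF PB P(4)]
  have E: "(LINT u|lborel. of_real (P f u) * B (norm u)) =
      of_real (real (DIM('a) + d) * (LINT u:cball 0 1|lborel. P f u)) * ?J"
    if "f \<in> {Re, \<lambda>z. - Re z, Im, \<lambda>z. - Im z}" for f
    using P[OF that] by (intro integral_polar_nonneg) auto
  have S: "set_integrable lborel (cball 0 1) (\<lambda>u. complex_of_real (P f u))"
    if "f \<in> {Re, \<lambda>z. - Re z, Im, \<lambda>z. - Im z}" for f
    unfolding set_integrable_def using P(1)[OF that]
    by (intro borel_integrable_compact) (auto intro!: continuous_intros intro: continuous_on_subset)
  have dec: "G u = of_real (P Re u) - of_real (P (\<lambda>z. - Re z) u)
      + \<i> * (of_real (P Im u) - of_real (P (\<lambda>z. - Im z) u))" for u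
    by (simp add: complex_eq_iff P_def max_def)
  have dec': "G u * B (norm u) = of_real (P Re u) * B (norm u) - of_real (P (\<lambda>z. - Re z) u) * B (norm u)
      + \<i> * (of_real (P Im u) * B (norm u) - of_real (P (\<lambda>z. - Im z) u) * B (norm u))" for u
    by (subst dec) (simp only: algebra_simps)
  show ?int
    unfolding dec' by (intro Bochner_Integration.integrable_add Bochner_Integration.integrable_diff integrable_mult_right I) auto
  have G: "(LINT u:cball 0 1|lborel. G u) = (LINT u:cball 0 1|lborel. of_real (P Re u)) - (LINT u:cball 0 1|lborel. of_real (P (\<lambda>z. - Re z) u))
      + \<i> * ((LINT u:cball 0 1|lborel. of_real (P Im u)) - (LINT u:cball 0 1|lborel. of_real (P (\<lambda>z. - Im z) u)))"
    by (subst dec) (simp add: S set_integral_add set_integral_diff set_integral_mult_right)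
  have GB: "(LINT u|lborel. G u * B (norm u)) =
      of_real (real (DIM('a) + d) * (LINT u:cball 0 1|lborel. P Re u)) * ?J
      - of_real (real (DIM('a) + d) * (LINT u:cball 0 1|lborel. P (\<lambda>z. - Re z) u)) * ?J
      + \<i> * (of_real (real (DIM('a) + d) * (LINT u:cball 0 1|lborel. P Im u)) * ?J
      - of_real (real (DIM('a) + d) * (LINT u:cball 0 1|lborel. P (\<lambda>z. - Im z) u)) * ?J)"
    unfolding dec' by (simp add: I E del: of_real_mult)
  show ?eq
    unfolding G GB set_integral_complex_of_real by (simp add: ring_distribs mult_ac)
qed

lemma integrable_exp_minus_norm: "integrable lborel (\<lambda>u::'a::euclidean_space. exp (- norm u))"
proof (rule integrableI_bounded)
  let ?c = "LINT u:cball (0::'a) 1|lborel. (1::real)"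
  obtain m where m: "DIM('a) = Suc m"
    using DIM_positive[where 'a='a] by (cases "DIM('a)") auto
  have c: "0 \<le> ?c"
    unfolding set_lebesgue_integral_def by (rule integral_nonneg_AE) simp
  have "(\<integral>\<^sup>+u. ennreal (norm (exp (- norm (u::'a)))) \<partial>lborel)
     = (\<integral>\<^sup>+u. ennreal 1 * ennreal (exp (- norm (u::'a))) \<partial>lborel)"
    by simp
  also have "\<dots> = (\<integral>\<^sup>+t. ennreal (indicator {0..} t * (?c * (real (DIM('a) + 0) * t ^ (DIM('a) + 0 - 1)))) * ennreal (exp (- t)) \<partial>lborel)"
    by (rule nn_integral_polar) auto
  also have "\<dots> = (\<integral>\<^sup>+t. ennreal (?c * real (DIM('a))) * (ennreal (t ^ m * exp (- t)) * indicator {0..} t) \<partial>lborel)"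
    using c by (intro nn_integral_cong) (auto simp: m indicator_def ennreal_mult[symmetric] mult_ac simp del: of_nat_Suc)
  also have "\<dots> = ennreal (?c * real (DIM('a))) * ennreal (fact m)"
    by (subst nn_integral_cmult, measurable) (subst nn_intergal_power_times_exp_Ici, simp)
  also have "\<dots> < \<infinity>"
    by (simp add: ennreal_mult_less_top)
  finally show "(\<integral>\<^sup>+u. ennreal (norm (exp (- norm (u::'a)))) \<partial>lborel) < \<infinity>" .
qed measurable

text \<open>The image of Lebesgue measure under \<open>norm\<close> is absolutely continuous.\<close>

lemma AE_norm:
  assumes "AE t in lborel. 0 < t \<longrightarrow> Q t"
  shows "AE u in lborel. u \<noteq> 0 \<longrightarrow> Q (norm (u::'a::euclidean_space))"
proof -
  obtain N where N: "{t. \<not> (0 < t \<longrightarrow> Q t)} \<subseteq> N" "N \<in> null_sets lborel"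
    using assms by (auto elim!: AE_E simp: null_sets_def)
  then have [measurable]: "N \<in> sets borel" by auto
  have "AE t in lborel. t \<notin> N" using N(2) by (rule AE_not_in)
  then have "(\<integral>\<^sup>+t. ennreal (indicator {0..} t * ((LINT u:cball (0::'a) 1|lborel. 1)
       * (real (DIM('a) + 0) * t ^ (DIM('a) + 0 - 1)))) * indicator N t \<partial>lborel) = 0"
    by (subst nn_integral_0_iff_AE) auto
  then have "(\<integral>\<^sup>+u. ennreal 1 * indicator N (norm (u::'a)) \<partial>lborel) = 0"
    by (subst nn_integral_polar[where d = 0]) auto
  then have "AE u::'a in lborel. ennreal 1 * indicator N (norm u) = (0::ennreal)"
    by (subst (asm) nn_integral_0_iff_AE) auto
  then show ?thesis
  proof eventually_elim
    fix u :: 'a assume "ennreal 1 * indicator N (norm u) = (0::ennreal)"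
    then show "u \<noteq> 0 \<longrightarrow> Q (norm u)"
      using subsetD[OF N(1), of "norm u"] by (auto simp: indicator_def split: if_splits)
  qed
qed

section \<open>Radial factors of measurable functions\<close>

lemma completion_ex_borel_measurable_complex:
  fixes f :: "'a \<Rightarrow> complex"
  assumes "f \<in> borel_measurable (completion M)"
  shows "\<exists>F\<in>borel_measurable M. AE x in M. f x = F x"
proof -
  obtain R where R [measurable]: "R \<in> borel_measurable M" "AE x in M. Re (f x) = R x"
    using completion_ex_borel_measurable_real[OF measurable_compose[OF assms borel_measurable_Re]] by blast
  obtain I where I [measurable]: "I \<in> borel_measurable M" "AE x in M. Im (f x) = I x"
    using completion_ex_borel_measurable_real[OF measurable_compose[OF assms borel_measurable_Im]] by blast
  show ?thesis
  proof (intro bexI)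
    show "AE x in M. f x = of_real (R x) + \<i> * of_real (I x)"
      using R(2) I(2) by eventually_elim (simp add: complex_eq_iff)
  qed measurable
qed

lemma AE_lborel_scaleR:
  fixes N :: "'a::euclidean_space set"
  assumes N: "N \<in> null_sets lborel" and t: "t \<noteq> 0"
  shows "AE u in lborel. t *\<^sub>R u \<notin> N"
proof -
  have [measurable]: "N \<in> sets borel" using N by auto
  have pos: "\<not> \<bar>t\<bar> ^ DIM('a) \<le> 0" using t by (simp add: not_le)
  have "0 = (\<integral>\<^sup>+u. indicator N u \<partial>lborel)" using N by auto
  also have "\<dots> = ennreal (\<bar>t\<bar> ^ DIM('a)) * (\<integral>\<^sup>+u. indicator N (t *\<^sub>R u) \<partial>lborel)"
    using t by (intro nn_integral_lborel_scaleR) auto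
  finally have "(\<integral>\<^sup>+u. indicator N (t *\<^sub>R u) \<partial>(lborel :: 'a measure)) = 0"
    using pos by (auto simp: ennreal_eq_0_iff)
  then have "AE u in lborel. indicator N (t *\<^sub>R u) = (0::ennreal)"
    by (subst (asm) nn_integral_0_iff_AE) auto
  then show ?thesis by eventually_elim (auto simp: indicator_def split: if_splits)
qed

text \<open>The product \<open>f = a(\<bar>z\<bar>) P(z)\<close> agrees with a Borel function \<open>F\<close> off a null set. By Fubini, almost
  every line through the origin meets this null set in a null set, so \<open>a\<close> can be read off
  from \<open>F\<close> along one such line on which \<open>P\<close> does not vanish.\<close>

lemma radial_profile_borel:
  fixes P :: "'a::euclidean_space \<Rightarrow> complex" and a :: "real \<Rightarrow> complex"
  assumes f: "(\<lambda>z. a (norm z) * P z) \<in> borel_measurable lebesgue"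
    and cont: "continuous_on UNIV P"
    and hom: "\<And>t u. 0 < t \<Longrightarrow> P (t *\<^sub>R u) = of_real (t ^ d) * P u"
    and nz: "P u0 \<noteq> 0"
  obtains b where "b \<in> borel_measurable borel" "AE t in lborel. 0 < t \<longrightarrow> a t = b t"
proof -
  have [measurable]: "P \<in> borel_measurable borel"
    using cont by (rule borel_measurable_continuous_onI)
  obtain F where [measurable]: "F \<in> borel_measurable borel" and F: "AE z in lborel. a (norm z) * P z = F z"
    using completion_ex_borel_measurable_complex[OF f] by auto
  obtain N where N: "{z. a (norm z) * P z \<noteq> F z} \<subseteq> N" "N \<in> null_sets lborel"
    using F by (auto elim!: AE_E simp: null_sets_def)
  have [measurable]: "N \<in> sets borel" using N(2) by auto
  \<comment> \<open>Dilations preserve null sets, so the first order of quantifiers is clear; Fubini exchanges them.\<close>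
  have "AE t in lborel. AE u in lborel. t \<noteq> 0 \<longrightarrow> t *\<^sub>R u \<notin> N"
  proof (rule AE_I2)
    show "AE u in lborel. t \<noteq> 0 \<longrightarrow> t *\<^sub>R u \<notin> N" for t
      using AE_lborel_scaleR[OF N(2), of t] by (cases "t = 0") auto
  qed
  then have AE: "AE u in lborel. AE t in lborel. t \<noteq> 0 \<longrightarrow> t *\<^sub>R u \<notin> N"
    by (subst lborel_pair.AE_commute) measurable
  have "\<exists>v. v \<noteq> 0 \<and> P v \<noteq> 0 \<and> (AE t in lborel. t \<noteq> 0 \<longrightarrow> t *\<^sub>R v \<notin> N)"
  proof (rule ccontr)
    assume "\<nexists>v. v \<noteq> 0 \<and> P v \<noteq> 0 \<and> (AE t in lborel. t \<noteq> 0 \<longrightarrow> t *\<^sub>R v \<notin> N)"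
    with AE AE_lborel_singleton[of 0] have "AE u in lborel. P u = 0"
      by (auto elim: eventually_elim2)
    then have "AE u in lebesgue. u \<in> {u. P u = 0}" by (intro AE_completion) simp
    moreover have "closed {u. P u = 0}" using cont by (intro closed_Collect_eq) auto
    ultimately show False using mem_closed_if_AE_lebesgue nz by blast
  qed
  then obtain v where v: "v \<noteq> 0" "P v \<noteq> 0" and AEv: "AE t in lborel. t \<noteq> 0 \<longrightarrow> t *\<^sub>R v \<notin> N"
    by blast
  \<comment> \<open>The point on the ray through \<open>v\<close> at distance \<open>t\<close> from the origin recovers \<open>a t\<close>.\<close>
  define b where "b t = F ((1 / norm v * t) *\<^sub>R v) / P ((1 / norm v * t) *\<^sub>R v)" for t
  show thesis
  proof
    show "b \<in> borel_measurable borel" unfolding b_def by measurable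
    have "AE t in lborel. 0 + 1 / norm v * t \<noteq> 0 \<longrightarrow> (0 + 1 / norm v * t) *\<^sub>R v \<notin> N"
      using v by (intro AE_borel_affine[OF _ _ AEv]) auto
    then show "AE t in lborel. 0 < t \<longrightarrow> a t = b t"
    proof eventually_elim
      fix t assume t: "0 + 1 / norm v * t \<noteq> 0 \<longrightarrow> (0 + 1 / norm v * t) *\<^sub>R v \<notin> N"
      show "0 < t \<longrightarrow> a t = b t"
      proof
        assume "0 < t"
        let ?w = "(1 / norm v * t) *\<^sub>R v"
        have "?w \<notin> N" using t v \<open>0 < t\<close> by simp
        then have "a (norm ?w) * P ?w = F ?w" using N(1) by blast
        moreover have "norm ?w = t" using v \<open>0 < t\<close> by simp
        moreover have "P ?w \<noteq> 0" using v \<open>0 < t\<close> by (subst hom) auto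
        ultimately show "a t = b t" by (simp add: b_def field_simps)
      qed
    qed
  qed
qed

section \<open>Functions of exponential growth\<close>

text \<open>A class that contains the polynomials and the exponentials of linear forms, is closed
  under products, and whose measurable members are integrable against every Gaussian.\<close>

definition exp_growth :: "('a::euclidean_space \<Rightarrow> complex) \<Rightarrow> bool" where
  "exp_growth G \<longleftrightarrow> (\<exists>M c. 0 \<le> c \<and> (\<forall>u. norm (G u) \<le> M * exp (c * norm u)))"

lemma exp_growthI: "(\<And>u. norm (G u) \<le> M * exp (c * norm u)) \<Longrightarrow> 0 \<le> c \<Longrightarrow> exp_growth G"
  unfolding exp_growth_def by blast

lemma exp_growth_mono:
  assumes "exp_growth G" "\<And>u. norm (F u) \<le> norm (G u)" shows "exp_growth F"
  using assms unfolding exp_growth_def by (meson order_trans)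

lemma exp_growth_const [intro]: "exp_growth (\<lambda>_. c)"
  by (rule exp_growthI[of _ "norm c" 0]) auto

lemma exp_growth_add [intro]:
  assumes "exp_growth F" "exp_growth G" shows "exp_growth (\<lambda>u. F u + G u)"
proof -
  obtain M c N d where F: "0 \<le> c" "\<And>u. norm (F u) \<le> M * exp (c * norm u)"
    and G: "0 \<le> d" "\<And>u. norm (G u) \<le> N * exp (d * norm u)"
    using assms unfolding exp_growth_def by blast
  have M: "0 \<le> M" "0 \<le> N"
    using order_trans[OF norm_ge_zero F(2)[of 0]] order_trans[OF norm_ge_zero G(2)[of 0]] by auto
  show ?thesis
  proof (rule exp_growthI)
    fix u :: 'a
    have "norm (F u + G u) \<le> M * exp (c * norm u) + N * exp (d * norm u)"
      using F(2)[of u] G(2)[of u] norm_triangle_ineq[of "F u" "G u"] by linarith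
    also have "\<dots> \<le> M * exp ((c + d) * norm u) + N * exp ((c + d) * norm u)"
      using M F(1) G(1) by (intro add_mono mult_left_mono) (auto simp: algebra_simps)
    finally show "norm (F u + G u) \<le> (M + N) * exp ((c + d) * norm u)"
      by (simp add: ring_distribs)
  qed (use F G in auto)
qed

lemma exp_growth_mult [intro]:
  assumes "exp_growth F" "exp_growth G" shows "exp_growth (\<lambda>u. F u * G u)"
proof -
  obtain M c N d where F: "0 \<le> c" "\<And>u. norm (F u) \<le> M * exp (c * norm u)"
    and G: "0 \<le> d" "\<And>u. norm (G u) \<le> N * exp (d * norm u)"
    using assms unfolding exp_growth_def by blast
  show ?thesis
  proof (rule exp_growthI)
    fix u :: 'a
    have "norm (F u) * norm (G u) \<le> (M * exp (c * norm u)) * (N * exp (d * norm u))"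
      using F(2)[of u] G(2)[of u] by (intro mult_mono) (auto intro: order_trans[OF norm_ge_zero])
    then show "norm (F u * G u) \<le> (M * N) * exp ((c + d) * norm u)"
      by (simp add: norm_mult ring_distribs exp_add mult_ac)
  qed (use F G in auto)
qed

lemma exp_growth_power [intro]: "exp_growth F \<Longrightarrow> exp_growth (\<lambda>u. F u ^ k)"
  by (induction k) auto

lemma exp_growth_sum [intro]: "(\<And>i. i \<in> A \<Longrightarrow> exp_growth (F i)) \<Longrightarrow> exp_growth (\<lambda>u. \<Sum>i\<in>A. F i u)"
  by (induction A rule: infinite_finite_induct) auto

lemma exp_growth_linear [intro]:
  fixes L :: "'a::euclidean_space \<Rightarrow> complex"
  assumes "bounded_linear L" shows "exp_growth L"
proof -
  obtain K where K: "0 < K" "\<And>u. norm (L u) \<le> norm u * K"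
    using bounded_linear.pos_bounded[OF assms] by blast
  show ?thesis
  proof (rule exp_growthI[of _ K 1])
    fix u :: 'a
    have "norm u * K \<le> exp (norm u) * K"
      using K exp_ge_add_one_self[of "norm u"] by (intro mult_right_mono) linarith+
    then show "norm (L u) \<le> K * exp (1 * norm u)"
      using K(2)[of u] by (simp add: mult.commute)
  qed simp
qed

lemma exp_growth_norm [intro]: "exp_growth (\<lambda>u. of_real (norm u))"
  by (rule exp_growthI[of _ 1 1]) (use exp_ge_add_one_self in \<open>auto intro: order_trans[OF _ exp_ge_add_one_self]\<close>)

text \<open>Completing the square.\<close>

lemma gauss_decay:
  assumes "0 < \<kappa>"
  shows "exp (c * r) * exp (- \<kappa> * r\<^sup>2) \<le> exp ((c + 1)\<^sup>2 / (4 * \<kappa>)) * exp (- r :: real)"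
proof -
  have "0 \<le> (2 * \<kappa> * r - (c + 1))\<^sup>2 / (4 * \<kappa>)" using assms by simp
  also have "\<dots> = \<kappa> * r\<^sup>2 - (c + 1) * r + (c + 1)\<^sup>2 / (4 * \<kappa>)"
    using assms by (simp add: field_simps power2_eq_square)
  finally have "c * r + - \<kappa> * r\<^sup>2 \<le> (c + 1)\<^sup>2 / (4 * \<kappa>) + - r"
    by (simp add: algebra_simps)
  then show ?thesis by (simp only: exp_add[symmetric] exp_le_cancel_iff)
qed

lemma exp_growth_gauss_bound:
  assumes "exp_growth G" "0 < \<kappa>"
  obtains M where "\<And>u. norm (G u * of_real (exp (- \<kappa> * (norm u)\<^sup>2))) \<le> M * exp (- norm u)"
proof -
  obtain M c where G: "\<And>u. norm (G u) \<le> M * exp (c * norm u)"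
    using assms unfolding exp_growth_def by blast
  have M: "0 \<le> M" using order_trans[OF norm_ge_zero G[of 0]] by simp
  show thesis
  proof (rule that)
    fix u
    have "norm (G u) * exp (- \<kappa> * (norm u)\<^sup>2) \<le> M * exp (c * norm u) * exp (- \<kappa> * (norm u)\<^sup>2)"
      by (intro mult_right_mono G) simp
    also have "\<dots> = M * (exp (c * norm u) * exp (- \<kappa> * (norm u)\<^sup>2))" by simp
    also have "\<dots> \<le> M * (exp ((c + 1)\<^sup>2 / (4 * \<kappa>)) * exp (- norm u))"
      using M assms by (intro mult_left_mono gauss_decay)
    finally show "norm (G u * of_real (exp (- \<kappa> * (norm u)\<^sup>2))) \<le> (M * exp ((c + 1)\<^sup>2 / (4 * \<kappa>))) * exp (- norm u)"
      by (simp add: norm_mult mult.assoc)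
  qed
qed

lemma integrable_exp_growth_gauss:
  fixes G :: "'a::euclidean_space \<Rightarrow> complex"
  assumes "exp_growth G" "0 < \<kappa>" and [measurable]: "G \<in> borel_measurable borel"
  shows "integrable lborel (\<lambda>u. G u * of_real (exp (- \<kappa> * (norm u)\<^sup>2)))"
proof -
  obtain M where M: "\<And>u. norm (G u * of_real (exp (- \<kappa> * (norm u)\<^sup>2))) \<le> M * exp (- norm u)"
    using exp_growth_gauss_bound[OF assms(1,2)] by blast
  show ?thesis
  proof (rule Bochner_Integration.integrable_bound)
    show "integrable lborel (\<lambda>u::'a. M * exp (- norm u))"
      by (intro integrable_mult_right integrable_exp_minus_norm)
    show "AE u in lborel. norm (G u * of_real (exp (- \<kappa> * (norm u)\<^sup>2))) \<le> norm (M * exp (- norm u))"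
      using M by (intro AE_I2) (metis abs_ge_self order_trans real_norm_def)
  qed measurable
qed

text \<open>For \<open>1 \<le> r < \<infinity>\<close> the bound \<open>\<bar>f\<bar> \<le> 1 + \<bar>f\<bar>^r\<close> replaces Hoelder's inequality, since
  \<open>k\<close> is both integrable and bounded.\<close>

lemma Lr_space_times_exp_decay_integrable:
  fixes F k :: "'a::euclidean_space \<Rightarrow> complex"
  assumes f: "f \<in> Lr_space r" and r: "1 \<le> r" and F [measurable]: "F \<in> borel_measurable borel"
    and AE: "AE x in lborel. f x = F x" and k [measurable]: "k \<in> borel_measurable borel"
    and bound: "\<And>u. norm (k u) \<le> M * exp (- norm u)"
  shows "integrable lborel (\<lambda>u. F u * k u)"
proof -
  have M: "0 \<le> M" using order_trans[OF norm_ge_zero bound[of 0]] by simp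
  have f_meas: "f \<in> borel_measurable lebesgue" using f by (simp add: Lr_space_def)
  have F_meas: "F \<in> borel_measurable lebesgue" by (intro measurable_completion) simp
  show ?thesis
  proof (cases "r = \<infinity>")
    case True
    then obtain B where "AE x in lebesgue. norm (f x) \<le> B" using f by (auto simp: Lr_space_def)
    then have B: "AE x in lborel. norm (f x) \<le> B" by (simp add: AE_completion_iff)
    show ?thesis
    proof (rule Bochner_Integration.integrable_bound)
      show "integrable lborel (\<lambda>u::'a. B * (M * exp (- norm u)))"
        by (intro integrable_mult_right integrable_exp_minus_norm)
      show "AE u in lborel. norm (F u * k u) \<le> norm (B * (M * exp (- norm u)))"
        using AE B
      proof eventually_elim
        fix u assume "f u = F u" "norm (f u) \<le> B"
        then have "norm (F u * k u) \<le> B * (M * exp (- norm u))"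
          unfolding norm_mult using bound[of u] by (intro mult_mono) (auto intro: order_trans[OF norm_ge_zero])
        then show "norm (F u * k u) \<le> norm (B * (M * exp (- norm u)))" by simp
      qed
    qed measurable
  next
    case False
    define s where "s = enn2real r"
    have s: "1 \<le> s" using r False enn2real_mono[of 1 r] by (simp add: s_def top.not_eq_extremum)
    have "integrable lebesgue (\<lambda>x. norm (f x) powr s)" using f False by (simp add: Lr_space_def s_def)
    then have "integrable lebesgue (\<lambda>x. norm (F x) powr s)"
    proof (rule integrable_cong_AE[THEN iffD1, rotated -1])
      show "AE x in lebesgue. norm (f x) powr s = norm (F x) powr s"
        using AE by (intro AE_completion) (auto elim: eventually_mono)
    qed (use f_meas F_meas in measurable)
    then have Fs: "integrable lborel (\<lambda>x. norm (F x) powr s)"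
      by (subst (asm) integrable_completion) auto
    show ?thesis
    proof (rule Bochner_Integration.integrable_bound)
      show "integrable lborel (\<lambda>u::'a. M * exp (- norm u) + M * (norm (F u) powr s))"
        by (intro Bochner_Integration.integrable_add integrable_mult_right integrable_exp_minus_norm Fs)
      show "AE u in lborel. norm (F u * k u) \<le> norm (M * exp (- norm u) + M * (norm (F u) powr s))"
      proof (rule AE_I2)
        fix u
        have "norm (F u) \<le> 1 + norm (F u) powr s"
        proof (cases "norm (F u) \<le> 1")
          case False
          then have "norm (F u) powr 1 \<le> norm (F u) powr s" using s by (intro powr_mono) auto
          then show ?thesis using False by simp
        qed (auto intro: add_increasing2)
        then have "norm (F u * k u) \<le> (1 + norm (F u) powr s) * (M * exp (- norm u))"
          unfolding norm_mult using bound[of u] by (intro mult_mono) auto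
        also have "\<dots> \<le> M * exp (- norm u) + M * (norm (F u) powr s)"
          using M mult_left_mono[of "exp (- norm u)" 1 "M * (norm (F u) powr s)"] by (simp add: algebra_simps)
        finally show "norm (F u * k u) \<le> norm (M * exp (- norm u) + M * (norm (F u) powr s))" by simp
      qed
    qed measurable
  qed
qed

section \<open>Polynomial functions and their directional derivatives\<close>

text \<open>Complex-valued polynomial functions of the real coordinates. The inductive description makes
  differentiability, growth, and the symmetry of second derivatives simple inductions.\<close>

inductive polyfun :: "('a::euclidean_space \<Rightarrow> complex) \<Rightarrow> bool" where
  const: "polyfun (\<lambda>_. c)"
| linear: "bounded_linear L \<Longrightarrow> polyfun L"
| add: "polyfun F \<Longrightarrow> polyfun G \<Longrightarrow> polyfun (\<lambda>u. F u + G u)"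
| mult: "polyfun F \<Longrightarrow> polyfun G \<Longrightarrow> polyfun (\<lambda>u. F u * G u)"

lemma polyfun_power: "polyfun F \<Longrightarrow> polyfun (\<lambda>u. F u ^ k)"
  by (induction k) (auto intro: polyfun.intros)

lemma polyfun_continuous: "polyfun F \<Longrightarrow> continuous_on S F"
  by (induction rule: polyfun.induct) (simp_all add: continuous_intros linear_continuous_on)

lemma polyfun_exp_growth: "polyfun F \<Longrightarrow> exp_growth F"
  by (induction rule: polyfun.induct) auto

lemma polyfun_borel: "polyfun F \<Longrightarrow> F \<in> borel_measurable borel"
  by (intro borel_measurable_continuous_onI polyfun_continuous)

lemma linear_has_dir_deriv:
  assumes "bounded_linear L"
  shows "((\<lambda>t. L (x + t *\<^sub>R v)) has_vector_derivative L v) (at t0)"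
  using assms by (auto intro!: derivative_eq_intros simp: bounded_linear.linear linear_add linear_scale)

text \<open>The derivative is produced together with the proof that it is a polynomial function again, since
  \<open>dir_deriv\<close> is defined by a choice of the derivative at each point.\<close>

lemma polyfun_has_dir_deriv_ex:
  "polyfun F \<Longrightarrow> \<exists>F'. polyfun F' \<and> (\<forall>x. ((\<lambda>t. F (x + t *\<^sub>R v)) has_vector_derivative F' x) (at 0))"
proof (induction rule: polyfun.induct)
  case (const c)
  show ?case by (rule exI[of _ "\<lambda>_. 0"]) (auto intro: polyfun.const)
next
  case (linear L)
  show ?case
    by (rule exI[of _ "\<lambda>_. L v"]) (auto intro: polyfun.const linear_has_dir_deriv[OF linear])
next
  case (add F G)
  then obtain F' G' where "polyfun F'" "\<And>x. ((\<lambda>t. F (x + t *\<^sub>R v)) has_vector_derivative F' x) (at 0)"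
    "polyfun G'" "\<And>x. ((\<lambda>t. G (x + t *\<^sub>R v)) has_vector_derivative G' x) (at 0)" by blast
  then show ?case
    by (intro exI[of _ "\<lambda>u. F' u + G' u"]) (auto intro: polyfun.add has_vector_derivative_add)
next
  case (mult F G)
  then obtain F' G' where *: "polyfun F'" "\<And>x. ((\<lambda>t. F (x + t *\<^sub>R v)) has_vector_derivative F' x) (at 0)"
    "polyfun G'" "\<And>x. ((\<lambda>t. G (x + t *\<^sub>R v)) has_vector_derivative G' x) (at 0)" by blast
  have "((\<lambda>t. F (x + t *\<^sub>R v) * G (x + t *\<^sub>R v)) has_vector_derivative (F x * G' x + F' x * G x)) (at 0)" for x
    using has_vector_derivative_mult[OF *(2)[of x] *(4)[of x]] by simp
  with * mult show ?case
    by (intro exI[of _ "\<lambda>u. F u * G' u + F' u * G u"]) (simp add: polyfun.add polyfun.mult)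
qed

lemma
  assumes "polyfun F"
  shows polyfun_has_dir_deriv: "((\<lambda>t. F (x + t *\<^sub>R v)) has_vector_derivative dir_deriv v F x) (at 0)"
    and polyfun_dir_deriv: "polyfun (dir_deriv v F)"
proof -
  obtain F' where F': "polyfun F'" "\<And>x. ((\<lambda>t. F (x + t *\<^sub>R v)) has_vector_derivative F' x) (at 0)"
    using polyfun_has_dir_deriv_ex[OF assms] by blast
  then have "dir_deriv v F = F'"
    by (auto simp: dir_deriv_def fun_eq_iff intro: vector_derivative_at)
  with F' show "((\<lambda>t. F (x + t *\<^sub>R v)) has_vector_derivative dir_deriv v F x) (at 0)" "polyfun (dir_deriv v F)"
    by auto
qed

lemma dir_deriv_const: "dir_deriv v (\<lambda>_. c) = (\<lambda>_. 0)"
  by (simp add: dir_deriv_def fun_eq_iff)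

lemma dir_deriv_linear: "bounded_linear L \<Longrightarrow> dir_deriv v L = (\<lambda>_. L v)"
  unfolding dir_deriv_def fun_eq_iff by (blast intro: vector_derivative_at linear_has_dir_deriv)

lemma dir_deriv_add:
  "polyfun F \<Longrightarrow> polyfun G \<Longrightarrow> dir_deriv v (\<lambda>u. F u + G u) = (\<lambda>u. dir_deriv v F u + dir_deriv v G u)"
  by (rule ext, subst (1) dir_deriv_def)
     (auto intro!: vector_derivative_at has_vector_derivative_add polyfun_has_dir_deriv)

lemma dir_deriv_mult:
  assumes "polyfun F" "polyfun G"
  shows "dir_deriv v (\<lambda>u. F u * G u) = (\<lambda>u. F u * dir_deriv v G u + dir_deriv v F u * G u)"
proof
  fix x
  show "dir_deriv v (\<lambda>u. F u * G u) x = F x * dir_deriv v G x + dir_deriv v F x * G x"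
    using has_vector_derivative_mult[OF polyfun_has_dir_deriv[OF assms(1), of x v] polyfun_has_dir_deriv[OF assms(2), of x v]]
    by (subst (1) dir_deriv_def) (auto intro!: vector_derivative_at)
qed

lemmas dir_deriv_simps = dir_deriv_const dir_deriv_linear dir_deriv_add dir_deriv_mult

lemma dir_deriv_cmult: "polyfun F \<Longrightarrow> dir_deriv v (\<lambda>u. c * F u) = (\<lambda>u. c * dir_deriv v F u)"
  by (simp add: dir_deriv_simps polyfun.const)

lemma dir_deriv_commute:
  "polyfun F \<Longrightarrow> dir_deriv v (dir_deriv w F) = dir_deriv w (dir_deriv v F)"
  by (induction rule: polyfun.induct)
     (simp_all add: dir_deriv_simps polyfun_dir_deriv polyfun.intros fun_eq_iff)

text \<open>Linearity of the derivative in the direction.\<close>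

lemma dir_deriv_expand:
  "polyfun F \<Longrightarrow> dir_deriv v F x = (\<Sum>b\<in>Basis. of_real (v \<bullet> b) * dir_deriv b F x)"
proof (induction rule: polyfun.induct)
  case (linear L)
  have "L v = L (\<Sum>b\<in>Basis. (v \<bullet> b) *\<^sub>R b)" by (simp add: euclidean_representation)
  also have "\<dots> = (\<Sum>b\<in>Basis. of_real (v \<bullet> b) * L b)"
    using linear by (simp add: bounded_linear.linear linear_sum linear_scale scaleR_conv_of_real)
  finally show ?case using linear by (simp add: dir_deriv_linear)
qed (simp_all add: dir_deriv_simps sum.distrib sum_distrib_left sum_distrib_right ring_distribs mult_ac)

text \<open>Constant-coefficient operators commute.\<close>

lemma laplacian_dir_deriv:
  assumes F: "polyfun F" and "\<And>x. laplacian F x = 0"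
  shows "laplacian (dir_deriv v F) x = 0"
proof -
  have fin: "polyfun (\<lambda>u. \<Sum>b\<in>A. G b u) \<and>
      dir_deriv v (\<lambda>u. \<Sum>b\<in>A. G b u) = (\<lambda>u. \<Sum>b\<in>A. dir_deriv v (G b) u)"
    if "finite A" "\<And>b. polyfun (G b)" for A and G :: "'a \<Rightarrow> 'a \<Rightarrow> complex"
    using that by (induction A rule: finite_induct) (simp_all add: dir_deriv_simps polyfun.const polyfun.add)
  have "laplacian (dir_deriv v F) x = (\<Sum>b\<in>Basis. dir_deriv v (dir_deriv b (dir_deriv b F)) x)"
    by (simp add: laplacian_def dir_deriv_commute[OF F, of _ v] dir_deriv_commute[OF polyfun_dir_deriv[OF F], of _ v])
  also have "\<dots> = dir_deriv v (laplacian F) x"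
    unfolding laplacian_def[abs_def] using fin[OF finite_Basis, of "\<lambda>b. dir_deriv b (dir_deriv b F)"]
    by (simp add: polyfun_dir_deriv F)
  also have "laplacian F = (\<lambda>_. 0)" using assms(2) by auto
  finally show ?thesis by (simp add: dir_deriv_const)
qed

lemma laplacian_lincomb:
  assumes "polyfun F" "polyfun G" "\<And>x. laplacian F x = 0" "\<And>x. laplacian G x = 0"
  shows "laplacian (\<lambda>u. a * F u + b * G u) x = 0"
proof -
  have "laplacian (\<lambda>u. a * F u + b * G u) x = a * laplacian F x + b * laplacian G x"
    unfolding laplacian_def
    by (simp add: dir_deriv_add dir_deriv_cmult polyfun_dir_deriv polyfun.mult polyfun.const assms
        sum.distrib sum_distrib_left)
  then show ?thesis using assms by simp
qed

section \<open>Gaussian integrals of polynomials\<close>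

lemma integral_lborel_shift:
  fixes g :: "'a::euclidean_space \<Rightarrow> 'b::{banach, second_countable_topology}"
  assumes [measurable]: "g \<in> borel_measurable borel"
  shows "(LINT x|lborel. g (x + w)) = (LINT x|lborel. g x)"
    and "integrable lborel (\<lambda>x. g (x + w)) \<longleftrightarrow> integrable lborel g"
proof -
  have "(LINT x|distr lborel borel ((+) w). g x) = (LINT x|lborel. g (w + x))"
    by (rule integral_distr) auto
  then show "(LINT x|lborel. g (x + w)) = (LINT x|lborel. g x)"
    by (simp add: lborel_distr_plus add.commute)
  have "integrable (distr lborel borel ((+) w)) g \<longleftrightarrow> integrable lborel (\<lambda>x. g (w + x))"
    by (rule integrable_distr_eq) auto
  then show "integrable lborel (\<lambda>x. g (x + w)) \<longleftrightarrow> integrable lborel g"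
    by (simp add: lborel_distr_plus add.commute)
qed

text \<open>Integrating \<open>H(x + v) - H(x)\<close>, written as an integral of \<open>H'\<close> along the segment, gives zero by
  translation invariance on the one side and the integral of \<open>H'\<close> by Fubini on the other.\<close>

lemma integral_directional_derivative_eq_0:
  fixes H H' :: "'a::euclidean_space \<Rightarrow> complex"
  assumes deriv: "\<And>x. ((\<lambda>t. H (x + t *\<^sub>R v)) has_vector_derivative H' x) (at 0)"
    and cont: "continuous_on UNIV H'"
    and H: "integrable lborel H" and H': "integrable lborel H'"
  shows "(LINT x|lborel. H' x) = 0"
proof -
  have [measurable]: "H' \<in> borel_measurable borel"
    using cont by (rule borel_measurable_continuous_onI)
  have [measurable]: "H \<in> borel_measurable borel"
    using H by (simp add: borel_measurable_integrable)
  have deriv': "((\<lambda>t. H (x + t *\<^sub>R v)) has_vector_derivative H' (x + s *\<^sub>R v)) (at s)" for x s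
  proof -
    have "(((\<lambda>t. H ((x + s *\<^sub>R v) + t *\<^sub>R v)) \<circ> (\<lambda>t. t - s)) has_vector_derivative 1 *\<^sub>R H' (x + s *\<^sub>R v)) (at s)"
      by (rule vector_diff_chain_at) (auto intro!: derivative_eq_intros deriv)
    then show ?thesis by (simp add: o_def algebra_simps)
  qed
  define f where "f t x = indicator {0..1} t *\<^sub>R H' (x + t *\<^sub>R v)" for t :: real and x
  have ftc: "(LINT t|lborel. f t x) = H (x + v) - H x" for x
  proof -
    have "(LINT t|lborel. indicator {0..1} t *\<^sub>R H' (x + t *\<^sub>R v)) = H (x + 1 *\<^sub>R v) - H (x + 0 *\<^sub>R v)"
      by (rule integral_FTC_atLeastAtMost)
         (auto intro: has_vector_derivative_at_within deriv' continuous_on_compose2[OF cont] intro!: continuous_intros)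
    then show ?thesis by (simp add: f_def)
  qed
  have norm': "(LINT x|lborel. norm (f t x)) = indicator {0..1} t * (LINT x|lborel. norm (H' x))" for t
    using integral_lborel_shift(1)[of "\<lambda>x. norm (H' x)" "t *\<^sub>R v"] by (simp add: f_def)
  have fint: "integrable lborel (f t)" for t
    unfolding f_def using integral_lborel_shift(2)[of H' "t *\<^sub>R v"] H' by (intro integrable_scaleR_right) simp
  have "integrable (lborel \<Otimes>\<^sub>M lborel) (case_prod f)"
  proof (rule lborel_pair.Fubini_integrable)
    show "case_prod f \<in> borel_measurable (lborel \<Otimes>\<^sub>M lborel)"
      unfolding f_def by measurable
    show "integrable lborel (\<lambda>t. LINT x|lborel. norm (case (t, x) of (t, x) \<Rightarrow> f t x))"
      by (auto simp: norm' intro!: integrable_mult_left)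
    show "AE t in lborel. integrable lborel (\<lambda>x. case (t, x) of (t, x) \<Rightarrow> f t x)"
      using fint by simp
  qed
  then have "(LINT x|lborel. LINT t|lborel. f t x) = (LINT t|lborel. LINT x|lborel. f t x)"
    by (rule lborel_pair.Fubini_integral)
  also have "(LINT x|lborel. LINT t|lborel. f t x) = 0"
    using H integral_lborel_shift[of H v] unfolding ftc by simp
  also have "(\<lambda>t. LINT x|lborel. f t x) = (\<lambda>t. indicator {0..1} t *\<^sub>R (LINT x|lborel. H' x))"
    unfolding f_def using integral_lborel_shift(1)[of H'] by (intro ext) simp
  also have "(LINT t|lborel. \<dots> t) = (LINT x|lborel. H' x)"
    by (simp add: scaleR_conv_of_real)
  finally show ?thesis by simp
qed

definition gauss_integral :: "('a::euclidean_space \<Rightarrow> complex) \<Rightarrow> complex" where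
  "gauss_integral G = (LINT u|lborel. G u * of_real (exp (- (norm u)\<^sup>2)))"

lemma integrable_polyfun_gauss:
  "polyfun G \<Longrightarrow> integrable lborel (\<lambda>u. G u * of_real (exp (- (norm u)\<^sup>2)))"
  using integrable_exp_growth_gauss[of G 1] by (simp add: polyfun_exp_growth polyfun_borel)

lemma gauss_integral_add:
  "polyfun F \<Longrightarrow> polyfun G \<Longrightarrow> gauss_integral (\<lambda>u. F u + G u) = gauss_integral F + gauss_integral G"
  unfolding gauss_integral_def
  by (simp add: ring_distribs integrable_polyfun_gauss del: of_real_exp)

lemma gauss_integral_cmult: "gauss_integral (\<lambda>u. c * G u) = c * gauss_integral G"
  unfolding gauss_integral_def by (simp add: mult.assoc)

lemma polyfun_inner: "polyfun (\<lambda>u. of_real (u \<bullet> v))"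
  by (rule polyfun.linear) (intro bounded_linear_compose[OF bounded_linear_of_real] bounded_linear_inner_left)

text \<open>The directional derivative of a polynomial times the Gaussian integrates to zero.\<close>

lemma gauss_integral_by_parts:
  assumes "polyfun G"
  shows "gauss_integral (dir_deriv v G) = gauss_integral (\<lambda>u. 2 * of_real (u \<bullet> v) * G u)"
proof -
  let ?g = "\<lambda>u. complex_of_real (exp (- (norm u)\<^sup>2))"
  let ?F = "\<lambda>u. dir_deriv v G u + (- 1) * (2 * of_real (u \<bullet> v) * G u)"
  have F: "polyfun ?F"
    by (intro polyfun.intros polyfun_dir_deriv polyfun_inner assms)
  have "(LINT u|lborel. ?F u * ?g u) = 0"
  proof (rule integral_directional_derivative_eq_0[where v = v and H = "\<lambda>u. G u * ?g u"])
    fix x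
    have "((\<lambda>t. exp (- ((x + t *\<^sub>R v) \<bullet> (x + t *\<^sub>R v)))) has_real_derivative - (2 * (x \<bullet> v)) * exp (- (x \<bullet> x))) (at 0)"
      by (auto intro!: derivative_eq_intros simp: inner_commute algebra_simps)
    then have "((\<lambda>t. exp (- (norm (x + t *\<^sub>R v))\<^sup>2)) has_vector_derivative - (2 * (x \<bullet> v)) * exp (- (norm x)\<^sup>2)) (at 0)"
      unfolding has_real_derivative_iff_has_vector_derivative power2_norm_eq_inner .
    then have g: "((\<lambda>t. ?g (x + t *\<^sub>R v)) has_vector_derivative of_real (- (2 * (x \<bullet> v)) * exp (- (norm x)\<^sup>2))) (at 0)"
      using bounded_linear.has_vector_derivative[OF bounded_linear_of_real] by blast
    show "((\<lambda>t. G (x + t *\<^sub>R v) * ?g (x + t *\<^sub>R v)) has_vector_derivative ?F x * ?g x) (at 0)"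
      using has_vector_derivative_mult[OF polyfun_has_dir_deriv[OF assms, of x v] g]
      by (simp add: algebra_simps)
  next
    show "continuous_on UNIV (\<lambda>u. ?F u * ?g u)"
      by (intro continuous_intros polyfun_continuous[OF F])
  qed (use integrable_polyfun_gauss[OF assms] integrable_polyfun_gauss[OF F] in simp_all)
  then have "gauss_integral ?F = 0" by (simp add: gauss_integral_def)
  also have "gauss_integral ?F = gauss_integral (dir_deriv v G) + (- 1) * gauss_integral (\<lambda>u. 2 * of_real (u \<bullet> v) * G u)"
    by (subst gauss_integral_add, intro polyfun_dir_deriv assms)
       (intro polyfun.intros polyfun_inner assms, simp only: gauss_integral_cmult)
  finally show ?thesis by simp
qed

lemma gaussian_moment:
  defines "\<mu> \<equiv> \<lambda>r. LINT t:{0..}|lborel. complex_of_real (exp (- t\<^sup>2)) * of_real (t ^ r)"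
  shows "set_integrable lborel {0..} (\<lambda>t. complex_of_real (exp (- t\<^sup>2)) * of_real (t ^ r))"
    and "\<mu> r \<noteq> 0" and "\<mu> (2 * k + 1) = fact k / 2"
proof -
  have of_real: "set_integrable lborel {0..} (\<lambda>t. complex_of_real (exp (- t\<^sup>2)) * of_real (t ^ r)) \<and> \<mu> r = of_real c \<and> (c \<noteq> 0 \<longrightarrow> \<mu> r \<noteq> 0)"
    if "has_bochner_integral lborel (\<lambda>x::real. indicator {0..} x *\<^sub>R (exp (-x\<^sup>2) * x ^ r)) c" for r c
  proof -
    have "has_bochner_integral lborel (\<lambda>x::real. complex_of_real (indicator {0..} x *\<^sub>R (exp (-x\<^sup>2) * x ^ r))) (of_real c)"
      using that by (rule has_bochner_integral_of_real)
    also have "(\<lambda>x::real. complex_of_real (indicator {0..} x *\<^sub>R (exp (-x\<^sup>2) * x ^ r)))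
        = (\<lambda>x. indicator {0..} x *\<^sub>R (complex_of_real (exp (- x\<^sup>2)) * of_real (x ^ r)))"
      by (simp add: fun_eq_iff scaleR_conv_of_real)
    finally show ?thesis
      unfolding \<mu>_def set_integrable_def set_lebesgue_integral_def by (simp add: has_bochner_integral_iff)
  qed
  note even = of_real[OF gaussian_moment_even_pos] and odd = of_real[OF gaussian_moment_odd_pos]
  show "\<mu> (2 * k + 1) = fact k / 2" using odd[of k] by simp
  have "set_integrable lborel {0..} (\<lambda>t. complex_of_real (exp (- t\<^sup>2)) * of_real (t ^ r)) \<and> \<mu> r \<noteq> 0"
  proof (cases "even r")
    case True
    then obtain j where "r = 2 * j" by blast
    then show ?thesis using even[of j] by (simp del: of_real_power)
  next
    case False
    then obtain j where "r = 2 * j + 1" by (blast elim: oddE)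
    then show ?thesis using odd[of j] by (simp del: of_real_power)
  qed
  then show "set_integrable lborel {0..} (\<lambda>t. complex_of_real (exp (- t\<^sup>2)) * of_real (t ^ r))" "\<mu> r \<noteq> 0"
    by auto
qed

lemma gauss_integral_sum:
  "finite A \<Longrightarrow> (\<And>i. i \<in> A \<Longrightarrow> polyfun (F i)) \<Longrightarrow>
    polyfun (\<lambda>u. \<Sum>i\<in>A. F i u) \<and> gauss_integral (\<lambda>u. \<Sum>i\<in>A. F i u) = (\<Sum>i\<in>A. gauss_integral (F i))"
proof (induction A rule: finite_induct)
  case empty
  then show ?case by (simp add: polyfun.const gauss_integral_def)
next
  case (insert x A)
  then show ?case by (simp add: polyfun.add gauss_integral_add)
qed

section \<open>Wirtinger derivatives\<close>

text \<open>The operators \<open>\<Sum>\<^sub>j w\<^sub>j \<partial>/\<partial>u\<^sub>j\<close> and, below, \<open>\<Sum>\<^sub>j cnj w\<^sub>j \<partial>/\<partial>(cnj u\<^sub>j)\<close>, expressed through real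
  directional derivatives.\<close>

definition wirtinger :: "complex ^ 'n \<Rightarrow> (complex ^ 'n \<Rightarrow> complex) \<Rightarrow> complex ^ 'n \<Rightarrow> complex" where
  "wirtinger w G u = 1/2 * dir_deriv w G u + (- \<i>/2) * dir_deriv (\<i> *s w) G u"

definition wirtinger_cnj :: "complex ^ 'n \<Rightarrow> (complex ^ 'n \<Rightarrow> complex) \<Rightarrow> complex ^ 'n \<Rightarrow> complex" where
  "wirtinger_cnj w G u = 1/2 * dir_deriv w G u + (\<i>/2) * dir_deriv (\<i> *s w) G u"

lemmas wirtinger_defs = wirtinger_def[abs_def] wirtinger_cnj_def[abs_def]

lemma polyfun_coord: "polyfun (\<lambda>u::complex ^ 'n. u $ j)" "polyfun (\<lambda>u::complex ^ 'n. cnj (u $ j))"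
  by (intro polyfun.linear bounded_linear_vec_nth bounded_linear_compose[OF bounded_linear_cnj])+

lemma polyfun_wirtinger: "polyfun F \<Longrightarrow> polyfun (wirtinger w F)" "polyfun F \<Longrightarrow> polyfun (wirtinger_cnj w F)"
  unfolding wirtinger_defs by (intro polyfun.add polyfun.mult[OF polyfun.const] polyfun_dir_deriv; assumption)+

lemma laplacian_wirtinger:
  assumes "polyfun F" "\<And>x. laplacian F x = 0"
  shows "laplacian (wirtinger w F) x = 0" "laplacian (wirtinger_cnj w F) x = 0"
  unfolding wirtinger_defs
  by (intro laplacian_lincomb laplacian_dir_deriv polyfun_dir_deriv assms)+

lemma wirtinger_const: "wirtinger w (\<lambda>_. c) = (\<lambda>_. 0)" "wirtinger_cnj w (\<lambda>_. c) = (\<lambda>_. 0)"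
  by (simp_all add: wirtinger_defs dir_deriv_const)

lemma wirtinger_coord:
  "wirtinger w (\<lambda>u. u $ j) = (\<lambda>_. w $ j)" "wirtinger_cnj w (\<lambda>u. u $ j) = (\<lambda>_. 0)"
  "wirtinger w (\<lambda>u. cnj (u $ j)) = (\<lambda>_. 0)" "wirtinger_cnj w (\<lambda>u. cnj (u $ j)) = (\<lambda>_. cnj (w $ j))"
  by (simp_all add: wirtinger_defs dir_deriv_linear bounded_linear_vec_nth
      bounded_linear_compose[OF bounded_linear_cnj bounded_linear_vec_nth] field_simps)

lemma wirtinger_add:
  assumes "polyfun F" "polyfun G"
  shows "wirtinger w (\<lambda>u. F u + G u) = (\<lambda>u. wirtinger w F u + wirtinger w G u)"
    "wirtinger_cnj w (\<lambda>u. F u + G u) = (\<lambda>u. wirtinger_cnj w F u + wirtinger_cnj w G u)"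
  by (simp_all add: wirtinger_defs dir_deriv_add[OF assms] fun_eq_iff algebra_simps add_divide_distrib)

lemma wirtinger_mult:
  assumes "polyfun F" "polyfun G"
  shows "wirtinger w (\<lambda>u. F u * G u) = (\<lambda>u. F u * wirtinger w G u + wirtinger w F u * G u)"
    "wirtinger_cnj w (\<lambda>u. F u * G u) = (\<lambda>u. F u * wirtinger_cnj w G u + wirtinger_cnj w F u * G u)"
  by (simp_all add: wirtinger_defs dir_deriv_mult[OF assms] fun_eq_iff algebra_simps add_divide_distrib)

lemma wirtinger_power:
  assumes "polyfun F"
  shows "wirtinger w (\<lambda>u. F u ^ k) = (\<lambda>u. of_nat k * F u ^ (k - 1) * wirtinger w F u)"
    "wirtinger_cnj w (\<lambda>u. F u ^ k) = (\<lambda>u. of_nat k * F u ^ (k - 1) * wirtinger_cnj w F u)"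
proof -
  have "wirtinger w (\<lambda>u. F u ^ k) = (\<lambda>u. of_nat k * F u ^ (k - 1) * wirtinger w F u) \<and>
    wirtinger_cnj w (\<lambda>u. F u ^ k) = (\<lambda>u. of_nat k * F u ^ (k - 1) * wirtinger_cnj w F u)"
  proof (induction k)
    case (Suc k)
    then show ?case
      by (cases k) (simp_all add: wirtinger_mult assms polyfun_power wirtinger_const polyfun.mult fun_eq_iff algebra_simps)
  qed (simp add: wirtinger_const)
  then show "wirtinger w (\<lambda>u. F u ^ k) = (\<lambda>u. of_nat k * F u ^ (k - 1) * wirtinger w F u)"
    "wirtinger_cnj w (\<lambda>u. F u ^ k) = (\<lambda>u. of_nat k * F u ^ (k - 1) * wirtinger_cnj w F u)" by auto
qed

lemma bounded_linear_hermitian_dot: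
  "bounded_linear (\<lambda>u::complex ^ 'n. hermitian_dot u z)" "bounded_linear (\<lambda>u::complex ^ 'n. hermitian_dot z u)"
  unfolding hermitian_dot_def
  by (intro bounded_linear_sum bounded_linear_mult_const bounded_linear_const_mult
      bounded_linear_vec_nth bounded_linear_compose[OF bounded_linear_cnj])+

lemmas polyfun_hermitian_dot = bounded_linear_hermitian_dot[THEN polyfun.linear]

lemma hermitian_dot_scale:
  "hermitian_dot (\<i> *s w) z = \<i> * hermitian_dot w z" "hermitian_dot z (\<i> *s w) = - \<i> * hermitian_dot z w"
  by (simp_all add: hermitian_dot_def sum_distrib_left mult_ac flip: sum_negf)

lemma wirtinger_hermitian_dot:
  "wirtinger w (\<lambda>u. hermitian_dot u z) = (\<lambda>_. hermitian_dot w z)"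
  "wirtinger_cnj w (\<lambda>u. hermitian_dot u z) = (\<lambda>_. 0)"
  "wirtinger w (\<lambda>u. hermitian_dot z u) = (\<lambda>_. 0)"
  "wirtinger_cnj w (\<lambda>u. hermitian_dot z u) = (\<lambda>_. hermitian_dot z w)"
  by (simp_all add: wirtinger_defs dir_deriv_linear bounded_linear_hermitian_dot hermitian_dot_scale field_simps)

lemma hermitian_dot_self: "hermitian_dot z z = of_real ((norm z)\<^sup>2)"
proof -
  have "(norm z)\<^sup>2 = (\<Sum>j\<in>UNIV. (norm (z $ j))\<^sup>2)"
    by (simp add: norm_vec_def L2_set_def sum_nonneg)
  then show ?thesis
    by (simp only: hermitian_dot_def of_real_sum complex_norm_square)
qed

lemma cnj_hermitian_dot: "cnj (hermitian_dot z u) = hermitian_dot u z"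
  by (simp add: hermitian_dot_def mult.commute)

lemma Re_hermitian_dot: "Re (hermitian_dot z u) = z \<bullet> u"
  by (simp add: hermitian_dot_def inner_vec_def inner_complex_def)

text \<open>This combination of real inner products is the one that arises when \<open>wirtinger z\<close> is
  integrated by parts.\<close>

lemma hermitian_dot_conv_inner: 
  "hermitian_dot z u = of_real (u \<bullet> z) - \<i> * of_real (u \<bullet> (\<i> *s z))"
proof -
  have "Re (hermitian_dot z u) = u \<bullet> z"
    by (simp add: Re_hermitian_dot inner_commute)
  moreover have "u \<bullet> (\<i> *s z) = - Im (hermitian_dot z u)"
    using Re_hermitian_dot[of "\<i> *s z" u] by (simp add: hermitian_dot_scale inner_commute)
  ultimately show ?thesis by (simp add: complex_eq_iff)
qed

text \<open>The Wirtinger derivative of the Gaussian in \<open>u\<close> is \<open>- cnj u\<close> times the Gaussian, so integration by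
  parts trades derivatives in \<open>u\<close> for factors \<open>cnj u\<close>, and conversely.\<close>

lemma gauss_integral_wirtinger:
  assumes "polyfun G"
  shows "gauss_integral (wirtinger z G) = gauss_integral (\<lambda>u. hermitian_dot z u * G u)" (is ?a)
    and "gauss_integral (wirtinger_cnj z G) = gauss_integral (\<lambda>u. hermitian_dot u z * G u)" (is ?b)
proof -
  have *: "gauss_integral (\<lambda>u. 1/2 * dir_deriv z G u + c * dir_deriv (\<i> *s z) G u)
     = gauss_integral (\<lambda>u. (of_real (u \<bullet> z) + 2 * c * of_real (u \<bullet> (\<i> *s z))) * G u)" for c
  proof -
    have p: "polyfun (\<lambda>u. 2 * of_real (u \<bullet> v) * G u)" for v
      by (intro polyfun.mult polyfun.const polyfun_inner assms)
    have "gauss_integral (\<lambda>u. 1/2 * dir_deriv z G u + c * dir_deriv (\<i> *s z) G u)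
      = 1/2 * gauss_integral (\<lambda>u. 2 * of_real (u \<bullet> z) * G u) + c * gauss_integral (\<lambda>u. 2 * of_real (u \<bullet> (\<i> *s z)) * G u)"
      by (subst gauss_integral_add, (intro polyfun.mult polyfun.const polyfun_dir_deriv assms)+)
         (simp only: gauss_integral_cmult gauss_integral_by_parts[OF assms])
    also have "\<dots> = gauss_integral (\<lambda>u. 1/2 * (2 * of_real (u \<bullet> z) * G u) + c * (2 * of_real (u \<bullet> (\<i> *s z)) * G u))"
      by (subst gauss_integral_add, (intro polyfun.mult[OF polyfun.const] p)+) (simp only: gauss_integral_cmult)
    finally show ?thesis by (simp add: algebra_simps)
  qed
  show ?a
    unfolding wirtinger_def[abs_def] * hermitian_dot_conv_inner by simp
  have "hermitian_dot u z = of_real (u \<bullet> z) + \<i> * of_real (u \<bullet> (\<i> *s z))" for u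
    by (subst cnj_hermitian_dot[symmetric], subst hermitian_dot_conv_inner) simp
  then show ?b
    unfolding wirtinger_cnj_def[abs_def] * by simp
qed

section \<open>Bihomogeneous polynomials\<close>

text \<open>Polynomials of bidegree \<open>(p, q)\<close> in \<open>u\<close> and \<open>cnj u\<close>. The zero function is included in every
  bidegree, so that derivatives stay in the class. Unlike an explicit coefficient family, this form
  is closed under products by its very definition.\<close>

inductive bihom :: "nat \<Rightarrow> nat \<Rightarrow> (complex ^ 'n::finite \<Rightarrow> complex) \<Rightarrow> bool" where
  zero: "bihom p q (\<lambda>_. 0)"
| const: "bihom 0 0 (\<lambda>_. c)"
| coord: "bihom 1 0 (\<lambda>u. u $ j)"
| cnj_coord: "bihom 0 1 (\<lambda>u. cnj (u $ j))"
| add: "bihom p q F \<Longrightarrow> bihom p q G \<Longrightarrow> bihom p q (\<lambda>u. F u + G u)"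
| mult: "bihom p q F \<Longrightarrow> bihom p' q' G \<Longrightarrow> bihom (p + p') (q + q') (\<lambda>u. F u * G u)"

lemma bihom_polyfun: "bihom p q P \<Longrightarrow> polyfun P"
  by (induction rule: bihom.induct) (simp_all add: polyfun.const polyfun_coord polyfun.add polyfun.mult)

lemma bihom_mult_eq:
  "bihom p q F \<Longrightarrow> bihom p' q' G \<Longrightarrow> a = p + p' \<Longrightarrow> b = q + q' \<Longrightarrow> bihom a b (\<lambda>u. F u * G u)"
  by (simp add: bihom.mult)

text \<open>Truncated subtraction in \<open>p - 1\<close> does no harm, because for \<open>p = 0\<close> the derivative is the zero
  function.\<close>

lemma bihom_wirtinger_aux:
  "bihom p q P \<Longrightarrow> (p = 0 \<longrightarrow> wirtinger w P = (\<lambda>_. 0)) \<and> bihom (p - 1) q (wirtinger w P) \<and>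
     (q = 0 \<longrightarrow> wirtinger_cnj w P = (\<lambda>_. 0)) \<and> bihom p (q - 1) (wirtinger_cnj w P)"
proof (induction rule: bihom.induct)
  case (add p q F G)
  then show ?case by (auto simp: wirtinger_add bihom_polyfun intro: bihom.add bihom.zero)
next
  case (mult p q F p' q' G)
  have 1: "bihom (p + p' - 1) (q + q') (\<lambda>u. F u * wirtinger w G u)"
    using mult by (cases p') (auto intro: bihom.zero bihom_mult_eq)
  have 2: "bihom (p + p' - 1) (q + q') (\<lambda>u. wirtinger w F u * G u)"
    using mult by (cases p) (auto intro: bihom.zero bihom_mult_eq)
  have 3: "bihom (p + p') (q + q' - 1) (\<lambda>u. F u * wirtinger_cnj w G u)"
    using mult by (cases q') (auto intro: bihom.zero bihom_mult_eq)
  have 4: "bihom (p + p') (q + q' - 1) (\<lambda>u. wirtinger_cnj w F u * G u)"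
    using mult by (cases q) (auto intro: bihom.zero bihom_mult_eq)
  show ?case
    using mult bihom.add[OF 1 2] bihom.add[OF 3 4] by (auto simp: wirtinger_mult bihom_polyfun)
qed (auto simp: wirtinger_const wirtinger_coord intro: bihom.intros)

lemma bihom_wirtinger: "bihom (Suc p) q P \<Longrightarrow> bihom p q (wirtinger w P)"
  and bihom_wirtinger_cnj: "bihom p (Suc q) P \<Longrightarrow> bihom p q (wirtinger_cnj w P)"
  and wirtinger_eq_0: "bihom 0 q P \<Longrightarrow> wirtinger w P = (\<lambda>_. 0)"
  and wirtinger_cnj_eq_0: "bihom p 0 P \<Longrightarrow> wirtinger_cnj w P = (\<lambda>_. 0)"
  using bihom_wirtinger_aux by fastforce+

text \<open>Euler's relation, separately in \<open>u\<close> and in \<open>cnj u\<close>.\<close>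

lemma bihom_euler: "bihom p q P \<Longrightarrow> wirtinger u P u = of_nat p * P u \<and> wirtinger_cnj u P u = of_nat q * P u"
  by (induction rule: bihom.induct)
     (simp_all add: wirtinger_const wirtinger_coord wirtinger_add wirtinger_mult bihom_polyfun algebra_simps)

lemma bihom_0_0: "bihom p q P \<Longrightarrow> p = 0 \<Longrightarrow> q = 0 \<Longrightarrow> P u = P v"
proof (induction arbitrary: u v rule: bihom.induct)
  case (add p q F G) then show ?case by metis
next
  case (mult p q F p' q' G) then show ?case by (metis add_is_0)
qed auto

lemma bihom_homogeneous: "bihom p q P \<Longrightarrow> P (t *\<^sub>R u) = of_real (t ^ (p + q)) * P u"
  by (induction rule: bihom.induct) (simp_all add: scaleR_conv_of_real[where 'a = complex] algebra_simps power_add)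

lemma bihom_power: "bihom p q F \<Longrightarrow> bihom (k * p) (k * q) (\<lambda>u. F u ^ k)"
proof (induction k)
  case 0 then show ?case by (simp add: bihom.const)
next
  case (Suc k)
  then show ?case using bihom.mult[of p q F "k * p" "k * q"] by simp
qed

lemma bihom_sum: "(\<And>i. i \<in> A \<Longrightarrow> bihom p q (F i)) \<Longrightarrow> bihom p q (\<lambda>u. \<Sum>i\<in>A. F i u)"
  by (induction A rule: infinite_finite_induct) (auto intro: bihom.zero bihom.add)

lemma bihom_prod:
  "finite A \<Longrightarrow> (\<And>i. i \<in> A \<Longrightarrow> bihom (f i) (g i) (F i)) \<Longrightarrow> bihom (sum f A) (sum g A) (\<lambda>u. \<Prod>i\<in>A. F i u)"
  by (induction A rule: finite_induct) (auto intro: bihom.const bihom.mult)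

lemma bihom_hermitian_dot:
  "bihom 1 0 (\<lambda>u::complex^'n. hermitian_dot u z)" "bihom 0 1 (\<lambda>u::complex^'n. hermitian_dot z u)"
  unfolding hermitian_dot_def
  by (auto intro!: bihom_sum bihom_mult_eq[OF bihom.coord bihom.const] bihom_mult_eq[OF bihom.const bihom.cnj_coord])

lemma bihom_bihom_poly: "bihom p q (bihom_poly p q c :: complex ^ 'n \<Rightarrow> complex)"
proof -
  have pow: "bihom k 0 (\<lambda>z::complex^'n. (z $ j) ^ k)" "bihom 0 k (\<lambda>z::complex^'n. cnj (z $ j) ^ k)" for k j
    using bihom_power[OF bihom.coord[of j], of k] bihom_power[OF bihom.cnj_coord[of j], of k] by simp_all
  have "bihom p q (\<lambda>z. c \<alpha> \<beta> * (\<Prod>j\<in>UNIV. (z $ j) ^ \<alpha> j) * (\<Prod>j\<in>UNIV. cnj (z $ j) ^ \<beta> j))"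
    if "\<alpha> \<in> multi_indices p" "\<beta> \<in> multi_indices q" for \<alpha> \<beta>
  proof (intro bihom_mult_eq)
    show "bihom (\<Sum>j\<in>UNIV. \<alpha> j) (\<Sum>j\<in>(UNIV :: 'n set). 0) (\<lambda>z. \<Prod>j\<in>UNIV. (z $ j) ^ \<alpha> j)"
      by (rule bihom_prod) (simp_all add: pow)
    show "bihom (\<Sum>j\<in>(UNIV :: 'n set). 0) (\<Sum>j\<in>UNIV. \<beta> j) (\<lambda>z. \<Prod>j\<in>UNIV. cnj (z $ j) ^ \<beta> j)"
      by (rule bihom_prod) (simp_all add: pow)
  qed (use that in \<open>auto simp: multi_indices_def intro: bihom.const\<close>)
  then show ?thesis
    unfolding bihom_poly_def[abs_def] by (intro bihom_sum) auto
qed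

section \<open>Gaussian integrals of harmonic polynomials against zonal monomials\<close>

text \<open>By Euler's relation \<open>(p + q) P\<close> is the radial derivative \<open>\<Sum>\<^sub>b (u \<bullet> b) D\<^sub>b P\<close>, and integration by parts
  turns the factors \<open>u \<bullet> b\<close> into derivatives, which add up to the Laplacian.\<close>

lemma gauss_integral_harmonic:
  assumes P: "bihom p q P" and harm: "\<And>x. laplacian P x = 0" and "p + q > 0"
  shows "gauss_integral P = 0"
proof -
  note pP = bihom_polyfun[OF P]
  have "of_nat (p + q) * P u = (\<Sum>b\<in>Basis. of_real (u \<bullet> b) * dir_deriv b P u)" for u
  proof -
    have "of_nat (p + q) * P u = wirtinger u P u + wirtinger_cnj u P u"
      using bihom_euler[OF P, of u] by (simp add: ring_distribs)
    also have "\<dots> = dir_deriv u P u" by (simp add: wirtinger_defs)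
    also note dir_deriv_expand[OF pP]
    finally show ?thesis .
  qed
  then have "of_nat (p + q) * gauss_integral P = gauss_integral (\<lambda>u. \<Sum>b\<in>Basis. of_real (u \<bullet> b) * dir_deriv b P u)"
    by (simp only: gauss_integral_cmult[symmetric])
  also have "\<dots> = (\<Sum>b\<in>Basis. gauss_integral (\<lambda>u. of_real (u \<bullet> b) * dir_deriv b P u))"
    using gauss_integral_sum[of Basis "\<lambda>b u. of_real (u \<bullet> b) * dir_deriv b P u"]
    by (simp add: polyfun.mult polyfun_inner polyfun_dir_deriv pP)
  also have "\<dots> = (\<Sum>b\<in>Basis. 1/2 * gauss_integral (dir_deriv b (dir_deriv b P)))"
    by (simp add: gauss_integral_by_parts polyfun_dir_deriv pP mult.assoc gauss_integral_cmult)
  also have "\<dots> = 1/2 * gauss_integral (laplacian P)"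
    unfolding laplacian_def[abs_def]
    using gauss_integral_sum[of Basis "\<lambda>b. dir_deriv b (dir_deriv b P)"]
    by (simp add: polyfun_dir_deriv pP sum_divide_distrib)
  also have "laplacian P = (\<lambda>_. 0)" using harm by auto
  finally have "of_nat (p + q) * gauss_integral P = 0" by (simp add: gauss_integral_def)
  moreover have "of_nat (p + q) \<noteq> (0 :: complex)"
    using assms(3) by (simp only: of_nat_eq_0_iff)
  ultimately show ?thesis by (simp only: mult_eq_0_iff simp_thms)
qed

text \<open>The factors \<open>hermitian_dot u z\<close> are removed one at a time by integration by parts. Being holomorphic
  in \<open>u\<close>, they are not hit by \<open>wirtinger_cnj z\<close>, so each step only differentiates \<open>P\<close>.\<close>

lemma gauss_integral_harmonic_hol:
  fixes P :: "complex ^ 'n::finite \<Rightarrow> complex"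
  assumes "bihom p q P" "\<And>x. laplacian P x = 0"
  shows "gauss_integral (\<lambda>u. P u * hermitian_dot u z ^ j)
    = (if p = 0 \<and> j = q then gauss_integral (\<lambda>_::complex^'n. 1) * fact j * P z else 0)"
  using assms
proof (induction j arbitrary: q P)
  case 0
  show ?case
  proof (cases "p = 0 \<and> q = 0")
    case True
    then have P: "P = (\<lambda>u. P z * 1)" using bihom_0_0[OF 0(1)] by auto
    have "gauss_integral P = gauss_integral (\<lambda>u::complex^'n. P z * 1)"
      by (rule arg_cong[where f = gauss_integral, OF P])
    also have "\<dots> = P z * gauss_integral (\<lambda>_::complex^'n. 1)"
      by (rule gauss_integral_cmult)
    finally show ?thesis using True by (simp add: mult.commute)
  next
    case False
    then show ?thesis using gauss_integral_harmonic[OF 0] by auto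
  qed
next
  case (Suc j)
  note pP = bihom_polyfun[OF Suc.prems(1)] and pH = polyfun_hermitian_dot[of z]
  have "gauss_integral (\<lambda>u. P u * hermitian_dot u z ^ Suc j)
      = gauss_integral (\<lambda>u. hermitian_dot u z * (P u * hermitian_dot u z ^ j))"
    by (simp add: mult_ac)
  also have "\<dots> = gauss_integral (wirtinger_cnj z (\<lambda>u. P u * hermitian_dot u z ^ j))"
    by (rule gauss_integral_wirtinger(2)[symmetric]) (intro polyfun.mult pP polyfun_power pH)
  also have "wirtinger_cnj z (\<lambda>u. P u * hermitian_dot u z ^ j) = (\<lambda>u. wirtinger_cnj z P u * hermitian_dot u z ^ j)"
    by (subst wirtinger_mult(2)[OF pP polyfun_power[OF pH(1)]]) (simp add: wirtinger_power pH wirtinger_hermitian_dot)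
  finally have eq: "gauss_integral (\<lambda>u. P u * hermitian_dot u z ^ Suc j)
      = gauss_integral (\<lambda>u. wirtinger_cnj z P u * hermitian_dot u z ^ j)" .
  show ?case
  proof (cases q)
    case 0
    then show ?thesis
      using eq wirtinger_cnj_eq_0[of p P z] Suc.prems(1) by (simp add: gauss_integral_def)
  next
    case (Suc q')
    have "gauss_integral (\<lambda>u. wirtinger_cnj z P u * hermitian_dot u z ^ j)
      = (if p = 0 \<and> j = q' then gauss_integral (\<lambda>_::complex^'n. 1) * fact j * wirtinger_cnj z P z else 0)"
      using Suc.IH[of q' "wirtinger_cnj z P"] bihom_wirtinger_cnj[of p q' P z] Suc.prems laplacian_wirtinger(2)[OF pP] Suc by blast
    then show ?thesis
      using eq bihom_euler[OF Suc.prems(1), of z] Suc by (simp add: algebra_simps)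
  qed
qed

text \<open>The condition says \<open>i = p + m\<close> and \<open>j = q + m\<close> with \<open>m = i - p \<ge> 0\<close>. Removing one factor
  \<open>hermitian_dot z u\<close> by integration by parts either differentiates \<open>P\<close>, which lowers \<open>p\<close>, or one of
  the factors \<open>hermitian_dot u z\<close>, which contributes \<open>\<bar>z\<bar>\<^sup>2\<close> and lowers \<open>m\<close>. The two contributions are
  \<open>p\<close> and \<open>m\<close> times the same quantity, and \<open>p + m = i\<close>.\<close>

lemma gauss_integral_harmonic_zonal:
  fixes P :: "complex ^ 'n::finite \<Rightarrow> complex"
  assumes "bihom p q P" "\<And>x. laplacian P x = 0"
  shows "gauss_integral (\<lambda>u. P u * hermitian_dot z u ^ i * hermitian_dot u z ^ j)
    = (if p \<le> i \<and> j + p = q + i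
       then gauss_integral (\<lambda>_::complex^'n. 1) * fact i * fact j / fact (i - p) * of_real (norm z) ^ (2 * (i - p)) * P z
       else 0)"
  using assms
proof (induction i arbitrary: p q P j)
  case 0
  then show ?case using gauss_integral_harmonic_hol[OF 0, of z j] by auto
next
  case (Suc i)
  note pP = bihom_polyfun[OF Suc.prems(1)] and pH = polyfun_hermitian_dot[of z]
  let ?I = "\<lambda>P i j. gauss_integral (\<lambda>u. P u * hermitian_dot z u ^ i * hermitian_dot u z ^ j)"
  let ?G1 = "gauss_integral (\<lambda>_::complex^'n. 1)"
  have "?I P (Suc i) j = gauss_integral (\<lambda>u. hermitian_dot z u * (P u * hermitian_dot z u ^ i * hermitian_dot u z ^ j))"
    by (simp add: mult_ac)
  also have "\<dots> = gauss_integral (wirtinger z (\<lambda>u. P u * hermitian_dot z u ^ i * hermitian_dot u z ^ j))"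
    by (rule gauss_integral_wirtinger(1)[symmetric]) (intro polyfun.mult pP polyfun_power pH)
  also have "wirtinger z (\<lambda>u. P u * hermitian_dot z u ^ i * hermitian_dot u z ^ j)
     = (\<lambda>u. wirtinger z P u * hermitian_dot z u ^ i * hermitian_dot u z ^ j +
         of_nat j * of_real ((norm z)\<^sup>2) * (P u * hermitian_dot z u ^ i * hermitian_dot u z ^ (j - 1)))"
    by (subst wirtinger_mult(1)[OF polyfun.mult[OF pP polyfun_power[OF pH(2)]] polyfun_power[OF pH(1)]],
        subst wirtinger_mult(1)[OF pP polyfun_power[OF pH(2)]])
       (simp add: wirtinger_power pH wirtinger_hermitian_dot hermitian_dot_self fun_eq_iff mult_ac)
  also have "gauss_integral \<dots> = ?I (wirtinger z P) i j + of_nat j * of_real ((norm z)\<^sup>2) * ?I P i (j - 1)"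
    by (subst gauss_integral_add, (intro polyfun.mult polyfun.const polyfun_wirtinger pP polyfun_power pH)+)
       (simp only: gauss_integral_cmult)
  finally have rec: "?I P (Suc i) j = ?I (wirtinger z P) i j + of_nat j * of_real ((norm z)\<^sup>2) * ?I P i (j - 1)" .
  have first: "?I (wirtinger z P) i j = (if p \<le> Suc i \<and> j + p = q + Suc i
      then ?G1 * fact i * fact j / fact (Suc i - p) * of_real (norm z) ^ (2 * (Suc i - p)) * (of_nat p * P z) else 0)"
  proof (cases p)
    case 0
    then show ?thesis using wirtinger_eq_0[of q P z] Suc.prems(1) by (simp add: gauss_integral_def)
  next
    case (Suc p')
    then have "?I (wirtinger z P) i j = (if p' \<le> i \<and> j + p' = q + i
      then ?G1 * fact i * fact j / fact (i - p') * of_real (norm z) ^ (2 * (i - p')) * wirtinger z P z else 0)"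
      using Suc.IH[of p' q "wirtinger z P" j] bihom_wirtinger[of p' q P z] Suc.prems laplacian_wirtinger(1)[OF pP] by blast
    then show ?thesis using bihom_euler[OF Suc.prems(1), of z] Suc by simp
  qed
  have second: "of_nat j * of_real ((norm z)\<^sup>2) * ?I P i (j - 1) = (if p \<le> i \<and> j + p = q + Suc i
      then ?G1 * fact i * fact j / fact (i - p) * of_real (norm z) ^ (2 * Suc (i - p)) * P z else 0)"
  proof (cases j)
    case 0 then show ?thesis by auto
  next
    case (Suc j')
    show ?thesis
      using Suc.IH[of p q P j'] Suc.prems Suc by (simp add: power2_eq_square mult_ac del: of_nat_Suc)
  qed
  show ?case
  proof (cases "p \<le> i \<and> j + p = q + Suc i")
    case True
    define m where "m = i - p"
    have i: "i = p + m" using True by (simp add: m_def)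
    have f: "(fact (Suc m) :: complex) = of_nat (Suc m) * fact m" by simp
    have "?I P (Suc i) j = ?G1 * fact i * fact j / fact (Suc m) * of_real (norm z) ^ (2 * Suc m) * (of_nat p * P z)
        + ?G1 * fact i * fact j / fact m * of_real (norm z) ^ (2 * Suc m) * P z"
      using True rec first second i by (simp add: Suc_diff_le)
    also have "?G1 * fact i * fact j / fact m * of_real (norm z) ^ (2 * Suc m) * P z
       = ?G1 * fact i * fact j / fact (Suc m) * of_real (norm z) ^ (2 * Suc m) * (of_nat (Suc m) * P z)"
      unfolding f using of_nat_neq_0[where 'a=complex, of m] by (simp add: divide_simps del: of_nat_Suc)
    also have "?G1 * fact i * fact j / fact (Suc m) * of_real (norm z) ^ (2 * Suc m) * (of_nat p * P z) + \<dots>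
       = ?G1 * (of_nat (p + Suc m) * fact i) * fact j / fact (Suc m) * of_real (norm z) ^ (2 * Suc m) * P z"
      by (simp add: add_divide_distrib ring_distribs mult_ac)
    also have "of_nat (p + Suc m) * fact i = (fact (Suc i) :: complex)" by (simp add: i)
    finally show ?thesis using True i by (simp add: Suc_diff_le)
  next
    case False
    then show ?thesis
    proof (cases "p = Suc i \<and> j + p = q + Suc i")
      case True
      then show ?thesis using rec first second by (simp add: algebra_simps)
    next
      case neither: False
      then have "\<not> (p \<le> Suc i \<and> j + p = q + Suc i)" using False by auto
      then show ?thesis using False rec first second by auto
    qed
  qed
qed

section \<open>The kernel of the twisted convolution\<close>

lemma norm_laguerre_le:
  fixes x :: "'a::{banach,real_normed_field}"
  shows "norm (laguerre \<alpha> k x) \<le> 2 ^ (\<alpha> + k) * (\<Sum>i\<le>k. norm x ^ i / fact i)"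
  unfolding laguerre_def sum_distrib_left
proof (intro sum_norm_le)
  fix i
  have "real ((\<alpha> + k) choose (\<alpha> + i)) \<le> real (2 ^ (\<alpha> + k))"
    by (intro of_nat_mono binomial_le_pow2)
  then have "real ((\<alpha> + k) choose (\<alpha> + i)) * (norm x ^ i / fact i) \<le> 2 ^ (\<alpha> + k) * (norm x ^ i / fact i)"
    by (intro mult_right_mono) auto
  then show "norm ((- 1) ^ i * of_nat ((\<alpha> + k) choose (\<alpha> + i)) * (x ^ i / fact i)) \<le> 2 ^ (\<alpha> + k) * (norm x ^ i / fact i)"
    by (simp add: norm_mult norm_power norm_divide)
qed

text \<open>The majorant for the interchange of the series with the integral: it is uniform in \<open>N\<close>, and the
  doubled exponent pays for the growth \<open>2^j\<close> of the binomial coefficients.\<close>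

lemma norm_laguerre_exp_partial_sum_le:
  fixes w x :: "'a::{banach,real_normed_field}"
  shows "norm (\<Sum>j<N. w ^ j / fact j * laguerre (\<alpha> + j) k x)
    \<le> 2 ^ (\<alpha> + k) * (\<Sum>i\<le>k. norm x ^ i / fact i) * exp (2 * norm w)"
proof -
  let ?Q = "2 ^ (\<alpha> + k) * (\<Sum>i\<le>k. norm x ^ i / fact i)"
  have Q: "0 \<le> ?Q" by (intro mult_nonneg_nonneg sum_nonneg) auto
  have "norm (\<Sum>j<N. w ^ j / fact j * laguerre (\<alpha> + j) k x) \<le> (\<Sum>j<N. ?Q * ((2 * norm w) ^ j / fact j))"
  proof (intro sum_norm_le)
    fix j
    have "norm w ^ j / fact j * norm (laguerre (\<alpha> + j) k x) \<le> norm w ^ j / fact j * (2 ^ (\<alpha> + j + k) * (\<Sum>i\<le>k. norm x ^ i / fact i))"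
      by (intro mult_left_mono norm_laguerre_le) auto
    then show "norm (w ^ j / fact j * laguerre (\<alpha> + j) k x) \<le> ?Q * ((2 * norm w) ^ j / fact j)"
      by (simp add: norm_mult norm_power norm_divide power_add power_mult_distrib mult_ac)
  qed
  also have "\<dots> = ?Q * (\<Sum>j<N. (2 * norm w) ^ j / fact j)" by (simp add: sum_distrib_left)
  also have "(\<Sum>j<N. (2 * norm w) ^ j / fact j) \<le> exp (2 * norm w)"
  proof -
    have s: "(\<lambda>j. (2 * norm w) ^ j / fact j) sums exp (2 * norm w)"
      using exp_converges[of "2 * norm w"] by (simp add: divide_inverse mult.commute)
    show ?thesis
      using sum_le_suminf[OF sums_summable[OF s], of "{..<N}"] sums_unique[OF s] by auto
  qed
  finally show ?thesis using Q by (simp add: mult_left_mono)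
qed

lemma exp_growth_of_real_norm: "exp_growth F \<Longrightarrow> exp_growth (\<lambda>u. of_real (norm (F u)))"
  by (erule exp_growth_mono) simp

lemma exp_growth_exp_norm_linear:
  fixes L :: "'a::euclidean_space \<Rightarrow> complex"
  assumes "bounded_linear L" "0 \<le> c"
  shows "exp_growth (\<lambda>u. of_real (exp (c * norm (L u))))"
proof -
  obtain K where K: "0 < K" "\<And>u. norm (L u) \<le> norm u * K"
    using bounded_linear.pos_bounded[OF assms(1)] by blast
  show ?thesis
    by (rule exp_growthI[of _ 1 "c * K"])
       (use K assms mult_left_mono[OF K(2), of c] in \<open>auto simp: mult_ac\<close>)
qed

lemma exp_growth_exp_linear:
  fixes L :: "'a::euclidean_space \<Rightarrow> complex"
  assumes "bounded_linear L"
  shows "exp_growth (\<lambda>u. exp (L u))"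
  by (rule exp_growth_mono[OF exp_growth_exp_norm_linear[OF assms, of 1]]) (auto simp: norm_exp complex_Re_le_cmod)

lemma exp_growth_norm_power: "exp_growth (\<lambda>u. of_real (norm u ^ e))"
  using exp_growth_power[OF exp_growth_norm, of e] by simp

lemma laguerre_continuous: "continuous_on S f \<Longrightarrow> continuous_on S (\<lambda>u. laguerre \<alpha> k (f u))"
  unfolding laguerre_def by (intro continuous_intros) auto

lemma exp_growth_laguerre: "exp_growth f \<Longrightarrow> exp_growth (\<lambda>u. laguerre \<alpha> k (f u))"
  unfolding laguerre_def divide_inverse by (intro exp_growth_sum exp_growth_mult exp_growth_const exp_growth_power)

text \<open>The quantity \<open>\<bar>z - u\<bar>\<^sup>2/2\<close> without its summand \<open>- hermitian_dot u z / 2\<close>, which will be expanded in a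
  power series together with the exponential.\<close>

definition zonal_argument :: "complex ^ 'n \<Rightarrow> complex ^ 'n \<Rightarrow> complex" where
  "zonal_argument z u = of_real ((norm z)\<^sup>2 / 2) + of_real ((norm u)\<^sup>2 / 2) + - hermitian_dot z u / 2"

lemma zonal_argument_continuous: "continuous_on S (zonal_argument z)"
  unfolding zonal_argument_def[abs_def]
  by (intro continuous_intros linear_continuous_on bounded_linear_hermitian_dot) auto

lemma zonal_argument_exp_growth: "exp_growth (zonal_argument z)"
proof -
  have "exp_growth (\<lambda>u. of_real ((norm z)\<^sup>2 / 2) + (1/2) * of_real (norm u ^ 2) + (- 1 / 2) * hermitian_dot z u)"
    by (intro exp_growth_add exp_growth_mult exp_growth_const exp_growth_norm_power exp_growth_linear bounded_linear_hermitian_dot)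
  then show ?thesis by (simp add: zonal_argument_def[abs_def])
qed

definition twisted_kernel :: "nat \<Rightarrow> complex ^ 'n \<Rightarrow> complex ^ 'n \<Rightarrow> complex" where
  "twisted_kernel k z u = laguerre (CARD('n) - 1) k (zonal_argument z u - hermitian_dot u z / 2) * exp (hermitian_dot u z / 2)"

lemma bounded_linear_half_dot: "bounded_linear (\<lambda>u::complex ^ 'n. hermitian_dot u z / 2)"
  by (intro bounded_linear_divide bounded_linear_compose[OF bounded_linear_divide] bounded_linear_hermitian_dot)

lemma twisted_kernel_exp_growth: "exp_growth (twisted_kernel k z)"
proof -
  have "exp_growth (\<lambda>u. zonal_argument z u + (- 1) * (hermitian_dot u z / 2))"
    by (intro exp_growth_add exp_growth_mult exp_growth_const zonal_argument_exp_growth exp_growth_linear bounded_linear_half_dot)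
  then have "exp_growth (\<lambda>u. zonal_argument z u - hermitian_dot u z / 2)" by simp
  then show ?thesis
    unfolding twisted_kernel_def[abs_def]
    by (intro exp_growth_mult exp_growth_laguerre exp_growth_exp_linear bounded_linear_half_dot)
qed

lemma twisted_kernel_continuous: "continuous_on S (twisted_kernel k z)"
  unfolding twisted_kernel_def[abs_def]
  by (intro continuous_intros laguerre_continuous zonal_argument_continuous linear_continuous_on bounded_linear_hermitian_dot) auto

text \<open>Expanding \<open>\<bar>z - u\<bar>\<^sup>2\<close> makes the Gaussian factor contribute \<open>Re (hermitian_dot u z) / 2\<close> to the
  exponent, and the oscillating factor contributes \<open>\<i> Im (hermitian_dot u z) / 2\<close>. Together they are
  holomorphic in \<open>u\<close>, which is the source of the asymmetry between \<open>p\<close> and \<open>q\<close>.\<close>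

lemma twisted_phase_eq_kernel:
  fixes z u :: "complex ^ 'n"
  shows "of_real (laguerre_fun (CARD('n) - 1) k (norm (z - u))) * exp (\<i> / 2 * of_real (Im (hermitian_dot z (z - u))))
    = of_real (exp (- (norm z)\<^sup>2 / 4)) * (twisted_kernel k z u * of_real (exp (- (norm u)\<^sup>2 / 4)))"
proof -
  have "(norm (z - u))\<^sup>2 = (norm z)\<^sup>2 + (norm u)\<^sup>2 - 2 * Re (hermitian_dot u z)"
    by (simp add: Re_hermitian_dot power2_norm_eq_inner inner_diff inner_commute)
  note N = this
  have "hermitian_dot z u = cnj (hermitian_dot u z)" by (simp add: cnj_hermitian_dot)
  note D = this
  have "hermitian_dot z (z - u) = hermitian_dot z z - hermitian_dot z u"
    by (simp add: hermitian_dot_def algebra_simps sum_subtractf)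
  then have I: "Im (hermitian_dot z (z - u)) = Im (hermitian_dot u z)"
    by (simp add: hermitian_dot_self D)
  have X: "complex_of_real ((norm (z - u))\<^sup>2 / 2) = zonal_argument z u - hermitian_dot u z / 2"
    unfolding zonal_argument_def N D by (simp add: complex_eq_iff)
  have "complex_of_real (exp (- (norm (z - u))\<^sup>2 / 4)) * exp (\<i> / 2 * of_real (Im (hermitian_dot z (z - u))))
     = of_real (exp (- (norm z)\<^sup>2 / 4)) * (exp (hermitian_dot u z / 2) * of_real (exp (- (norm u)\<^sup>2 / 4)))"
    unfolding exp_of_real[symmetric] exp_add[symmetric] N I
    by (rule arg_cong[of _ _ exp]) (simp add: complex_eq_iff field_simps)
  note E = this
  have "of_real (laguerre_fun (CARD('n) - 1) k (norm (z - u))) * exp (\<i> / 2 * of_real (Im (hermitian_dot z (z - u))))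
    = laguerre (CARD('n) - 1) k (zonal_argument z u - hermitian_dot u z / 2) *
      (complex_of_real (exp (- (norm (z - u))\<^sup>2 / 4)) * exp (\<i> / 2 * of_real (Im (hermitian_dot z (z - u)))))"
    unfolding laguerre_fun_def of_real_mult of_real_laguerre_poly X by (rule mult.assoc)
  also note E
  finally show ?thesis
    unfolding twisted_kernel_def by (simp only: mult_ac)
qed

section \<open>Integrating the kernel against a harmonic polynomial with a radial factor\<close>

text \<open>The radial factor enters only through the integrability of its product with \<open>P\<close> against functions
  of Gaussian decay. The number \<open>\<alpha>\<close> is \<open>\<gamma> - 1\<close>, the upper index of the resulting Laguerre function.\<close>

context
  fixes P :: "complex ^ 'n::finite \<Rightarrow> complex" and p q \<alpha> :: nat and b :: "real \<Rightarrow> complex" and u0 :: "complex ^ 'n"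
  assumes bihom: "bihom p q P" and harm: "\<And>x. laplacian P x = 0" and nz: "P u0 \<noteq> 0"
    and \<alpha>: "\<alpha> + 1 = CARD('n) + p + q"
    and b [measurable]: "b \<in> borel_measurable borel"
    and ker: "\<forall>G. exp_growth G \<longrightarrow> G \<in> borel_measurable borel \<longrightarrow>
      integrable lborel (\<lambda>u. b (norm u) * P u * (G u * of_real (exp (- (norm u)\<^sup>2 / 4))))"
begin

text \<open>The weight \<open>\<bar>u\<bar>^e\<close> is absorbed into the radial factor, and the homogeneous factor \<open>\<bar>P\<bar>\<close> is stripped
  off; here \<open>P \<noteq> 0\<close> is essential.\<close>

lemma moments: "set_integrable lborel {0..}
    (\<lambda>t. b t * of_real (exp (- t\<^sup>2 / 4)) * of_real (t ^ (2 * CARD('n) + p + q - 1 + e)))"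
proof -
  note pP = bihom_polyfun[OF bihom]
  have [measurable]: "P \<in> borel_measurable borel" by (rule polyfun_borel[OF pP])
  define B where "B t = b t * of_real (exp (- t\<^sup>2 / 4)) * of_real (t ^ e)" for t
  have [measurable]: "B \<in> borel_measurable borel" unfolding B_def by measurable
  have "integrable lborel (\<lambda>u. b (norm u) * P u * (of_real (norm u ^ e) * of_real (exp (- (norm u)\<^sup>2 / 4))))"
    by (intro ker[rule_format] exp_growth_norm_power) measurable
  then have "integrable lborel (\<lambda>u. of_real (norm (P u)) * B (norm u))"
    by (rule Bochner_Integration.integrable_bound) (auto simp: B_def norm_mult norm_power)
  then have "set_integrable lborel {0..} (\<lambda>t. B t * of_real (t ^ (DIM(complex ^ 'n) + (p + q) - 1)))"
    using nz by (intro set_integrable_radial_profile[where H = "\<lambda>u. norm (P u)"])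
      (auto intro!: continuous_intros polyfun_continuous pP simp: bihom_homogeneous[OF bihom] norm_mult norm_power)
  also have "(\<lambda>t. B t * of_real (t ^ (DIM(complex ^ 'n) + (p + q) - 1)))
      = (\<lambda>t. b t * of_real (exp (- t\<^sup>2 / 4)) * of_real (t ^ (2 * CARD('n) + p + q - 1 + e)))"
  proof -
    have e: "DIM(complex ^ 'n) + (p + q) - 1 = 2 * CARD('n) + p + q - 1" by (simp add: mult.commute)
    show ?thesis unfolding e B_def power_add[of _ _ e] by (simp add: mult_ac)
  qed
  finally show ?thesis .
qed

lemma profile_integrable:
  "set_integrable lborel {0..} (\<lambda>t. b t * of_real (exp (- t\<^sup>2 / 4)) * of_real (t ^ (2 * \<alpha> + 1)) * of_real (t\<^sup>2 / 2) ^ e)"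
proof -
  have e: "2 * \<alpha> + 1 + 2 * e = 2 * CARD('n) + p + q - 1 + (p + q + 2 * e)"
    using \<alpha> zero_less_card_finite[where 'a='n] by simp
  have "set_integrable lborel {0..} (\<lambda>t. of_real (1 / 2 ^ e) * (b t * of_real (exp (- t\<^sup>2 / 4)) * of_real (t ^ (2 * \<alpha> + 1 + 2 * e))))"
    unfolding e by (intro set_integrable_mult_right moments)
  also have "(\<lambda>t. of_real (1 / 2 ^ e) * (b t * of_real (exp (- t\<^sup>2 / 4)) * of_real (t ^ (2 * \<alpha> + 1 + 2 * e))))
     = (\<lambda>t. b t * of_real (exp (- t\<^sup>2 / 4)) * of_real (t ^ (2 * \<alpha> + 1)) * of_real (t\<^sup>2 / 2) ^ e)"
    by (simp add: fun_eq_iff power_add power_mult power_divide)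
  finally show ?thesis .
qed

definition profile_moment :: "nat \<Rightarrow> complex" where
  "profile_moment e = (LINT t:{0..}|lborel. b t * of_real (exp (- t\<^sup>2 / 4)) * of_real (t ^ (2 * \<alpha> + 1)) * of_real (t\<^sup>2 / 2) ^ e)"

text \<open>The spherical constant of \<open>P(u) (hermitian_dot z u)^i (hermitian_dot u z)^j\<close> is the quotient of its
  Gaussian integral by a one-dimensional Gaussian moment. For \<open>i = p + m\<close> and \<open>j = q + m\<close> that moment is
  \<open>(\<alpha> + m)! / 2\<close>; the factorials of \<open>i\<close> and \<open>j\<close> cancel against those of the divided powers, and
  the powers of \<open>\<bar>z\<bar>\<close> and \<open>\<bar>u\<bar>\<close> combine to \<open>x^m y^m\<close>.\<close>

lemma zonal_monomial_integral:
  fixes z :: "complex ^ 'n" and i j l :: nat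
  defines "f \<equiv> \<lambda>u. b (norm u) * P u * of_real (exp (- (norm u)\<^sup>2 / 4)) * (of_real ((norm u)\<^sup>2 / 2) ^ l / fact l)
      * ((- hermitian_dot z u / 2) ^ i / fact i) * ((hermitian_dot u z / 2) ^ j / fact j)"
  shows "integrable lborel f"
    and "integral\<^sup>L lborel f = (if p \<le> i \<and> j + p = q + i then
       (- 1) ^ i * (2 * gauss_integral (\<lambda>_::complex^'n. 1) / 2 ^ (p + q)) * P z *
       (of_real ((norm z)\<^sup>2 / 2) ^ (i - p) / (fact (i - p) * fact (\<alpha> + (i - p)) * fact l)) *
       profile_moment (i - p + l) else 0)"
proof -
  let ?n = "CARD('n)" and ?d = "p + q + i + j"
  let ?G = "\<lambda>u. P u * hermitian_dot z u ^ i * hermitian_dot u z ^ j"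
  let ?k = "(- 1) ^ i / (2 ^ (i + j) * fact i * fact j) :: complex"
  define B where "B t = b t * of_real (exp (- t\<^sup>2 / 4)) * (of_real (t\<^sup>2 / 2) ^ l / fact l)" for t
  have n: "0 < ?n" by simp
  have dim: "DIM(complex ^ 'n) = 2 * ?n" by simp
  have [measurable]: "B \<in> borel_measurable borel" unfolding B_def by measurable
  have neg: "(- w / 2) ^ i = (- 1) ^ i * w ^ i / 2 ^ i" for w :: complex
    by (subst power_divide, subst power_minus) simp
  have f: "f = (\<lambda>u. ?k * (?G u * B (norm u)))"
    unfolding f_def B_def neg by (simp add: fun_eq_iff power_divide power_add field_simps)
  have Gb: "bihom (p + j) (q + i) ?G"
    using bihom.mult[OF bihom.mult[OF bihom bihom_power[OF bihom_hermitian_dot(2)[of z], of i]]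
        bihom_power[OF bihom_hermitian_dot(1)[of z], of j]] by simp
  have cont: "continuous_on UNIV ?G" by (rule polyfun_continuous[OF bihom_polyfun[OF Gb]])
  have hom: "?G (t *\<^sub>R u) = of_real (t ^ ?d) * ?G u" for t u
    using bihom_homogeneous[OF Gb, of t u] by (simp add: add_ac)
  have int1: "set_integrable lborel {0..} (\<lambda>t. B t * of_real (t ^ (DIM(complex ^ 'n) + ?d - 1)))"
  proof -
    have e: "2 * ?n + ?d - 1 + 2 * l = 2 * ?n + p + q - 1 + (i + j + 2 * l)" using n by linarith
    have "set_integrable lborel {0..} (\<lambda>t. of_real (1 / (2 ^ l * fact l)) *
        (b t * of_real (exp (- t\<^sup>2 / 4)) * of_real (t ^ (2 * ?n + ?d - 1 + 2 * l))))"
      unfolding e by (intro set_integrable_mult_right moments)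
    also have "(\<lambda>t. of_real (1 / (2 ^ l * fact l)) * (b t * of_real (exp (- t\<^sup>2 / 4)) * of_real (t ^ (2 * ?n + ?d - 1 + 2 * l))))
      = (\<lambda>t. B t * of_real (t ^ (DIM(complex ^ 'n) + ?d - 1)))"
      unfolding dim B_def by (simp add: fun_eq_iff power_add power_mult power_divide)
    finally show ?thesis .
  qed
  note I = integral_polar[OF cont hom _ int1]
  show "integrable lborel f"
    unfolding f by (intro integrable_mult_right I) auto
  define \<mu> where "\<mu> = (LINT t:{0..}|lborel. complex_of_real (exp (- t\<^sup>2)) * of_real (t ^ (2 * ?n + ?d - 1)))"
  let ?S = "of_nat (DIM(complex ^ 'n) + ?d) * (LINT u:cball 0 1|lborel. ?G u)"
  have \<mu>: "\<mu> \<noteq> 0" unfolding \<mu>_def by (rule gaussian_moment(2))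
  have "gauss_integral ?G = (LINT u|lborel. ?G u * complex_of_real (exp (- (norm u)\<^sup>2)))"
    by (simp add: gauss_integral_def)
  also have "\<dots> = ?S * \<mu>"
    unfolding \<mu>_def using integral_polar(2)[OF cont hom _ gaussian_moment(1)] unfolding dim by simp
  \<comment> \<open>The factor \<open>?S\<close> is independent of the weight, so the Gaussian weight determines it.\<close>
  finally have S: "?S = gauss_integral ?G / \<mu>" using \<mu> by (simp add: field_simps)
  let ?J = "LINT t:{0..}|lborel. B t * of_real (t ^ (2 * ?n + ?d - 1))"
  have "integral\<^sup>L lborel f = ?k * (LINT u|lborel. ?G u * B (norm u))"
    unfolding f by (rule integral_mult_right_zero)
  also have "(LINT u|lborel. ?G u * B (norm u)) = gauss_integral ?G / \<mu> * ?J"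
    unfolding S[symmetric] unfolding dim[symmetric] by (rule I) auto
  finally have eq: "integral\<^sup>L lborel f = ?k * (gauss_integral ?G / \<mu> * ?J)" .
  show "integral\<^sup>L lborel f = (if p \<le> i \<and> j + p = q + i then
       (- 1) ^ i * (2 * gauss_integral (\<lambda>_::complex^'n. 1) / 2 ^ (p + q)) * P z *
       (of_real ((norm z)\<^sup>2 / 2) ^ (i - p) / (fact (i - p) * fact (\<alpha> + (i - p)) * fact l)) *
       profile_moment (i - p + l) else 0)"
  proof (cases "p \<le> i \<and> j + p = q + i")
    case False
    then show ?thesis using eq gauss_integral_harmonic_zonal[OF bihom harm, of z i j] by auto
  next
    case True
    define m where "m = i - p"
    have i: "i = p + m" and j: "j = q + m" using True by (auto simp: m_def)
    have e: "2 * ?n + ?d - 1 = 2 * (\<alpha> + m) + 1" using \<alpha> n by (simp add: i j)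
    have G: "gauss_integral ?G = gauss_integral (\<lambda>_::complex^'n. 1) * fact i * fact j / fact m * of_real (norm z) ^ (2 * m) * P z"
      using gauss_integral_harmonic_zonal[OF bihom harm, of z i j] True by (simp add: m_def)
    have \<mu>': "\<mu> = fact (\<alpha> + m) / 2"
      unfolding \<mu>_def e by (rule gaussian_moment(3))
    have "?J = (LINT t:{0..}|lborel. 2 ^ m / fact l *
       (b t * of_real (exp (- t\<^sup>2 / 4)) * of_real (t ^ (2 * \<alpha> + 1)) * of_real (t\<^sup>2 / 2) ^ (m + l)))"
      unfolding e B_def
    proof (intro set_lebesgue_integral_cong allI impI)
      fix t :: real
      have "complex_of_real (t ^ (2 * (\<alpha> + m) + 1)) = of_real (t ^ (2 * \<alpha> + 1)) * (2 ^ m * of_real (t\<^sup>2 / 2) ^ m)"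
        by (simp add: distrib_left power_add power_mult power_divide)
      then show "b t * of_real (exp (- t\<^sup>2 / 4)) * (of_real (t\<^sup>2 / 2) ^ l / fact l) * complex_of_real (t ^ (2 * (\<alpha> + m) + 1))
        = 2 ^ m / fact l * (b t * of_real (exp (- t\<^sup>2 / 4)) * of_real (t ^ (2 * \<alpha> + 1)) * of_real (t\<^sup>2 / 2) ^ (m + l))"
        by (simp only: power_add) simp
    qed auto
    also have "\<dots> = 2 ^ m / fact l * profile_moment (m + l)"
      unfolding profile_moment_def by (rule set_integral_mult_right)
    finally have J: "?J = 2 ^ m / fact l * profile_moment (m + l)" .
    have z: "of_real (norm z) ^ (2 * m) = 2 ^ m * (of_real ((norm z)\<^sup>2 / 2) ^ m :: complex)"
      by (simp add: power_mult power_divide)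
    have tw: "(2::complex) ^ (i + j) = 2 ^ (p + q) * (2 ^ m * 2 ^ m)"
      by (simp add: i j power_add)
    have alg: "(s / (w * (t * t) * fi * fj)) * (g * fi * fj / fm * (t * x) * Pz / (fa / 2) * (t / fl * pm))
      = s * (2 * g / w) * Pz * (x / (fm * fa * fl)) * pm"
      if "w \<noteq> 0" "t \<noteq> 0" "fi \<noteq> 0" "fj \<noteq> 0" "fm \<noteq> 0" "fa \<noteq> 0" "fl \<noteq> 0"
      for s w t fi fj g fm x Pz fa fl pm :: complex
      using that by (simp add: field_simps)
    show ?thesis
      using True unfolding eq G \<mu>' J z tw m_def[symmetric]
      by (subst alg) auto
  qed
qed

lemma profile_moment_sum:
  "finite I \<Longrightarrow> (\<Sum>i\<in>I. c i * profile_moment (e i)) =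
    (LINT t:{0..}|lborel. b t * of_real (exp (- t\<^sup>2 / 4)) * of_real (t ^ (2 * \<alpha> + 1)) * (\<Sum>i\<in>I. c i * of_real (t\<^sup>2 / 2) ^ e i))"
  (is "_ \<Longrightarrow> ?l = (LINT t:_|_. ?w t * _)")
proof -
  assume "finite I"
  have I: "integrable lborel (\<lambda>t. c i * (indicator {0..} t *\<^sub>R (?w t * of_real (t\<^sup>2 / 2) ^ e i)))" for i
    using profile_integrable[of "e i"] unfolding set_integrable_def by (rule integrable_mult_right)
  have "?l = (\<Sum>i\<in>I. (LINT t|lborel. c i * (indicator {0..} t *\<^sub>R (?w t * of_real (t\<^sup>2 / 2) ^ e i))))"
    unfolding profile_moment_def set_lebesgue_integral_def by (simp only: integral_mult_right_zero)
  also have "\<dots> = (LINT t|lborel. (\<Sum>i\<in>I. c i * (indicator {0..} t *\<^sub>R (?w t * of_real (t\<^sup>2 / 2) ^ e i))))"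
    using I by (rule Bochner_Integration.integral_sum[symmetric])
  also have "\<dots> = (LINT t:{0..}|lborel. ?w t * (\<Sum>i\<in>I. c i * of_real (t\<^sup>2 / 2) ^ e i))"
    unfolding set_lebesgue_integral_def
    by (intro Bochner_Integration.integral_cong refl) (simp add: sum_distrib_left scaleR_conv_of_real mult_ac)
  finally show ?thesis .
qed

text \<open>For given \<open>j\<close> only the power \<open>i = p + (j - q)\<close> of \<open>hermitian_dot z u\<close> contributes, and it
  occurs in the Laguerre polynomial only if it is at most \<open>k\<close>.\<close>

lemma zonal_laguerre_integral:
  fixes z :: "complex ^ 'n" and j k :: nat
  defines "f \<equiv> \<lambda>u. b (norm u) * P u * of_real (exp (- (norm u)\<^sup>2 / 4)) * ((hermitian_dot u z / 2) ^ j / fact j *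
      laguerre (CARD('n) - 1 + j) k (of_real ((norm z)\<^sup>2 / 2) + of_real ((norm u)\<^sup>2 / 2) + - hermitian_dot z u / 2))"
  shows "integrable lborel f"
    and "integral\<^sup>L lborel f = (if q \<le> j \<and> p + (j - q) \<le> k then
      (2 * gauss_integral (\<lambda>_::complex^'n. 1) / 2 ^ (p + q)) * P z *
      (\<Sum>a\<le>k. \<Sum>l\<le>k. (- 1) ^ (a + l) * of_nat ((\<alpha> + (k - p) + (j - q)) choose (\<alpha> + 2 * (j - q) + a + l))
        * (of_real ((norm z)\<^sup>2 / 2) ^ (j - q + a) / fact a) / fact l / (fact (j - q) * fact (\<alpha> + (j - q)))
        * profile_moment (j - q + l)) else 0)"
proof -
  let ?x = "of_real ((norm z)\<^sup>2 / 2) :: complex"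
  let ?\<beta> = "CARD('n) - 1 + j"
  let ?c = "\<lambda>a l i. (-1) ^ (a + l + i) * of_nat ((?\<beta> + k) choose (?\<beta> + (a + l + i))) * (?x ^ a / fact a)"
  let ?g = "\<lambda>l i u. b (norm u) * P u * of_real (exp (- (norm u)\<^sup>2 / 4)) * (of_real ((norm u)\<^sup>2 / 2) ^ l / fact l)
      * ((- hermitian_dot z u / 2) ^ i / fact i) * ((hermitian_dot u z / 2) ^ j / fact j)"
  have f: "f = (\<lambda>u. \<Sum>a\<le>k. \<Sum>l\<le>k. \<Sum>i\<le>k. ?c a l i * ?g l i u)"
    unfolding f_def laguerre_add3 sum_distrib_left by (simp only: mult_ac)
  have I: "integrable lborel (\<lambda>u. ?c a l i * ?g l i u)" for a l i
    by (intro integrable_mult_right zonal_monomial_integral)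
  show "integrable lborel f"
    unfolding f by (intro Bochner_Integration.integrable_sum I)
  let ?gp = "2 * gauss_integral (\<lambda>_::complex^'n. 1) / 2 ^ (p + q)"
  define h where "h a l i = ?c a l i * ((- 1) ^ i * ?gp * P z *
       (?x ^ (i - p) / (fact (i - p) * fact (\<alpha> + (i - p)) * fact l)) * profile_moment (i - p + l))" for a l i
  have "integral\<^sup>L lborel f = (\<Sum>a\<le>k. \<Sum>l\<le>k. \<Sum>i\<le>k. (LINT u|lborel. ?c a l i * ?g l i u))"
    unfolding f by (simp only: Bochner_Integration.integral_sum Bochner_Integration.integrable_sum I)
  also have "\<dots> = (\<Sum>a\<le>k. \<Sum>l\<le>k. \<Sum>i\<le>k. if p \<le> i \<and> j + p = q + i then h a l i else 0)"
    unfolding h_def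
    by (intro sum.cong refl) (simp only: integral_mult_right_zero zonal_monomial_integral(2) if_distrib[of "(*) _"] mult_zero_right)
  also have "\<dots> = (\<Sum>a\<le>k. \<Sum>l\<le>k. if q \<le> j \<and> p + (j - q) \<le> k then h a l (p + (j - q)) else 0)"
  proof (intro sum.cong refl)
    fix a l
    have "(\<Sum>i\<le>k. if p \<le> i \<and> j + p = q + i then h a l i else 0) =
       (\<Sum>i\<le>k. if i = p + (j - q) then (if q \<le> j then h a l i else 0) else 0)"
      by (intro sum.cong refl) auto
    also have "\<dots> = (if q \<le> j \<and> p + (j - q) \<le> k then h a l (p + (j - q)) else 0)"
      by (simp add: sum.delta)
    finally show "(\<Sum>i\<le>k. if p \<le> i \<and> j + p = q + i then h a l i else 0) = \<dots>" .
  qed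
  also have "\<dots> = (if q \<le> j \<and> p + (j - q) \<le> k then
      ?gp * P z *
      (\<Sum>a\<le>k. \<Sum>l\<le>k. (- 1) ^ (a + l) * of_nat ((\<alpha> + (k - p) + (j - q)) choose (\<alpha> + 2 * (j - q) + a + l))
        * (?x ^ (j - q + a) / fact a) / fact l / (fact (j - q) * fact (\<alpha> + (j - q)))
        * profile_moment (j - q + l)) else 0)"
  proof (cases "q \<le> j \<and> p + (j - q) \<le> k")
    case True
    define m where "m = j - q"
    have j: "j = q + m" and k: "p + m \<le> k" using True by (auto simp: m_def)
    have n: "CARD('n) - 1 + q + p = \<alpha>" using \<alpha> zero_less_card_finite[where 'a='n] by linarith
    have "h a l (p + m) = ?gp * P z * ((- 1) ^ (a + l) * of_nat ((\<alpha> + (k - p) + m) choose (\<alpha> + 2 * m + a + l))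
        * (?x ^ (m + a) / fact a) / fact l / (fact m * fact (\<alpha> + m)) * profile_moment (m + l))" for a l
    proof -
      have 1: "?\<beta> + k = \<alpha> + (k - p) + m" "?\<beta> + (a + l + (p + m)) = \<alpha> + 2 * m + a + l"
        using n k j zero_less_card_finite[where 'a='n] by linarith+
      have 2: "(-1::complex) ^ (a + l + (p + m)) * (-1) ^ (p + m) = (-1) ^ (a + l)"
        by (simp add: power_add mult_ac flip: power_mult_distrib)
      have alg: "(s1 * cc * (xa / fa)) * (s2 * g * Pz * (xm / (fm * fam * fl)) * pm)
         = g * Pz * ((s1 * s2) * cc * ((xm * xa) / fa) / fl / (fm * fam) * pm)"
        for s1 cc xa fa s2 g Pz xm fm fam fl pm :: complex
        by (simp add: mult_ac)
      show ?thesis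
        unfolding h_def 1 add_diff_cancel_left' alg 2 by (simp only: power_add)
    qed
    then show ?thesis using True by (simp only: m_def[symmetric] sum_distrib_left if_True simp_thms)
  next
    case False
    show ?thesis unfolding if_not_P[OF False] by simp
  qed
  finally show "integral\<^sup>L lborel f = \<dots>" .
qed

text \<open>Expanding \<open>L\<^sub>k(X - w) exp w\<close> in powers of \<open>w = hermitian_dot u z / 2\<close> by \<open>laguerre_exp_sums\<close>, with
  dominated convergence for the partial sums.\<close>

lemma twisted_kernel_sums:
  "(\<lambda>j. LINT u|lborel. b (norm u) * P u * of_real (exp (- (norm u)\<^sup>2 / 4)) * ((hermitian_dot u z / 2) ^ j / fact j *
      laguerre (CARD('n) - 1 + j) k (of_real ((norm z)\<^sup>2 / 2) + of_real ((norm u)\<^sup>2 / 2) + - hermitian_dot z u / 2)))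
   sums (LINT u|lborel. b (norm u) * P u * of_real (exp (- (norm u)\<^sup>2 / 4)) * twisted_kernel k z u)"
  (is "(\<lambda>j. LINT u|_. ?F u * ?g j u) sums _")
proof -
  note pP = bihom_polyfun[OF bihom]
  have [measurable]: "P \<in> borel_measurable borel" by (rule polyfun_borel[OF pP])
  have [measurable]: "twisted_kernel k z \<in> borel_measurable borel" "zonal_argument z \<in> borel_measurable borel"
     "(\<lambda>u. hermitian_dot u z) \<in> borel_measurable borel"
    by (intro borel_measurable_continuous_onI twisted_kernel_continuous zonal_argument_continuous
        linear_continuous_on bounded_linear_hermitian_dot)+
  have [measurable]: "laguerre \<beta> k \<in> borel_measurable borel" for \<beta> and k :: nat
    by (intro borel_measurable_continuous_onI laguerre_continuous continuous_on_id)
  note I = zonal_laguerre_integral(1)[of z]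
  define D where "D u = 2 ^ (CARD('n) - 1 + k) * (\<Sum>i\<le>k. norm (zonal_argument z u) ^ i / fact i) * exp (2 * norm (hermitian_dot u z / 2))" for u
  have "exp_growth (\<lambda>u. of_real (2 ^ (CARD('n) - 1 + k)) * (\<Sum>i\<le>k. of_real (norm (zonal_argument z u)) ^ i * (1 / fact i)) * of_real (exp (2 * norm (hermitian_dot u z / 2))))"
    by (intro exp_growth_mult exp_growth_const exp_growth_sum exp_growth_power exp_growth_of_real_norm
        zonal_argument_exp_growth exp_growth_exp_norm_linear bounded_linear_half_dot) simp
  then have "exp_growth (\<lambda>u. of_real (D u))"
    by (simp add: D_def)
  then have "integrable lborel (\<lambda>u. b (norm u) * P u * (of_real (D u) * of_real (exp (- (norm u)\<^sup>2 / 4))))"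
    by (rule ker[rule_format]) (unfold D_def, measurable)
  then have w: "integrable lborel (\<lambda>u. norm (b (norm u) * P u * (of_real (D u) * of_real (exp (- (norm u)\<^sup>2 / 4)))))"
    by (rule integrable_norm)
  have "(\<lambda>N. LINT u|lborel. (\<Sum>j<N. ?F u * ?g j u)) \<longlonglongrightarrow> (LINT u|lborel. ?F u * twisted_kernel k z u)"
  proof (rule integral_dominated_convergence[OF _ _ w])
    show "AE u in lborel. (\<lambda>N. \<Sum>j<N. ?F u * ?g j u) \<longlonglongrightarrow> ?F u * twisted_kernel k z u"
    proof (rule AE_I2)
      fix u
      have "(\<lambda>j. ?F u * ?g j u) sums (?F u * twisted_kernel k z u)"
        unfolding twisted_kernel_def zonal_argument_def by (intro sums_mult laguerre_exp_sums)
      then show "(\<lambda>N. \<Sum>j<N. ?F u * ?g j u) \<longlonglongrightarrow> ?F u * twisted_kernel k z u"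
        by (simp add: sums_def)
    qed
    show "AE u in lborel. norm (\<Sum>j<N. ?F u * ?g j u) \<le> norm (b (norm u) * P u * (of_real (D u) * of_real (exp (- (norm u)\<^sup>2 / 4))))" for N
    proof (rule AE_I2)
      fix u
      have "norm (\<Sum>j<N. ?g j u) \<le> D u"
        unfolding D_def zonal_argument_def by (rule norm_laguerre_exp_partial_sum_le)
      then have "norm (?F u) * norm (\<Sum>j<N. ?g j u) \<le> norm (?F u) * \<bar>D u\<bar>"
        by (intro mult_left_mono) auto
      then show "norm (\<Sum>j<N. ?F u * ?g j u) \<le> norm (b (norm u) * P u * (of_real (D u) * of_real (exp (- (norm u)\<^sup>2 / 4))))"
        unfolding sum_distrib_left[symmetric] norm_mult norm_of_real by (simp add: mult_ac)
    qed
    show "(\<lambda>u. \<Sum>j<N. ?F u * ?g j u) \<in> borel_measurable lborel" for N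
      unfolding zonal_argument_def[symmetric] by measurable
  qed measurable
  then show ?thesis
    unfolding sums_def by (simp only: Bochner_Integration.integral_sum I)
qed

text \<open>Only the indices \<open>j = q + m\<close> with \<open>m \<le> k - p\<close> contribute, so the series is a finite sum. Replacing each
  \<open>profile_moment e\<close> by the power \<open>y^e\<close> under the integral sign turns the sum into the left-hand side of
  \<open>laguerre_product\<close>.\<close>

lemma twisted_kernel_integral:
  assumes "p \<le> k"
  shows "(LINT u|lborel. b (norm u) * P u * of_real (exp (- (norm u)\<^sup>2 / 4)) * twisted_kernel k z u) =
    (2 * gauss_integral (\<lambda>_::complex^'n. 1) / 2 ^ (p + q)) * P z *
    (fact (k - p) / fact (\<alpha> + (k - p)) * laguerre \<alpha> (k - p) (of_real ((norm z)\<^sup>2 / 2))) *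
    (LINT t:{0..}|lborel. b t * of_real (exp (- t\<^sup>2 / 4)) * of_real (t ^ (2 * \<alpha> + 1)) * laguerre \<alpha> (k - p) (of_real (t\<^sup>2 / 2)))"
proof -
  define K where "K = k - p"
  let ?x = "of_real ((norm z)\<^sup>2 / 2) :: complex" and ?gp = "2 * gauss_integral (\<lambda>_::complex^'n. 1) / 2 ^ (p + q)"
  let ?L = "LINT u|lborel. b (norm u) * P u * of_real (exp (- (norm u)\<^sup>2 / 4)) * twisted_kernel k z u"
  let ?M = profile_moment
  define c where "c m a l = (- 1) ^ (a + l) * of_nat ((\<alpha> + K + m) choose (\<alpha> + 2 * m + a + l))
        * (?x ^ (m + a) / fact a) / fact l / (fact m * fact (\<alpha> + m))" for m a l
  define J where "J j = (if q \<le> j \<and> p + (j - q) \<le> k then ?gp * P z *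
      (\<Sum>a\<le>k. \<Sum>l\<le>k. c (j - q) a l * ?M (j - q + l)) else 0)" for j
  have "J sums ?L"
    using twisted_kernel_sums[of z k]
    unfolding zonal_laguerre_integral(2) J_def c_def K_def .
  moreover have "J sums (\<Sum>j\<in>{q..q+K}. J j)"
    using assms by (intro sums_finite) (auto simp: J_def K_def)
  ultimately have "?L = (\<Sum>j\<in>{q..q+K}. J j)" by (rule sums_unique2)
  also have "\<dots> = (\<Sum>m\<le>K. ?gp * P z * (\<Sum>a\<le>k. \<Sum>l\<le>k. c m a l * ?M (m + l)))"
    by (rule sum.reindex_bij_witness[of _ "\<lambda>m. q + m" "\<lambda>j. j - q"]) (use assms in \<open>auto simp: J_def K_def\<close>)
  also have "\<dots> = ?gp * P z * (\<Sum>(m,a,l)\<in>{..K}\<times>{..k}\<times>{..k}. c m a l * ?M (m + l))"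
    by (simp only: sum_distrib_left[symmetric] sum.cartesian_product)
  also have "(\<Sum>(m,a,l)\<in>{..K}\<times>{..k}\<times>{..k}. c m a l * ?M (m + l))
     = (\<Sum>i\<in>{..K}\<times>{..k}\<times>{..k}. (case i of (m,a,l) \<Rightarrow> c m a l) * ?M (case i of (m,a,l) \<Rightarrow> m + l))"
    by (intro sum.cong refl) auto
  also have "\<dots> = (LINT t:{0..}|lborel. b t * of_real (exp (- t\<^sup>2 / 4)) * of_real (t ^ (2 * \<alpha> + 1)) *
      (\<Sum>i\<in>{..K}\<times>{..k}\<times>{..k}. (case i of (m,a,l) \<Rightarrow> c m a l) * of_real (t\<^sup>2 / 2) ^ (case i of (m,a,l) \<Rightarrow> m + l)))"
    by (rule profile_moment_sum) auto
  also have "\<dots> = (LINT t:{0..}|lborel. (fact K / fact (\<alpha> + K) * laguerre \<alpha> K ?x) *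
      (b t * of_real (exp (- t\<^sup>2 / 4)) * of_real (t ^ (2 * \<alpha> + 1)) * laguerre \<alpha> K (of_real (t\<^sup>2 / 2))))"
  proof (intro set_lebesgue_integral_cong allI impI)
    fix t :: real
    let ?y = "of_real (t\<^sup>2 / 2) :: complex"
    have "(\<Sum>i\<in>{..K}\<times>{..k}\<times>{..k}. (case i of (m,a,l) \<Rightarrow> c m a l) * ?y ^ (case i of (m,a,l) \<Rightarrow> m + l))
       = (\<Sum>(m,a,l)\<in>{..K}\<times>{..k}\<times>{..k}. c m a l * ?y ^ (m + l))"
      by (intro sum.cong refl) auto
    also have "\<dots> = (\<Sum>m\<le>K. \<Sum>a\<le>k. \<Sum>l\<le>k. c m a l * ?y ^ (m + l))"
      by (simp add: sum.cartesian_product)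
    also have "\<dots> = fact K / fact (\<alpha> + K) * laguerre \<alpha> K ?x * laguerre \<alpha> K ?y"
      by (subst laguerre_product[of K k, symmetric]) (simp_all add: K_def c_def mult_ac)
    finally show "b t * of_real (exp (- t\<^sup>2 / 4)) * of_real (t ^ (2 * \<alpha> + 1)) *
        (\<Sum>i\<in>{..K}\<times>{..k}\<times>{..k}. (case i of (m,a,l) \<Rightarrow> c m a l) * ?y ^ (case i of (m,a,l) \<Rightarrow> m + l))
      = fact K / fact (\<alpha> + K) * laguerre \<alpha> K ?x *
        (b t * of_real (exp (- t\<^sup>2 / 4)) * of_real (t ^ (2 * \<alpha> + 1)) * laguerre \<alpha> K ?y)"
      by simp
  qed auto
  also have "\<dots> = fact K / fact (\<alpha> + K) * laguerre \<alpha> K ?x *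
      (LINT t:{0..}|lborel. b t * of_real (exp (- t\<^sup>2 / 4)) * of_real (t ^ (2 * \<alpha> + 1)) * laguerre \<alpha> K (of_real (t\<^sup>2 / 2)))"
    by (rule set_integral_mult_right)
  finally show ?thesis by (simp add: K_def mult_ac)
qed

text \<open>The kernel has degree at most \<open>k\<close> in \<open>hermitian_dot z u\<close>, but a power of at least \<open>p\<close> is needed.\<close>

lemma twisted_kernel_integral_eq_0:
  assumes "k < p"
  shows "(LINT u|lborel. b (norm u) * P u * of_real (exp (- (norm u)\<^sup>2 / 4)) * twisted_kernel k z u) = 0"
proof -
  have "(\<lambda>j::nat. 0) sums (LINT u|lborel. b (norm u) * P u * of_real (exp (- (norm u)\<^sup>2 / 4)) * twisted_kernel k z u)"
    using twisted_kernel_sums[of z k]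
    unfolding zonal_laguerre_integral(2) using assms by simp
  then show ?thesis using sums_unique2[OF _ sums_zero] by blast
qed

lemma laguerre_profile_integrable:
  "set_integrable lborel {0..} (\<lambda>t. b t * of_real (exp (- t\<^sup>2 / 4)) * of_real (t ^ (2 * \<alpha> + 1)) * laguerre \<alpha> K (of_real (t\<^sup>2 / 2)))"
proof -
  let ?w = "\<lambda>t. b t * of_real (exp (- t\<^sup>2 / 4)) * of_real (t ^ (2 * \<alpha> + 1))"
  have "integrable lborel (\<lambda>t. \<Sum>i\<le>K. ((- 1) ^ i * of_nat ((\<alpha> + K) choose (\<alpha> + i)) / fact i) *
      (indicator {0..} t *\<^sub>R (?w t * of_real (t\<^sup>2 / 2) ^ i)))"
    using profile_integrable unfolding set_integrable_def
    by (intro Bochner_Integration.integrable_sum integrable_mult_right)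
  also have "(\<lambda>t. \<Sum>i\<le>K. ((- 1) ^ i * of_nat ((\<alpha> + K) choose (\<alpha> + i)) / fact i) *
      (indicator {0..} t *\<^sub>R (?w t * of_real (t\<^sup>2 / 2) ^ i)))
    = (\<lambda>t. indicator {0..} t *\<^sub>R (?w t * laguerre \<alpha> K (of_real (t\<^sup>2 / 2))))"
    by (simp add: fun_eq_iff laguerre_def sum_distrib_left scaleR_conv_of_real mult_ac)
  finally show ?thesis unfolding set_integrable_def .
qed

end

section \<open>The twisted convolution with a Laguerre function\<close>

text \<open>By completeness, \<open>g\<close> is Lebesgue measurable because it agrees almost everywhere with a Borel
  function.\<close>

lemma lebesgue_integral_AE_transfer:
  fixes g h :: "'a::euclidean_space \<Rightarrow> complex"
  assumes AE: "AE x in lborel. g x = h x" and int: "integrable lborel h"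
  shows "integrable lebesgue g" and "integral\<^sup>L lebesgue g = integral\<^sup>L lborel h"
proof -
  have h: "h \<in> borel_measurable lborel" using int by auto
  then have h': "h \<in> borel_measurable lebesgue" by (rule measurable_completion)
  have AE': "AE x in lebesgue. h x = g x"
    using AE by (intro AE_completion) (auto elim: eventually_mono)
  have g: "g \<in> borel_measurable lebesgue"
  proof (rule measurableI)
    fix A :: "complex set" assume A: "A \<in> sets borel"
    have "AE x in lebesgue. x \<in> h -` A \<inter> space lebesgue \<longleftrightarrow> x \<in> g -` A \<inter> space lebesgue"
      using AE' by eventually_elim auto
    then show "g -` A \<inter> space lebesgue \<in> sets lebesgue"
      using measurable_sets[OF h' A] by (rule completion.in_sets_AE) auto
  qed auto
  have "integrable lebesgue h" using int h by (subst integrable_completion) auto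
  then show "integrable lebesgue g"
    using integrable_cong_AE[OF h' g AE'] by simp
  show "integral\<^sup>L lebesgue g = integral\<^sup>L lborel h"
    using integral_cong_AE[OF h' g AE'] integral_completion[OF h] by simp
qed

theorem theorem3p7:
  fixes p q k \<gamma> :: nat
  assumes "\<gamma> = CARD('n::finite) + p + q"
  shows "\<exists>C::complex. \<forall>(r::ennreal) (P :: complex ^ 'n \<Rightarrow> complex) (a :: real \<Rightarrow> complex).
    1 \<le> r \<longrightarrow> P \<in> bigraded_harmonics p q \<longrightarrow> P \<noteq> (\<lambda>z. 0) \<longrightarrow>
    (\<lambda>z. a (norm z) * P z) \<in> Lr_space r \<longrightarrow>
    (let f = (\<lambda>z. a (norm z) * P z);
         \<phi> = (\<lambda>z :: complex ^ 'n. complex_of_real (laguerre_fun (CARD('n) - 1) k (norm z)));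
         h = (\<lambda>t. a t * complex_of_real (laguerre_fun (\<gamma> - 1) (k - p) t * t ^ (2 * \<gamma> - 1)))
     in (\<forall>z. integrable lebesgue (twisted_integrand f \<phi> z)) \<and>
        (p \<le> k \<longrightarrow> set_integrable lebesgue {0..} h \<and>
          (\<forall>z. twisted_conv f \<phi> z =
             complex_of_real (1 / (2 * pi) ^ CARD('n)) * C * (LINT t:{0..}|lebesgue. h t) *
             P z * complex_of_real (laguerre_fun (\<gamma> - 1) (k - p) (norm z)))) \<and>
        (k < p \<longrightarrow> (\<forall>z. twisted_conv f \<phi> z = 0)))"
proof -
  define \<alpha> where "\<alpha> = \<gamma> - 1"
  have \<alpha>: "\<alpha> + 1 = CARD('n) + p + q" and \<gamma>: "2 * \<gamma> - 1 = 2 * \<alpha> + 1"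
    using assms zero_less_card_finite[where 'a='n] unfolding \<alpha>_def by linarith+
  define c0 where "c0 = 2 * gauss_integral (\<lambda>_::complex^'n. 1) / 2 ^ (p + q) * (fact (k - p) / fact (\<alpha> + (k - p)))"
  show ?thesis
    unfolding Let_def \<gamma> \<alpha>_def[symmetric]
  \<comment> \<open>The power of \<open>2 * pi\<close> cancels the normalising factor, and \<open>c0\<close> is the constant of \<open>twisted_kernel_integral\<close>.\<close>
  proof (rule exI[of _ "of_real ((2 * pi) ^ CARD('n)) * c0"], intro allI impI)
    fix r :: ennreal and P :: "complex ^ 'n \<Rightarrow> complex" and a :: "real \<Rightarrow> complex"
    assume r: "1 \<le> r" and PH: "P \<in> bigraded_harmonics p q" and P0: "P \<noteq> (\<lambda>z. 0)"
      and Lr: "(\<lambda>z. a (norm z) * P z) \<in> Lr_space r"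
    let ?f = "\<lambda>z. a (norm z) * P z"
    let ?\<phi> = "\<lambda>z :: complex ^ 'n. complex_of_real (laguerre_fun (CARD('n) - 1) k (norm z))"
    let ?h = "\<lambda>t. a t * complex_of_real (laguerre_fun \<alpha> (k - p) t * t ^ (2 * \<alpha> + 1))"
    have bihom: "bihom p q P" and harm: "\<And>x. laplacian P x = 0"
      using PH bihom_bihom_poly[of p q] by (auto simp: bigraded_harmonics_def)
    obtain u0 where nz: "P u0 \<noteq> 0" using P0 by auto
    note cont = polyfun_continuous[OF bihom_polyfun[OF bihom]]
    have [measurable]: "P \<in> borel_measurable borel" by (rule polyfun_borel[OF bihom_polyfun[OF bihom]])
    obtain b where b [measurable]: "b \<in> borel_measurable borel" and ab: "AE t in lborel. 0 < t \<longrightarrow> a t = b t"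
    proof (rule radial_profile_borel[of a P "p + q" u0])
      show "?f \<in> borel_measurable lebesgue" using Lr by (simp add: Lr_space_def)
    qed (use cont nz bihom_homogeneous[OF bihom] in auto)
    let ?F = "\<lambda>u. b (norm u) * P u"
    have fF: "AE u in lborel. ?f u = ?F u"
      using AE_norm[OF ab, where 'a = "complex ^ 'n"] AE_lborel_singleton[of 0] by eventually_elim auto
    have ker: "\<forall>G. exp_growth G \<longrightarrow> G \<in> borel_measurable borel \<longrightarrow>
      integrable lborel (\<lambda>u. ?F u * (G u * of_real (exp (- (norm u)\<^sup>2 / 4))))"
    proof (intro allI impI)
      fix G :: "complex ^ 'n \<Rightarrow> complex"
      assume G: "exp_growth G" and [measurable]: "G \<in> borel_measurable borel"
      obtain M where "\<And>u. norm (G u * of_real (exp (- (1/4) * (norm u)\<^sup>2))) \<le> M * exp (- norm u)"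
        using exp_growth_gauss_bound[OF G, of "1/4"] by auto
      then show "integrable lborel (\<lambda>u. ?F u * (G u * of_real (exp (- (norm u)\<^sup>2 / 4))))"
        by (intro Lr_space_times_exp_decay_integrable[OF Lr r _ fF]) auto
    qed
    note ctx = bihom harm nz \<alpha> b ker
    \<comment> \<open>The integrand after the substitution \<open>w = z - u\<close>, with the Borel representative of the radial factor.\<close>
    define Q where "Q z u = ?F u * (of_real (exp (- (norm z)\<^sup>2 / 4)) * (twisted_kernel k z u * of_real (exp (- (norm u)\<^sup>2 / 4))))" for z u
    have Q: "Q z = (\<lambda>u. of_real (exp (- (norm z)\<^sup>2 / 4)) * (?F u * (twisted_kernel k z u * of_real (exp (- (norm u)\<^sup>2 / 4)))))" for z
      by (simp add: Q_def fun_eq_iff)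
    have intQ: "integrable lborel (Q z)" for z
      unfolding Q
      by (intro integrable_mult_right ker[rule_format] twisted_kernel_exp_growth borel_measurable_continuous_onI twisted_kernel_continuous)
    have [measurable]: "Q z \<in> borel_measurable borel" for z
      using borel_measurable_integrable[OF intQ[of z]] by simp
    have AEQ: "AE w in lborel. twisted_integrand ?f ?\<phi> z w = Q z (z - w)" for z
    proof -
      have "AE w in lborel. ?f (z - w) = ?F (z - w)"
      proof (rule AE_distrD[where f = "\<lambda>w. z - w" and M = lborel and M' = borel])
        show "AE u in distr lborel borel (\<lambda>w. z - w). ?f u = ?F u"
          unfolding lborel_distr_reflect by (rule fF)
      qed measurable
      then show ?thesis
      proof eventually_elim
        fix w assume *: "?f (z - w) = ?F (z - w)"
        have "twisted_integrand ?f ?\<phi> z w = ?f (z - w) * (?\<phi> (z - (z - w)) * exp (\<i> / 2 * of_real (Im (hermitian_dot z (z - (z - w))))))"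
          by (simp add: twisted_integrand_def)
        then show "twisted_integrand ?f ?\<phi> z w = Q z (z - w)"
          unfolding twisted_phase_eq_kernel * Q_def .
      qed
    qed
    have Qz: "integrable lborel (\<lambda>w. Q z (z - w))" "(LINT w|lborel. Q z (z - w)) = (LINT u|lborel. Q z u)" for z
    proof -
      have "integrable (distr lborel borel (\<lambda>w. z - w)) (Q z) \<longleftrightarrow> integrable lborel (\<lambda>w. Q z (z - w))"
        by (rule integrable_distr_eq) auto
      then show "integrable lborel (\<lambda>w. Q z (z - w))"
        unfolding lborel_distr_reflect using intQ by blast
      have "(LINT u|distr lborel borel (\<lambda>w. z - w). Q z u) = (LINT w|lborel. Q z (z - w))"
        by (rule integral_distr) auto
      then show "(LINT w|lborel. Q z (z - w)) = (LINT u|lborel. Q z u)"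
        unfolding lborel_distr_reflect by (rule sym)
    qed
    have int: "integrable lebesgue (twisted_integrand ?f ?\<phi> z)" for z
      by (rule lebesgue_integral_AE_transfer(1)[OF AEQ Qz(1)])
    have conv: "twisted_conv ?f ?\<phi> z = of_real (exp (- (norm z)\<^sup>2 / 4)) *
        (LINT u|lborel. b (norm u) * P u * of_real (exp (- (norm u)\<^sup>2 / 4)) * twisted_kernel k z u)" for z
    proof -
      have "twisted_conv ?f ?\<phi> z = (LINT u|lborel. Q z u)"
        unfolding twisted_conv_def lebesgue_integral_AE_transfer(2)[OF AEQ Qz(1)] Qz(2) ..
      also have "\<dots> = of_real (exp (- (norm z)\<^sup>2 / 4)) *
          (LINT u|lborel. ?F u * (twisted_kernel k z u * of_real (exp (- (norm u)\<^sup>2 / 4))))"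
        unfolding Q by (rule integral_mult_right_zero)
      finally show ?thesis by (simp only: mult_ac)
    qed
    have h: "set_integrable lebesgue {0..} ?h \<and> (LINT t:{0..}|lebesgue. ?h t) =
        (LINT t:{0..}|lborel. b t * of_real (exp (- t\<^sup>2 / 4)) * of_real (t ^ (2 * \<alpha> + 1)) * laguerre \<alpha> (k - p) (of_real (t\<^sup>2 / 2)))"
    proof -
      let ?hb = "\<lambda>t. b t * of_real (exp (- t\<^sup>2 / 4)) * of_real (t ^ (2 * \<alpha> + 1)) * laguerre \<alpha> (k - p) (of_real (t\<^sup>2 / 2))"
      have AEh: "AE t in lborel. indicator {0..} t *\<^sub>R ?h t = indicator {0..} t *\<^sub>R ?hb t"
        using ab AE_lborel_singleton[of "0::real"]
      proof eventually_elim
        fix t :: real assume t: "0 < t \<longrightarrow> a t = b t" "t \<noteq> 0"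
        show "indicator {0..} t *\<^sub>R ?h t = indicator {0..} t *\<^sub>R ?hb t"
        proof (cases "0 < t")
          case True
          with t have "a t = b t" by simp
          then have "?h t = ?hb t"
            unfolding laguerre_fun_def of_real_mult of_real_laguerre_poly by (simp only: mult_ac)
          then show ?thesis by (rule arg_cong)
        qed (use t in simp)
      qed
      note T = lebesgue_integral_AE_transfer[OF AEh laguerre_profile_integrable[OF ctx, of "k - p", unfolded set_integrable_def]]
      show ?thesis
        unfolding set_integrable_def set_lebesgue_integral_def by (rule conjI[OF T])
    qed
    show "(\<forall>z. integrable lebesgue (twisted_integrand ?f ?\<phi> z)) \<and>
        (p \<le> k \<longrightarrow> set_integrable lebesgue {0..} ?h \<and>
          (\<forall>z. twisted_conv ?f ?\<phi> z =
             complex_of_real (1 / (2 * pi) ^ CARD('n)) * (of_real ((2 * pi) ^ CARD('n)) * c0) * (LINT t:{0..}|lebesgue. ?h t) *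
             P z * complex_of_real (laguerre_fun \<alpha> (k - p) (norm z)))) \<and>
        (k < p \<longrightarrow> (\<forall>z. twisted_conv ?f ?\<phi> z = 0))"
    proof (intro conjI impI allI)
      show "twisted_conv ?f ?\<phi> z = 0" if "k < p" for z
        unfolding conv twisted_kernel_integral_eq_0[OF ctx that] by (rule mult_zero_right)
      show "twisted_conv ?f ?\<phi> z =
             complex_of_real (1 / (2 * pi) ^ CARD('n)) * (of_real ((2 * pi) ^ CARD('n)) * c0) * (LINT t:{0..}|lebesgue. ?h t) *
             P z * complex_of_real (laguerre_fun \<alpha> (k - p) (norm z))" if "p \<le> k" for z
      proof -
        have cancel: "complex_of_real (1 / x) * (of_real x * c) = c" if "x \<noteq> 0" for x :: real and c
          using that by (simp add: field_simps)
        have "complex_of_real (1 / (2 * pi) ^ CARD('n)) * (of_real ((2 * pi) ^ CARD('n)) * c0) = c0"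
          by (rule cancel) simp
        moreover have "complex_of_real (laguerre_fun \<alpha> (k - p) (norm z)) =
            laguerre \<alpha> (k - p) (of_real ((norm z)\<^sup>2 / 2)) * of_real (exp (- (norm z)\<^sup>2 / 4))"
          unfolding laguerre_fun_def of_real_mult of_real_laguerre_poly ..
        ultimately show ?thesis
          unfolding conv twisted_kernel_integral[OF ctx that] c0_def conjunct2[OF h] by (simp only: mult_ac)
      qed
      show "integrable lebesgue (twisted_integrand ?f ?\<phi> z)" for z by (rule int)
      show "set_integrable lebesgue {0..} ?h" by (rule conjunct1[OF h])
    qed
  qed
qed

end
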